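(* Let $p>2$ and $\nu>0$. Consider on $\mathbb{T}^2$ the advective $p$-Laplacian equation $$\partial_t\vartheta+v\cdot\nabla\vartheta-\nu\,\nabla\cdot\big(|\nabla\vartheta|^{p-2}\nabla\vartheta\big)=0,\qquad \vartheta(x,0)=\vartheta_0(x),$$ with $\vartheta_0\in L^2_0(\mathbb{T}^2)$ and $\|\vartheta_0\|_{L^2}=1$, and let $\vartheta$ be its (unique) weak solution. Then for any $\tau>0$ there exist a cell size $m$ and an amplitude $A$ (depending on $\tau$, $\|\vartheta_0\|_{L^2}$ and $\nu$) such that, with the cellular flow $v(x)=A\,u(mx)$, $u(x)=\nabla^{\perp}\big(\sin(2\pi x_1)\sin(2\pi x_2)\big)$, $$\|\vartheta(\cdot,\tau)\|_{L^2}\leq\tfrac12 .$$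
   Context: $\nabla^\perp=(-\partial_{x_2},\partial_{x_1})$; $\mathbb{T}^2=[0,1]^2$; $L^2_0(\mathbb{T}^2)$ is the space of mean-zero square-integrable functions. *)

theory Defs
  imports "HOL-Analysis.Analysis"
begin

(* The torus T^2 = [0,1]^2 is modelled by functions on R^2 (= real \<times> real)
   that are 1-periodic in both coordinates; integrals over T^2 are integrals
   over the fundamental cell [0,1]^2 w.r.t. Lebesgue measure. *)

definition cell :: "(real \<times> real) set" where
  "cell = {0..1} \<times> {0..1}"

definition periodic_x :: "(real \<times> real \<Rightarrow> 'a) \<Rightarrow> bool" where
  "periodic_x f \<longleftrightarrow>
     (\<forall>a b (k::int) (l::int). f (a + of_int k, b + of_int l) = f (a, b))"

definition L2norm_cell :: "(real \<times> real \<Rightarrow> real) \<Rightarrow> real" where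
  "L2norm_cell f = sqrt (LINT x:cell|lborel. (f x)^2)"

(* u(x) = \<nabla>^\<perp>(sin(2 pi x1) sin(2 pi x2)) with \<nabla>^\<perp> = (-d/dx2, d/dx1), written out *)
definition cell_flow :: "real \<times> real \<Rightarrow> real \<times> real" where
  "cell_flow x =
     (- (2*pi) * sin (2*pi * fst x) * cos (2*pi * snd x),
        (2*pi) * cos (2*pi * fst x) * sin (2*pi * snd x))"

definition test_function ::
  "(real \<times> real \<Rightarrow> real \<Rightarrow> real) \<Rightarrow> ((real \<times> real) \<times> real \<Rightarrow> (real \<times> real) \<times> real) \<Rightarrow> bool" where
  "test_function \<psi> D \<longleftrightarrow>
     (\<forall>z. ((\<lambda>w. \<psi> (fst w) (snd w)) has_derivative (\<lambda>h. inner (D z) h)) (at z)) \<and>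
     continuous_on UNIV D \<and>
     (\<forall>t. periodic_x (\<lambda>x. \<psi> x t))"

(* Weak solution on [0,\<infinity>) of
     d_t theta + v . grad theta - nu div(|grad theta|^(p-2) grad theta) = 0,  theta(.,0) = theta0
   in the class theta \<in> C([0,T];L^2(T^2)) \<inter> L^p(0,T;W^{1,p}(T^2)) for every T \<ge> 0.
   g is the weak spatial gradient of theta. *)
definition weak_solution ::
  "real \<Rightarrow> real \<Rightarrow> (real \<times> real \<Rightarrow> real \<times> real) \<Rightarrow> (real \<times> real \<Rightarrow> real)
     \<Rightarrow> (real \<times> real \<Rightarrow> real \<Rightarrow> real) \<Rightarrow> bool" where
  "weak_solution p \<nu> v \<theta>0 \<theta> \<longleftrightarrow>
     (\<forall>t. periodic_x (\<lambda>x. \<theta> x t)) \<and>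
     (\<lambda>z. \<theta> (fst z) (snd z)) \<in> borel_measurable lborel \<and>
     (\<forall>t\<ge>0. set_integrable lborel cell (\<lambda>x. (\<theta> x t)^2)) \<and>
     (\<forall>t\<ge>0. ((\<lambda>s. LINT x:cell|lborel. (\<theta> x s - \<theta> x t)^2) \<longlongrightarrow> 0) (at t within {0..})) \<and>
     (AE x in lborel. x \<in> cell \<longrightarrow> \<theta> x 0 = \<theta>0 x) \<and>
     (\<exists>g :: real \<times> real \<Rightarrow> real \<Rightarrow> real \<times> real.
        (\<lambda>z. g (fst z) (snd z)) \<in> borel_measurable lborel \<and>
        (\<forall>T\<ge>0. set_integrable lborel (cell \<times> {0..T}) (\<lambda>z. norm (g (fst z) (snd z)) powr p)) \<and>
        (\<forall>\<psi> D T. test_function \<psi> D \<and> T \<ge> 0 \<longrightarrow>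
            (LINT z:(cell \<times> {0..T})|lborel. \<theta> (fst z) (snd z) *\<^sub>R fst (D z))
            = - (LINT z:(cell \<times> {0..T})|lborel. \<psi> (fst z) (snd z) *\<^sub>R g (fst z) (snd z))) \<and>
        (\<forall>\<psi> D t. test_function \<psi> D \<and> t \<ge> 0 \<longrightarrow>
            (LINT x:cell|lborel. \<theta> x t * \<psi> x t) - (LINT x:cell|lborel. \<theta>0 x * \<psi> x 0)
            = (LINT z:(cell \<times> {0..t})|lborel.
                 \<theta> (fst z) (snd z) * snd (D z)
                 - inner (v (fst z)) (g (fst z) (snd z)) * \<psi> (fst z) (snd z)
                 - \<nu> * norm (g (fst z) (snd z)) powr (p - 2) * inner (g (fst z) (snd z)) (fst (D z)))))"

end

theory Submission
  imports Defs "HOL-Library.Periodic_Fun"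
begin

text \<open>
  Suppose that the $L^2$ norm at time $\tau$ exceeds $1/2$. By the energy identity the gradient is then
  bounded in $L^p$ of space-time, uniformly in $m$, $A$ and the initial datum. The flow vanishes at the corners
  of the grid of mesh $h = 1/(2m)$ and is parallel to its edges (the separatrices). Mollify the
  solution at scale $\rho$. Comparing a point of an edge with the corner, the squared difference, integrated
  in time, has a derivative along the edge that is $O(\rho^{1-2/p}) + O_\rho(1/A)$ up to the factor
  $1/\sin(2\pi m z)$, whose integral is only logarithmic in $\rho$: no mixing inside the cells is needed.
  Hence, on the whole grid, the solution is nearly equal to a function of time alone, and a one-dimensional
  Poincare inequality across the rows of the grid gives a time average of the squared $L^2$ norm of order $h$.
  Choosing $m$, then $\rho$, then $A$ contradicts the monotonicity of the energy.
\<close>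

section \<open>Elementary inequalities\<close>

lemma abs_le_one_plus_power2: "\<bar>a\<bar> \<le> 1 + a\<^sup>2" for a :: real
  using zero_le_power2[of "\<bar>a\<bar> - 1/2"] by (simp add: power2_eq_square algebra_simps)

lemma power2_add_le: "(a + b)\<^sup>2 \<le> 2 * a\<^sup>2 + 2 * b\<^sup>2" for a b :: real
  using sum_squares_bound[of a b] by (simp add: power2_sum)

lemma power2_add3_le: "(a + b + c)\<^sup>2 \<le> 2 * a\<^sup>2 + 4 * b\<^sup>2 + 4 * c\<^sup>2" for a b c :: real
  using power2_add_le[of a "b + c"] power2_add_le[of b c] by (simp add: add.assoc)

lemma abs_inner_le:
  fixes a b :: "'a::real_inner"
  assumes "norm a \<le> C"
  shows "\<bar>a \<bullet> b\<bar> \<le> C * norm b"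
  using Cauchy_Schwarz_ineq2[of a b] mult_right_mono[OF assms, of "norm b"] by simp

lemma norm_prod_power2: "(norm z)\<^sup>2 = (fst z)\<^sup>2 + (snd z)\<^sup>2" for z :: "real \<times> real"
  by (simp add: norm_prod_def)

lemma norm_le_abs_fst_snd: "norm z \<le> \<bar>fst z\<bar> + \<bar>snd z\<bar>" for z :: "real \<times> real"
  using norm_Pair_le[of "fst z" "snd z"] by simp

lemma powr_le_one_plus_powr:
  fixes x a p :: real
  assumes "0 \<le> x" "0 \<le> a" "a \<le> p"
  shows "x powr a \<le> 1 + x powr p"
proof (cases "x \<le> 1")
  case True
  then have "x powr a \<le> 1 powr a" using assms by (intro powr_mono2) auto
  then show ?thesis by (simp add: add_increasing2)
next
  case False
  then have "x powr a \<le> x powr p" using assms by (intro powr_mono) auto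
  then show ?thesis by simp
qed

lemma norm_add_powr_le:
  fixes a b :: "'a::real_normed_vector"
  assumes "p \<ge> 0"
  shows "norm (a + b) powr p \<le> 2 powr p * (norm a powr p + norm b powr p)"
proof -
  define r where "r = max (norm a) (norm b)"
  have "norm (a + b) \<le> 2 * r" using norm_triangle_ineq[of a b] unfolding r_def by linarith
  then have "norm (a + b) powr p \<le> (2 * r) powr p" using assms by (intro powr_mono2) auto
  also have "\<dots> = 2 powr p * r powr p" unfolding r_def by (simp add: powr_mult)
  also have "r powr p \<le> norm a powr p + norm b powr p" unfolding r_def by (auto simp: max_def)
  finally show ?thesis by simp
qed


lemma norm_add3_powr_le:
  fixes a b c :: "'a::real_normed_vector"
  assumes "0 \<le> p"
  shows "norm (a + b + c) powr p \<le> (2 powr p)\<^sup>2 * (norm a powr p + norm b powr p + norm c powr p)"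
proof -
  have "norm (a + b + c) powr p \<le> 2 powr p * (norm a powr p + norm (b + c) powr p)"
    using norm_add_powr_le[OF assms, of a "b + c"] by (simp add: add.assoc)
  also have "\<dots> \<le> 2 powr p * (2 powr p * norm a powr p + 2 powr p * (norm b powr p + norm c powr p))"
    using norm_add_powr_le[OF assms, of b c] mult_right_mono[OF ge_one_powr_ge_zero[of 2 p], of "norm a powr p"] assms
    by (intro mult_left_mono add_mono) auto
  finally show ?thesis by (simp add: power2_eq_square algebra_simps)
qed

lemma powr_ge_tangent:
  fixes p a s :: real
  assumes "p \<ge> 1" "a \<ge> 0" "s \<ge> 0"
  shows "p * a powr (p - 1) * s - (p - 1) * a powr p \<le> s powr p"
proof (cases "p = 1")
  case True
  then show ?thesis using assms by (cases "a = 0") auto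
next
  case False
  then have p: "p > 1" using assms by simp
  define q where "q = p / (p - 1)"
  have q: "q > 1" "1/p + 1/q = 1" unfolding q_def using p by (auto simp: field_simps)
  have "s * a powr (p - 1) \<le> s powr p / p + (a powr (p - 1)) powr q / q"
    by (rule Youngs_inequality) (use assms p q in auto)
  moreover have "(a powr (p - 1)) powr q = a powr p"
    unfolding powr_powr q_def using p by simp
  ultimately have "p * (s * a powr (p - 1)) \<le> p * (s powr p / p + a powr p / q)"
    using p by (intro mult_left_mono) auto
  also have "\<dots> = s powr p + (p - 1) * a powr p"
    unfolding q_def using p by (simp add: field_simps)
  finally show ?thesis by (simp add: algebra_simps)
qed

lemma power2_le_add_powr:
  fixes s c p :: real
  assumes "0 \<le> s" "0 < c" "2 \<le> p"
  shows "s\<^sup>2 \<le> c\<^sup>2 + c powr (2 - p) * s powr p"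
proof (cases "s \<le> c")
  case True
  then have "s\<^sup>2 \<le> c\<^sup>2" using assms by (intro power_mono) auto
  then show ?thesis by (simp add: add_increasing2)
next
  case False
  have "s\<^sup>2 = s powr (2 - p) * s powr p"
    using False assms by (simp flip: powr_add)
  also have "\<dots> \<le> c powr (2 - p) * s powr p"
    using False assms by (intro mult_right_mono powr_mono2') auto
  finally show ?thesis by (simp add: add_increasing)
qed

lemma abs_inner_le_powr_add_powr:
  fixes u v :: "'a::real_inner"
  assumes p: "p > 1" and p': "1/p + 1/p' = 1" and c: "c > 0"
  shows "\<bar>u \<bullet> v\<bar> \<le> c powr p' * norm u powr p' + c powr (- p) * norm v powr p"
proof -
  have "p' > 1"
  proof -
    have "1/p' = 1 - 1/p" "0 < 1/p" "1/p < 1" using p p' by auto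
    then have "0 < 1/p'" "1/p' < 1" by linarith+
    then show ?thesis by (simp add: divide_less_eq_1)
  qed
  have "\<bar>u \<bullet> v\<bar> \<le> norm u * norm v" by (rule Cauchy_Schwarz_ineq2)
  also have "\<dots> = (c * norm u) * (norm v / c)" using c by simp
  also have "\<dots> \<le> (c * norm u) powr p' / p' + (norm v / c) powr p / p"
    by (rule Youngs_inequality) (use p p' \<open>p' > 1\<close> c in auto)
  also have "\<dots> \<le> (c * norm u) powr p' + (norm v / c) powr p"
    using p \<open>p' > 1\<close> by (intro add_mono) (auto simp: divide_le_eq mult_le_cancel_left1)
  also have "\<dots> = c powr p' * norm u powr p' + c powr (- p) * norm v powr p"
    using c by (simp add: powr_mult powr_divide powr_minus_divide)
  finally show ?thesis .
qed

lemma abs_sin_nat_mult_le: "\<bar>sin (real m * x)\<bar> \<le> real m * \<bar>sin x\<bar>"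
proof (induction m)
  case (Suc m)
  have "\<bar>sin (real (Suc m) * x)\<bar> = \<bar>sin (real m * x) * cos x + cos (real m * x) * sin x\<bar>"
    by (simp add: distrib_right sin_add add.commute[of x])
  also have "\<dots> \<le> \<bar>sin (real m * x)\<bar> * \<bar>cos x\<bar> + \<bar>cos (real m * x)\<bar> * \<bar>sin x\<bar>"
    by (metis abs_mult abs_triangle_ineq)
  also have "\<dots> \<le> \<bar>sin (real m * x)\<bar> * 1 + 1 * \<bar>sin x\<bar>"
    by (intro add_mono mult_mono) auto
  finally show ?case using Suc by (simp add: algebra_simps)
qed simp

lemma sin_pi_ge_linear:
  assumes "0 \<le> z" "z \<le> 1/2"
  shows "2 * z \<le> sin (pi * z)"
proof -
  have "concave_on {0..pi/2} sin"
    by (rule f''_le0_imp_concave[where f'=cos and f''="\<lambda>x. - sin x"])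
      (auto intro!: derivative_eq_intros sin_ge_zero)
  from concave_onD[OF this, of "2 * z" 0 "pi/2"] assms
  show ?thesis by (simp add: mult.commute)
qed

lemma abs_sin_pi_ge:
  assumes "\<bar>z\<bar> \<le> 1"
  shows "2 * min \<bar>z\<bar> (1 - \<bar>z\<bar>) \<le> \<bar>sin (pi * z)\<bar>"
proof -
  have abs_arg: "\<bar>sin (pi * z)\<bar> = \<bar>sin (pi * \<bar>z\<bar>)\<bar>" by (auto simp: abs_if)
  show ?thesis
  proof (cases "\<bar>z\<bar> \<le> 1/2")
    case True
    then show ?thesis using sin_pi_ge_linear[of "\<bar>z\<bar>"] abs_arg by auto
  next
    case False
    have "sin (pi * \<bar>z\<bar>) = sin (pi * (1 - \<bar>z\<bar>))"
      by (simp add: right_diff_distrib)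
    then show ?thesis using sin_pi_ge_linear[of "1 - \<bar>z\<bar>"] abs_arg False assms by auto
  qed
qed

lemma DERIV_max_zero_power2: "((\<lambda>x. (max 0 x)\<^sup>2) has_field_derivative 2 * max 0 x) (at x)"
  for x :: real
  unfolding DERIV_def
proof (rule LIM_zero_cancel, rule Lim_null_comparison)
  show "\<forall>\<^sub>F h in at 0. norm (((max 0 (x + h))\<^sup>2 - (max 0 x)\<^sup>2) / h - 2 * max 0 x) \<le> \<bar>h\<bar>"
  proof (rule eventually_mono[OF eventually_at_ball'[of 1 0 UNIV]])
    fix h :: real assume "h \<in> ball 0 1 \<and> h \<noteq> 0 \<and> h \<in> UNIV"
    then have "h \<noteq> 0" by simp
    have "\<bar>(max 0 (x + h))\<^sup>2 - (max 0 x)\<^sup>2 - 2 * max 0 x * h\<bar> \<le> h\<^sup>2"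
    proof (cases "x \<le> 0")
      case True
      then have "(max 0 (x + h))\<^sup>2 \<le> \<bar>h\<bar>\<^sup>2" by (intro power_mono) auto
      then show ?thesis using True by simp
    next
      case False
      show ?thesis
      proof (cases "0 \<le> x + h")
        case True
        then show ?thesis using False by (simp add: power2_sum)
      next
        case x_h: False
        then have "0 \<le> x * (- (x + 2 * h))" "0 \<le> (x + h)\<^sup>2"
          using False by (intro mult_nonneg_nonneg) auto
        then show ?thesis using x_h False by (simp add: power2_eq_square algebra_simps)
      qed
    qed
    then have "\<bar>(max 0 (x + h))\<^sup>2 - (max 0 x)\<^sup>2 - 2 * max 0 x * h\<bar> / \<bar>h\<bar> \<le> \<bar>h\<bar>"
      using \<open>h \<noteq> 0\<close> by (simp add: divide_le_eq power2_eq_square)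
    then show "norm (((max 0 (x + h))\<^sup>2 - (max 0 x)\<^sup>2) / h - 2 * max 0 x) \<le> \<bar>h\<bar>"
      using \<open>h \<noteq> 0\<close> by (simp add: diff_divide_distrib flip: abs_divide)
  qed simp
  show "((\<lambda>h::real. \<bar>h\<bar>) \<longlongrightarrow> 0) (at 0)" by (intro tendsto_rabs_zero tendsto_ident_at)
qed

section \<open>Integrability and parameter integrals\<close>

lemma integrable_dominated:
  fixes f :: "'a \<Rightarrow> 'b::{banach, second_countable_topology}"
    and k :: "'a \<Rightarrow> 'c::{banach, second_countable_topology}"
  assumes "integrable M f" "k \<in> borel_measurable M" "\<And>x. norm (k x) \<le> C * norm (f x)"
  shows "integrable M k"
  by (rule Bochner_Integration.integrable_bound[of M "\<lambda>x. C * norm (f x)"])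
    (use assms in \<open>auto intro!: AE_I2 order_trans[OF _ abs_ge_self]\<close>)

lemma (in finite_measure) integrable_norm_powr_le:
  fixes f :: "'a \<Rightarrow> 'b::{banach, second_countable_topology}"
  assumes "f \<in> borel_measurable M" "integrable M (\<lambda>x. norm (f x) powr p)" "0 \<le> a" "a \<le> p"
  shows "integrable M (\<lambda>x. norm (f x) powr a)"
proof (rule Bochner_Integration.integrable_bound)
  show "integrable M (\<lambda>x. 1 + norm (f x) powr p)" using assms by auto
  show "AE x in M. norm (norm (f x) powr a) \<le> norm (1 + norm (f x) powr p)"
    using assms by (auto intro!: AE_I2 powr_le_one_plus_powr)
qed (use assms in measurable)

lemma (in finite_measure) integrable_of_norm_powr:
  fixes f :: "'a \<Rightarrow> 'b::{banach, second_countable_topology}"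
  assumes "f \<in> borel_measurable M" "integrable M (\<lambda>x. norm (f x) powr p)" "1 \<le> p"
  shows "integrable M f"
  using integrable_norm_powr_le[OF assms(1,2), of 1] assms by (simp add: integrable_norm_iff)

lemma (in finite_measure) integrable_of_norm_power2:
  fixes f :: "'a \<Rightarrow> 'b::{banach, second_countable_topology}"
  assumes "f \<in> borel_measurable M" "integrable M (\<lambda>x. (norm (f x))\<^sup>2)"
  shows "integrable M f"
  by (rule integrable_of_norm_powr[where p = 2]) (use assms in auto)

lemma integrable_mult_of_power2:
  fixes f g :: "'a \<Rightarrow> real"
  assumes "f \<in> borel_measurable M" "g \<in> borel_measurable M"
    and "integrable M (\<lambda>x. (f x)\<^sup>2)" "integrable M (\<lambda>x. (g x)\<^sup>2)"
  shows "integrable M (\<lambda>x. f x * g x)"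
proof (rule Bochner_Integration.integrable_bound)
  show "integrable M (\<lambda>x. (f x)\<^sup>2 + (g x)\<^sup>2)" using assms by auto
  have "\<bar>a * b\<bar> \<le> a\<^sup>2 + b\<^sup>2" for a b :: real
  proof -
    have "2 * (\<bar>a\<bar> * \<bar>b\<bar>) \<le> a\<^sup>2 + b\<^sup>2" using sum_squares_bound[of "\<bar>a\<bar>" "\<bar>b\<bar>"] by simp
    moreover have "0 \<le> \<bar>a\<bar> * \<bar>b\<bar>" by simp
    ultimately show ?thesis unfolding abs_mult by linarith
  qed
  then show "AE x in M. norm (f x * g x) \<le> norm ((f x)\<^sup>2 + (g x)\<^sup>2)" by simp
qed (use assms in auto)

lemma integrable_power2_diff:
  fixes f g :: "'a \<Rightarrow> real"
  assumes "f \<in> borel_measurable M" "g \<in> borel_measurable M"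
    and "integrable M (\<lambda>x. (f x)\<^sup>2)" "integrable M (\<lambda>x. (g x)\<^sup>2)"
  shows "integrable M (\<lambda>x. (f x - g x)\<^sup>2)"
  using integrable_mult_of_power2[OF assms] assms by (simp add: power2_diff mult.assoc)

lemma integral_mult_Cauchy_Schwarz:
  fixes f g :: "'a \<Rightarrow> real"
  assumes "f \<in> borel_measurable M" "g \<in> borel_measurable M"
    and f2: "integrable M (\<lambda>x. (f x)\<^sup>2)" and g2: "integrable M (\<lambda>x. (g x)\<^sup>2)"
  shows "(LINT x|M. f x * g x)\<^sup>2 \<le> (LINT x|M. (f x)\<^sup>2) * (LINT x|M. (g x)\<^sup>2)"
proof -
  define F where "F = (LINT x|M. (f x)\<^sup>2)"
  define G where "G = (LINT x|M. (g x)\<^sup>2)"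
  define P where "P = (LINT x|M. f x * g x)"
  note fg = integrable_mult_of_power2[OF assms]
  show ?thesis
  proof (cases "F = 0")
    case True
    then have "AE x in M. (f x)\<^sup>2 = 0"
      using integral_nonneg_eq_0_iff_AE[OF f2] unfolding F_def by simp
    then have "AE x in M. f x * g x = 0" by eventually_elim simp
    then have "P = 0" unfolding P_def by (rule integral_eq_zero_AE)
    then show ?thesis unfolding P_def by simp
  next
    case False
    then have "F > 0" unfolding F_def by (simp add: order.not_eq_order_implies_strict)
    have "0 \<le> (LINT x|M. (F * g x - P * f x)\<^sup>2)" by simp
    also have "\<dots> = (LINT x|M. F\<^sup>2 * (g x)\<^sup>2 - 2 * F * P * (f x * g x) + P\<^sup>2 * (f x)\<^sup>2)"
      by (simp add: power2_diff power_mult_distrib algebra_simps)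
    also have "\<dots> = F\<^sup>2 * G - 2 * F * P * P + P\<^sup>2 * F"
      using f2 g2 fg unfolding F_def G_def P_def by simp
    also have "\<dots> = F * (F * G - P\<^sup>2)" by (simp add: power2_eq_square algebra_simps)
    finally have "P\<^sup>2 \<le> F * G" using \<open>F > 0\<close> by (simp add: zero_le_mult_iff)
    then show ?thesis unfolding F_def G_def P_def .
  qed
qed

lemma continuous_on_parameter_integral:
  fixes f :: "'a \<Rightarrow> real" and k :: "'c::metric_space \<Rightarrow> 'a \<Rightarrow> 'b::{banach, second_countable_topology}"
  assumes "integrable M f"
    and "\<And>x. k x \<in> borel_measurable M"
    and "\<And>x y. norm (k x y) \<le> f y"
    and cont: "\<And>y. continuous_on UNIV (\<lambda>x. k x y)"
  shows "continuous_on UNIV (\<lambda>x. LINT y|M. k x y)"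
proof (rule continuous_on_sequentiallyI)
  fix u a assume u: "\<forall>n. u n \<in> UNIV" "a \<in> UNIV" "u \<longlonglongrightarrow> (a::'c)"
  show "(\<lambda>n. LINT y|M. k (u n) y) \<longlonglongrightarrow> (LINT y|M. k a y)"
    by (rule integral_dominated_convergence[where w = f])
      (use assms continuous_on_tendsto_compose[OF cont u(3)] in auto)
qed

lemma GDERIV_fst_mult_snd:
  fixes f h :: "real \<Rightarrow> real"
  assumes "(f has_field_derivative f') (at (fst x))" "(h has_field_derivative h') (at (snd x))"
  shows "GDERIV (\<lambda>x. f (fst x) * h (snd x)) x :> (f' * h (snd x), f (fst x) * h')"
proof -
  have "((\<lambda>x. f (fst x) * h (snd x)) has_derivative
      (\<lambda>d. f (fst x) * (snd d * h') + (fst d * f') * h (snd x))) (at x)"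
    by (intro has_derivative_mult DERIV_compose_FDERIV[of f _ fst] DERIV_compose_FDERIV[of h _ snd] assms
        has_derivative_fst has_derivative_snd has_derivative_ident)
  then show ?thesis
    unfolding gderiv_def by (rule has_derivative_eq_rhs) (simp add: fun_eq_iff inner_prod_def algebra_simps)
qed

lemma GDERIV_imp_DERIV_line:
  assumes "\<And>x. GDERIV F x :> G x"
  shows "((\<lambda>z. F (c + z *\<^sub>R e)) has_field_derivative e \<bullet> G (c + z *\<^sub>R e)) (at z)"
proof -
  have "((\<lambda>z. F (c + z *\<^sub>R e)) has_derivative (\<lambda>h. (h *\<^sub>R e) \<bullet> G (c + z *\<^sub>R e))) (at z)"
    by (rule has_derivative_compose[OF _ assms[unfolded gderiv_def]]) (auto intro!: derivative_eq_intros)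
  then show ?thesis
    unfolding has_field_derivative_def by (rule has_derivative_eq_rhs) (simp add: fun_eq_iff mult.commute)
qed

lemma
  fixes F :: "'a::euclidean_space \<Rightarrow> real"
  assumes deriv: "\<And>x. GDERIV F x :> G x" and bound: "\<And>x. norm (G x) \<le> B"
  shows GDERIV_imp_Lipschitz: "\<bar>F z - F x\<bar> \<le> B * norm (z - x)"
    and GDERIV_remainder_quotient_le: "\<bar>(F z - F x - (z - x) \<bullet> G x) / norm (z - x)\<bar> \<le> 2 * B"
proof -
  have "onorm (\<lambda>h. h \<bullet> G x) \<le> B" for x
    by (rule onorm_le) (use abs_inner_le[OF bound] in \<open>simp add: inner_commute\<close>)
  then show Lipschitz: "\<bar>F z - F x\<bar> \<le> B * norm (z - x)"
    using differentiable_bound[where S = UNIV and f = F and f' = "\<lambda>x h. h \<bullet> G x" and B = B] deriv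
    by (simp add: gderiv_def)
  have "\<bar>(z - x) \<bullet> G x\<bar> \<le> B * norm (z - x)"
    using abs_inner_le[OF bound, of x "z - x"] by (simp add: inner_commute)
  with Lipschitz have "\<bar>F z - F x - (z - x) \<bullet> G x\<bar> \<le> (2 * B) * norm (z - x)" by simp
  moreover have "0 \<le> 2 * B" using order_trans[OF norm_ge_zero bound[of x]] by simp
  ultimately show "\<bar>(F z - F x - (z - x) \<bullet> G x) / norm (z - x)\<bar> \<le> 2 * B"
    by (cases "z = x") (simp_all add: abs_divide divide_le_eq)
qed

lemma GDERIV_parameter_integral:
  fixes k :: "'c::euclidean_space \<Rightarrow> 'a \<Rightarrow> real" and k' :: "'c \<Rightarrow> 'a \<Rightarrow> 'c"
  assumes f: "integrable M f"
    and k: "\<And>x. integrable M (k x)"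
    and k': "\<And>x. k' x \<in> borel_measurable M"
    and AE_S: "AE y in M. y \<in> S"
    and bound: "\<And>x y. y \<in> S \<Longrightarrow> norm (k' x y) \<le> f y"
    and deriv: "\<And>x y. y \<in> S \<Longrightarrow> GDERIV (\<lambda>x. k x y) x :> k' x y"
  shows "GDERIV (\<lambda>x. LINT y|M. k x y) x :> (LINT y|M. k' x y)"
  unfolding gderiv_def has_derivative_iff_norm
proof
  show "bounded_linear (\<lambda>h. h \<bullet> (LINT y|M. k' x y))" by (rule bounded_linear_inner_left)
  have k'_integrable: "integrable M (k' x)"
    by (rule Bochner_Integration.integrable_bound[OF f k'])
      (use AE_S in eventually_elim, auto intro: order_trans[OF bound abs_ge_self])
  define r where "r z y = (k z y - k x y - (z - x) \<bullet> k' x y) / norm (z - x)" for z y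
  have r_integral: "norm ((LINT y|M. k z y) - (LINT y|M. k x y) - (z - x) \<bullet> (LINT y|M. k' x y)) / norm (z - x)
      = \<bar>LINT y|M. r z y\<bar>" for z
    unfolding r_def using k k'_integrable by (simp add: abs_divide)

  have "((\<lambda>z. \<bar>LINT y|M. r z y\<bar>) \<longlongrightarrow> 0) (at x)"
    unfolding tendsto_at_iff_sequentially comp_def
  proof (intro allI impI tendsto_rabs_zero)
    fix X :: "nat \<Rightarrow> 'c" assume X: "\<forall>i. X i \<in> UNIV - {x}" "X \<longlonglongrightarrow> x"
    have "(\<lambda>i. LINT y|M. r (X i) y) \<longlonglongrightarrow> (LINT y|M. 0)"
    proof (rule integral_dominated_convergence[where w = "\<lambda>y. 2 * f y"])
      show "AE y in M. (\<lambda>i. r (X i) y) \<longlonglongrightarrow> 0"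
        using AE_S
      proof eventually_elim
        case (elim y)
        have "((\<lambda>z. \<bar>r z y\<bar>) \<longlongrightarrow> 0) (at x)"
          using deriv[OF elim, of x] unfolding gderiv_def has_derivative_iff_norm r_def by (simp add: abs_divide)
        then have "((\<lambda>z. r z y) \<longlongrightarrow> 0) (at x)" by (rule tendsto_rabs_zero_cancel)
        then show ?case
          using X unfolding tendsto_at_iff_sequentially comp_def by blast
      qed
      show "r (X i) \<in> borel_measurable M" for i
        unfolding r_def using k[THEN borel_measurable_integrable] k' by measurable
      show "AE y in M. norm (r (X i) y) \<le> 2 * f y" for i
        using AE_S by eventually_elim (simp only: r_def real_norm_def GDERIV_remainder_quotient_le[OF deriv bound])
    qed (use f in auto)
    then show "(\<lambda>i. LINT y|M. r (X i) y) \<longlonglongrightarrow> 0" by simp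
  qed
  then show "((\<lambda>z. norm ((LINT y|M. k z y) - (LINT y|M. k x y) - (z - x) \<bullet> (LINT y|M. k' x y)) / norm (z - x)) \<longlongrightarrow> 0) (at x)"
    unfolding r_integral .
qed

section \<open>Lebesgue measure on the torus and on time intervals\<close>

definition lborel_on :: "'a::euclidean_space set \<Rightarrow> 'a measure" where
  "lborel_on A = density lborel (\<lambda>x. ennreal (indicator A x))"

abbreviation circle :: "real measure" where
  "circle \<equiv> lborel_on {0..1}"

abbreviation torus :: "(real \<times> real) measure" where
  "torus \<equiv> lborel_on cell"

abbreviation time :: "real \<Rightarrow> real measure" where
  "time T \<equiv> lborel_on {0..T}"

abbreviation spacetime :: "real \<Rightarrow> ((real \<times> real) \<times> real) measure" where
  "spacetime T \<equiv> torus \<Otimes>\<^sub>M time T"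

lemma sets_lborel_on [simp, measurable_cong]: "sets (lborel_on A) = sets borel"
  and space_lborel_on [simp]: "space (lborel_on A) = UNIV"
  unfolding lborel_on_def by simp_all

lemma AE_lborel_on:
  assumes "A \<in> sets borel"
  shows "(AE x in lborel_on A. P x) \<longleftrightarrow> (AE x in lborel. x \<in> A \<longrightarrow> P x)"
  unfolding lborel_on_def by (subst AE_density) (use assms in \<open>auto simp: indicator_def\<close>)

lemma
  fixes f :: "'a::euclidean_space \<Rightarrow> 'b::{banach, second_countable_topology}"
  assumes "f \<in> borel_measurable borel" "A \<in> sets borel"
  shows integral_lborel_on: "(LINT x|lborel_on A. f x) = (LINT x:A|lborel. f x)"
    and integrable_lborel_on: "integrable (lborel_on A) f \<longleftrightarrow> set_integrable lborel A f"
  using assms unfolding lborel_on_def set_lebesgue_integral_def set_integrable_def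
  by (auto simp: integral_density integrable_density)

lemma emeasure_lborel_on_UNIV:
  assumes "A \<in> sets borel"
  shows "emeasure (lborel_on A) UNIV = emeasure lborel A"
  unfolding lborel_on_def by (subst emeasure_density) (use assms in \<open>auto simp: ennreal_indicator\<close>)

lemma finite_measure_lborel_on:
  assumes "A \<in> sets borel" "bounded A"
  shows "finite_measure (lborel_on A)"
  by standard (use assms emeasure_bounded_finite[OF assms(2)] in \<open>simp add: emeasure_lborel_on_UNIV less_top\<close>)

lemma lborel_on_Times:
  assumes "A \<in> sets borel" "B \<in> sets borel" "bounded B"
  shows "lborel_on A \<Otimes>\<^sub>M lborel_on B = lborel_on (A \<times> B)"
proof -
  interpret B: finite_measure "lborel_on B" by (rule finite_measure_lborel_on[OF assms(2,3)])
  have "lborel_on A \<Otimes>\<^sub>M lborel_on B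
      = density (lborel \<Otimes>\<^sub>M lborel) (\<lambda>(x, y). ennreal (indicator A x) * ennreal (indicator B y))"
    unfolding lborel_on_def using assms
    by (intro pair_measure_density)
      (auto simp flip: lborel_on_def intro: B.sigma_finite_measure_axioms sigma_finite_lborel)
  also have "\<dots> = density (lborel \<Otimes>\<^sub>M lborel) (\<lambda>z. ennreal (indicator (A \<times> B) z))"
    by (rule density_cong) (use assms in measurable, auto simp: indicator_def)
  finally show ?thesis unfolding lborel_on_def lborel_prod .
qed

lemma integrable_lborel_on_compact:
  fixes f :: "'a::euclidean_space \<Rightarrow> 'b::{banach, second_countable_topology}"
  assumes "continuous_on UNIV f" "compact K"
  shows "integrable (lborel_on K) f"
proof -
  have "set_integrable lborel K f"
    unfolding set_integrable_def
    using borel_integrable_compact[OF assms(2) continuous_on_subset[OF assms(1)]] by simp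
  then show ?thesis
    using integrable_lborel_on[OF borel_measurable_continuous_onI[OF assms(1)] borel_compact[OF assms(2)]] by simp
qed

lemma cell_sets [measurable]: "cell \<in> sets borel"
  and cell_Times_sets [measurable]: "cell \<times> {0..T::real} \<in> sets borel"
  and compact_cell: "compact cell"
  unfolding cell_def by (auto intro!: borel_Times compact_Times)

lemma torus_eq_circle_circle: "torus = circle \<Otimes>\<^sub>M circle"
  unfolding cell_def by (rule lborel_on_Times[symmetric]) auto

lemma spacetime_eq: "spacetime T = lborel_on (cell \<times> {0..T})"
  by (rule lborel_on_Times) auto

lemma sets_spacetime [simp, measurable_cong]: "sets (spacetime T) = sets borel"
  unfolding spacetime_eq by simp

lemma measure_time_UNIV [simp]: "0 \<le> T \<Longrightarrow> measure (time T) UNIV = T"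
  by (simp add: measure_def emeasure_lborel_on_UNIV)

lemma measure_torus_UNIV [simp]: "measure torus UNIV = 1"
proof -
  have "emeasure lborel ({0..1} \<times> {0..1} :: (real \<times> real) set)
      = emeasure (lborel :: real measure) {0..1} * emeasure (lborel :: real measure) {0..1}"
    unfolding lborel_prod[symmetric] by (rule lborel.emeasure_pair_measure_Times) auto
  then show ?thesis using emeasure_lborel_on_UNIV[OF cell_sets] by (simp add: measure_def cell_def)
qed

interpretation time: finite_measure "time T" for T
  by (rule finite_measure_lborel_on) auto

interpretation torus: finite_measure torus
  by (rule finite_measure_lborel_on) (auto intro: compact_imp_bounded compact_cell)

interpretation time_time: pair_sigma_finite "time S" "time T" for S T ..

interpretation torus_torus: pair_sigma_finite torus torus ..

interpretation spacetime: pair_sigma_finite torus "time T" for T ..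

interpretation timespace: pair_sigma_finite "time T" torus for T ..

interpretation spacetime: finite_measure "spacetime T" for T
  unfolding spacetime_eq
  by (rule finite_measure_lborel_on) (auto intro: bounded_Times compact_imp_bounded compact_cell)

lemma AE_time: "AE t in time T. 0 \<le> t \<and> t \<le> T"
  by (simp add: AE_lborel_on)

lemma AE_torus_cell: "AE x in torus. x \<in> cell"
  by (simp add: AE_lborel_on)

lemma AE_torus_interior: "AE x in torus. x \<in> {0<..<1} \<times> {0<..<1}"
proof -
  have circle_interior: "AE a in circle. a \<in> {0<..<1}"
    using AE_lborel_singleton[of 0] AE_lborel_singleton[of 1] by (auto simp: AE_lborel_on elim: eventually_elim2)
  then have "AE a in circle. AE b in circle. (a, b) \<in> {0<..<1} \<times> {0<..<1}"
    by eventually_elim (use circle_interior in \<open>auto elim: eventually_mono\<close>)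
  moreover have "{x \<in> space (circle \<Otimes>\<^sub>M circle). x \<in> {0<..<1} \<times> {0<..<1}} \<in> sets (circle \<Otimes>\<^sub>M circle)"
    by measurable
  ultimately show ?thesis
    unfolding torus_eq_circle_circle by (intro time_time.AE_pair_measure)
qed

lemma measurable_fst_borel [measurable]: "fst \<in> (borel :: ('a::topological_space \<times> 'b::topological_space) measure) \<rightarrow>\<^sub>M borel"
  and measurable_snd_borel [measurable]: "snd \<in> (borel :: ('a::topological_space \<times> 'b::topological_space) measure) \<rightarrow>\<^sub>M borel"
  by (intro borel_measurable_continuous_onI continuous_intros)+

lemma
  fixes f :: "real \<times> real \<Rightarrow> 'b::{banach, second_countable_topology}"
  assumes "continuous_on UNIV f"
  shows integrable_torus_continuous: "integrable torus f"
    and integral_torus_rows: "(LINT x|torus. f x) = (LINT a|circle. LINT b|circle. f (a, b))"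
    and integral_torus_columns: "(LINT x|torus. f x) = (LINT b|circle. LINT a|circle. f (a, b))"
proof -
  show "integrable torus f" by (rule integrable_lborel_on_compact[OF assms compact_cell])
  then have pair: "integrable (circle \<Otimes>\<^sub>M circle) (case_prod (\<lambda>a b. f (a, b)))"
    unfolding torus_eq_circle_circle by simp
  show "(LINT x|torus. f x) = (LINT a|circle. LINT b|circle. f (a, b))"
    using time_time.integral_fst[OF pair] unfolding torus_eq_circle_circle by simp
  show "(LINT x|torus. f x) = (LINT b|circle. LINT a|circle. f (a, b))"
    using time_time.integral_snd[OF pair] unfolding torus_eq_circle_circle by simp
qed

lemma
  fixes f :: "real \<Rightarrow> 'b::{banach, second_countable_topology}"
  assumes "integrable circle f"
  shows integrable_torus_fst: "integrable torus (\<lambda>x. f (fst x))"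
    and integral_torus_fst: "(LINT x|torus. f (fst x)) = (LINT a|circle. f a)"
    and integrable_torus_snd: "integrable torus (\<lambda>x. f (snd x))"
    and integral_torus_snd: "(LINT x|torus. f (snd x)) = (LINT b|circle. f b)"
proof -
  have [measurable]: "f \<in> borel_measurable borel" using assms by auto
  show row: "integrable torus (\<lambda>x. f (fst x))"
    unfolding torus_eq_circle_circle
    by (rule time_time.Fubini_integrable) (use assms in auto)
  show column: "integrable torus (\<lambda>x. f (snd x))"
    unfolding torus_eq_circle_circle
    by (rule time_time.Fubini_integrable) (use assms in auto)
  show "(LINT x|torus. f (fst x)) = (LINT a|circle. f a)"
    using time_time.integral_fst'[OF row[unfolded torus_eq_circle_circle]] unfolding torus_eq_circle_circle by simp
  show "(LINT x|torus. f (snd x)) = (LINT b|circle. f b)"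
    using time_time.integral_fst'[OF column[unfolded torus_eq_circle_circle]] unfolding torus_eq_circle_circle by simp
qed

lemma
  fixes f :: "real \<times> real \<Rightarrow> real"
  assumes "continuous_on UNIV f"
  shows integrable_torus_row_integral: "integrable torus (\<lambda>x. LINT w|circle. f (fst x, w))"
    and integral_torus_row_integral: "(LINT x|torus. LINT w|circle. f (fst x, w)) = (LINT x|torus. f x)"
    and integrable_torus_column_integral: "integrable torus (\<lambda>x. LINT w|circle. f (w, snd x))"
    and integral_torus_column_integral: "(LINT x|torus. LINT w|circle. f (w, snd x)) = (LINT x|torus. f x)"
proof -
  have pair: "integrable (circle \<Otimes>\<^sub>M circle) (case_prod (\<lambda>a b. f (a, b)))"
    using integrable_torus_continuous[OF assms] unfolding torus_eq_circle_circle by simp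
  note rows = time_time.integrable_fst[OF pair] and columns = time_time.integrable_snd[OF pair]
  show "integrable torus (\<lambda>x. LINT w|circle. f (fst x, w))" "integrable torus (\<lambda>x. LINT w|circle. f (w, snd x))"
    by (rule integrable_torus_fst[OF rows] integrable_torus_snd[OF columns])+
  show "(LINT x|torus. LINT w|circle. f (fst x, w)) = (LINT x|torus. f x)"
    using integral_torus_fst[OF rows] integral_torus_rows[OF assms] by simp
  show "(LINT x|torus. LINT w|circle. f (w, snd x)) = (LINT x|torus. f x)"
    using integral_torus_snd[OF columns] integral_torus_columns[OF assms] by simp
qed

lemma integrable_spacetimeI:
  fixes f :: "real \<times> real \<Rightarrow> real \<Rightarrow> 'b::{banach, second_countable_topology}"
  assumes [measurable]: "(\<lambda>z. f (fst z) (snd z)) \<in> borel_measurable borel"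
    and slices: "AE t in time T. integrable torus (\<lambda>x. f x t)"
    and norms: "integrable (time T) (\<lambda>t. LINT x|torus. norm (f x t))"
  shows "integrable (spacetime T) (\<lambda>(x, t). f x t)"
proof -
  have meas: "(\<lambda>z. f (fst z) (snd z)) \<in> borel_measurable (spacetime T)" by simp
  have swap: "(\<lambda>w. (snd w, fst w)) \<in> time T \<Otimes>\<^sub>M torus \<rightarrow>\<^sub>M spacetime T" by measurable
  have "(\<lambda>w. f (snd w) (fst w)) \<in> borel_measurable (time T \<Otimes>\<^sub>M torus)"
    using measurable_compose[OF swap meas] by simp
  then have "integrable (time T \<Otimes>\<^sub>M torus) (\<lambda>w. f (snd w) (fst w))"
    by (rule timespace.Fubini_integrable) (use slices norms in auto)
  from timespace.integrable_product_swap[OF this] show ?thesis by (simp add: split_beta')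
qed

section \<open>Calculus on intervals\<close>

lemma integral_time_deriv:
  fixes \<phi> \<phi>' :: "real \<Rightarrow> real"
  assumes "\<And>s. (\<phi> has_field_derivative \<phi>' s) (at s)" and cont: "continuous_on UNIV \<phi>'" and "s \<le> t"
  shows "(LINT w|lborel_on {s..t}. \<phi>' w) = \<phi> t - \<phi> s"
proof -
  have "integral\<^sup>L lborel (\<lambda>w. indicator {s..t} w *\<^sub>R \<phi>' w) = \<phi> t - \<phi> s"
    by (rule integral_FTC_atLeastAtMost)
      (use assms in \<open>auto simp flip: has_real_derivative_iff_has_vector_derivative
        intro: has_field_derivative_at_within continuous_on_subset\<close>)
  then show ?thesis
    using integral_lborel_on[OF borel_measurable_continuous_onI[OF cont], of "{s..t}"]
    by (simp add: set_lebesgue_integral_def)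
qed

lemma integral_lborel_on_mono_set:
  fixes f :: "'a::euclidean_space \<Rightarrow> real"
  assumes "integrable (lborel_on B) f" "A \<in> sets borel" "B \<in> sets borel" "A \<subseteq> B" "\<And>x. 0 \<le> f x"
  shows "(LINT x|lborel_on A. f x) \<le> (LINT x|lborel_on B. f x)"
proof -
  have f: "f \<in> borel_measurable borel" using assms(1) by auto
  have B: "set_integrable lborel B f" using integrable_lborel_on[OF f assms(3)] assms(1) by simp
  then have "set_integrable lborel A f" by (rule set_integrable_subset) (use assms in auto)
  with B show ?thesis
    unfolding integral_lborel_on[OF f assms(2)] integral_lborel_on[OF f assms(3)]
      set_lebesgue_integral_def set_integrable_def
    by (intro integral_mono) (use assms in \<open>auto simp: indicator_def\<close>)
qed

lemma power2_diff_le_integral_deriv: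
  fixes \<phi> \<phi>' :: "real \<Rightarrow> real"
  assumes deriv: "\<And>s. (\<phi> has_field_derivative \<phi>' s) (at s)" and cont: "continuous_on UNIV \<phi>'"
    and st: "s \<in> {0..1}" "t \<in> {0..1}"
  shows "(\<phi> s - \<phi> t)\<^sup>2 \<le> \<bar>s - t\<bar> * (LINT w|circle. (\<phi>' w)\<^sup>2)"
  using st
proof (induction s t rule: linorder_wlog)
  case (le s t)
  have [continuous_intros]: "continuous_on A \<phi>'" for A using cont continuous_on_subset by blast
  have [measurable]: "\<phi>' \<in> borel_measurable borel" using cont by (rule borel_measurable_continuous_onI)
  have integrable: "integrable (lborel_on {a..b}) (\<lambda>w. (\<phi>' w)\<^sup>2)" for a b
    by (intro integrable_lborel_on_compact continuous_intros) simp
  interpret finite_measure "lborel_on {s..t}" by (rule finite_measure_lborel_on) auto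
  have "(\<phi> s - \<phi> t)\<^sup>2 = (LINT w|lborel_on {s..t}. 1 * \<phi>' w)\<^sup>2"
    using integral_time_deriv[OF deriv cont le(1)] by (simp add: power2_commute)
  also have "\<dots> \<le> (LINT w|lborel_on {s..t}. 1\<^sup>2) * (LINT w|lborel_on {s..t}. (\<phi>' w)\<^sup>2)"
    by (rule integral_mult_Cauchy_Schwarz) (use integrable in auto)
  also have "(LINT w|lborel_on {s..t}. 1\<^sup>2) = \<bar>s - t\<bar>"
    using le(1) by (simp add: measure_def emeasure_lborel_on_UNIV)
  also have "\<bar>s - t\<bar> * (LINT w|lborel_on {s..t}. (\<phi>' w)\<^sup>2) \<le> \<bar>s - t\<bar> * (LINT w|circle. (\<phi>' w)\<^sup>2)"
    by (intro mult_left_mono integral_lborel_on_mono_set integrable) (use le in auto)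
  finally show ?case .
next
  case (sym s t)
  then show ?case by (simp add: power2_commute abs_minus_commute)
qed

lemma periodic_power2_diff_le:
  fixes \<phi> \<phi>' :: "real \<Rightarrow> real"
  assumes deriv: "\<And>s. (\<phi> has_field_derivative \<phi>' s) (at s)" and cont: "continuous_on UNIV \<phi>'"
    and periodic: "\<phi> 0 = \<phi> 1"
    and st: "s \<in> {0..1}" "t \<in> {0..1}" and close: "\<bar>sin (pi * (s - t))\<bar> \<le> r"
  shows "(\<phi> s - \<phi> t)\<^sup>2 \<le> r * (LINT w|circle. (\<phi>' w)\<^sup>2)"
proof -
  let ?I = "LINT w|circle. (\<phi>' w)\<^sup>2"
  have "\<bar>s - t\<bar> \<le> 1" using st by (auto simp: abs_le_iff)
  then have min_le: "2 * min \<bar>s - t\<bar> (1 - \<bar>s - t\<bar>) \<le> r"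
    using abs_sin_pi_ge close by (meson order_trans)
  show ?thesis
  proof (cases "\<bar>s - t\<bar> \<le> 1 - \<bar>s - t\<bar>")
    case True
    have "\<bar>s - t\<bar> \<le> 2 * \<bar>s - t\<bar>" by simp
    also have "\<dots> \<le> r" using min_le True by simp
    finally have "\<bar>s - t\<bar> \<le> r" .
    then have "\<bar>s - t\<bar> * ?I \<le> r * ?I" by (intro mult_right_mono) auto
    then show ?thesis using power2_diff_le_integral_deriv[OF deriv cont st] by linarith
  next
    case False
    then have "2 * (1 - \<bar>s - t\<bar>) \<le> r" using min_le by simp
    then show ?thesis
      using st
    proof (induction s t rule: linorder_wlog)
      case (le s t)
      have "(\<phi> s - \<phi> t)\<^sup>2 = ((\<phi> s - \<phi> 0) + (\<phi> 1 - \<phi> t))\<^sup>2" using periodic by simp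
      also have "\<dots> \<le> 2 * (\<phi> s - \<phi> 0)\<^sup>2 + 2 * (\<phi> 1 - \<phi> t)\<^sup>2" by (rule power2_add_le)
      also have "\<dots> \<le> 2 * (\<bar>s - 0\<bar> * ?I) + 2 * (\<bar>1 - t\<bar> * ?I)"
        by (intro add_mono mult_left_mono power2_diff_le_integral_deriv[OF deriv cont]) (use le in auto)
      also have "\<dots> = 2 * (1 - \<bar>s - t\<bar>) * ?I" using le by (simp add: algebra_simps)
      also have "\<dots> \<le> r * ?I" using le by (intro mult_right_mono) auto
      finally show ?case .
    next
      case (sym s t)
      then show ?case by (simp add: power2_commute abs_minus_commute)
    qed
  qed
qed

lemma integral_periodic_shift:
  fixes f :: "real \<Rightarrow> real"
  assumes cont: "continuous_on UNIV f" and periodic: "\<And>x. f (x + 1) = f x"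
  shows "integral {a..a + 1} f = integral {0..1} f"
proof -
  interpret periodic_fun_simple' f using periodic by unfold_locales
  define k where "k = \<lfloor>a\<rfloor>"
  have k: "of_int k \<le> a" "a \<le> of_int k + 1" unfolding k_def by linarith+
  have shift: "integral {c..d} f = integral {c + of_int j..d + of_int j} f" for c d j
    using integral_shift_Icc_real[of c d f "of_int j"] by (simp add: comp_def add.commute[of "of_int j"] plus_of_int)
  have integrable: "f integrable_on {c..d}" for c d
    by (intro integrable_continuous_interval continuous_on_subset[OF cont]) simp
  have "integral {a..a + 1} f = integral {a..of_int k + 1} f + integral {of_int k + 1..a + 1} f"
    using k by (intro Henstock_Kurzweil_Integration.integral_combine[symmetric] integrable) auto
  also have "\<dots> = integral {of_int k..a} f + integral {a..of_int k + 1} f"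
    using shift[of "of_int k" a 1] by simp
  also have "\<dots> = integral {of_int k..of_int k + 1} f"
    using k by (intro Henstock_Kurzweil_Integration.integral_combine integrable) auto
  also have "\<dots> = integral {0..1} f" using shift[of 0 1 k] by (simp add: add.commute)
  finally show ?thesis .
qed

section \<open>A periodic mollifier\<close>

definition radius :: "nat \<Rightarrow> real" where
  "radius n = inverse (real (Suc n))"

text \<open>A function of $\sin^2(\pi z)$ only, so that periodicity needs no summation over the lattice.\<close>

definition profile :: "nat \<Rightarrow> real \<Rightarrow> real" where
  "profile n z = (max 0 (1 - (sin (pi * z) / radius n)\<^sup>2))\<^sup>2"

definition profile_mass :: "nat \<Rightarrow> real" where
  "profile_mass n = integral {0..1} (profile n)"

definition kernel1 :: "nat \<Rightarrow> real \<Rightarrow> real" where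
  "kernel1 n z = profile n z / profile_mass n"

definition kernel1_deriv :: "nat \<Rightarrow> real \<Rightarrow> real" where
  "kernel1_deriv n z = - (4 * pi * max 0 (1 - (sin (pi * z) / radius n)\<^sup>2) * (sin (pi * z) * cos (pi * z)))
     / ((radius n)\<^sup>2 * profile_mass n)"

definition kernel :: "nat \<Rightarrow> real \<times> real \<Rightarrow> real" where
  "kernel n z = kernel1 n (fst z) * kernel1 n (snd z)"

definition kernel_grad :: "nat \<Rightarrow> real \<times> real \<Rightarrow> real \<times> real" where
  "kernel_grad n z = (kernel1_deriv n (fst z) * kernel1 n (snd z), kernel1 n (fst z) * kernel1_deriv n (snd z))"

definition kernel_bound :: "nat \<Rightarrow> real" where
  "kernel_bound n = 256 / (radius n)\<^sup>2"

definition kernel_grad_bound :: "nat \<Rightarrow> real" where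
  "kernel_grad_bound n = (SUP z. norm (kernel_grad n z))"

lemma radius_pos [simp]: "0 < radius n"
  and radius_nonzero [simp]: "radius n \<noteq> 0"
  and radius_le_1: "radius n \<le> 1"
  unfolding radius_def by (auto simp: inverse_le_1_iff)

lemma radius_tendsto_0: "radius \<longlonglongrightarrow> 0"
  unfolding radius_def by (rule LIMSEQ_inverse_real_of_nat)

lemma continuous_on_profile [continuous_intros]:
  fixes f :: "'a::t2_space \<Rightarrow> real"
  assumes "continuous_on A f"
  shows "continuous_on A (\<lambda>x. profile n (f x))"
  unfolding profile_def by (intro continuous_intros assms) auto

lemma profile_nonneg: "0 \<le> profile n z"
  and profile_le_1: "profile n z \<le> 1"
  unfolding profile_def by (auto intro: power_le_one)

lemma profile_mass_ge: "radius n / 16 \<le> profile_mass n"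
proof -
  define d where "d = radius n / 8"
  have d: "0 < d" "d \<le> 1" unfolding d_def using radius_le_1[of n] by auto
  have profile_ge: "1/2 \<le> profile n z" if "z \<in> {0..d}" for z
  proof -
    have "\<bar>sin (pi * z)\<bar> \<le> pi * z" using abs_sin_x_le_abs_x[of "pi * z"] that by simp
    also have "\<dots> \<le> 4 * d" using that pi_less_4 by (intro mult_mono) auto
    finally have "\<bar>sin (pi * z) / radius n\<bar> \<le> 1/2" unfolding d_def by (simp add: divide_le_eq)
    then have "(sin (pi * z) / radius n)\<^sup>2 \<le> (1/2)\<^sup>2" by (simp only: power2_le_iff_abs_le)
    also have "(1/2)\<^sup>2 = (1/4 :: real)" by (simp add: power2_eq_square)
    finally have "3/4 \<le> max 0 (1 - (sin (pi * z) / radius n)\<^sup>2)" by linarith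
    then have "(3/4)\<^sup>2 \<le> profile n z" unfolding profile_def by (rule power_mono) simp
    then show ?thesis by (simp add: power2_eq_square)
  qed
  have integrable: "profile n integrable_on {a..b}" for a b
    by (intro integrable_continuous_interval continuous_intros)
  have "radius n / 16 = integral {0..d} (\<lambda>z. 1/2)" using d(1) by (simp add: d_def less_imp_le)
  also have "\<dots> \<le> integral {0..d} (profile n)"
    by (intro integral_le integrable profile_ge) auto
  also have "\<dots> \<le> profile_mass n"
    unfolding profile_mass_def using d by (intro integral_subset_le integrable) (auto simp: profile_nonneg)
  finally show ?thesis .
qed

lemma profile_mass_pos [simp]: "0 < profile_mass n"
  and profile_mass_nonzero [simp]: "profile_mass n \<noteq> 0"
  using profile_mass_ge[of n] radius_pos[of n] by linarith+

lemma kernel1_nonneg: "0 \<le> kernel1 n z"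
  unfolding kernel1_def by (simp add: profile_nonneg less_imp_le)

lemma kernel1_le: "kernel1 n z \<le> 16 / radius n"
proof -
  have "kernel1 n z \<le> 1 / profile_mass n"
    unfolding kernel1_def by (intro divide_right_mono profile_le_1) (simp add: less_imp_le)
  also have "\<dots> \<le> 1 / (radius n / 16)"
    by (intro divide_left_mono profile_mass_ge mult_pos_pos) auto
  finally show ?thesis by simp
qed

lemma kernel1_support:
  assumes "kernel1 n z \<noteq> 0"
  shows "\<bar>sin (pi * z)\<bar> \<le> radius n"
proof -
  have "(sin (pi * z) / radius n)\<^sup>2 \<le> 1\<^sup>2"
    using assms unfolding kernel1_def profile_def by (auto simp: max_def split: if_splits)
  then have "\<bar>sin (pi * z) / radius n\<bar> \<le> 1" by (simp only: power2_le_iff_abs_le)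
  then show ?thesis by (simp add: abs_divide divide_le_eq abs_of_pos)
qed

lemma continuous_on_kernel1 [continuous_intros]:
  fixes f :: "'a::t2_space \<Rightarrow> real"
  assumes "continuous_on A f"
  shows "continuous_on A (\<lambda>x. kernel1 n (f x))" "continuous_on A (\<lambda>x. kernel1_deriv n (f x))"
  unfolding kernel1_def kernel1_deriv_def by (intro continuous_intros assms; simp)+

lemma DERIV_kernel1: "(kernel1 n has_field_derivative kernel1_deriv n z) (at z)"
proof -
  define b where "b z = 1 - (sin (pi * z) / radius n)\<^sup>2" for z
  have "(b has_field_derivative - (2 * pi * (sin (pi * z) * cos (pi * z)) / (radius n)\<^sup>2)) (at z)"
    unfolding b_def by (auto intro!: derivative_eq_intros simp: field_simps power2_eq_square)
  from DERIV_cdivide[OF DERIV_chain2[OF DERIV_max_zero_power2 this], of "profile_mass n"]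
  show ?thesis
    unfolding kernel1_def[abs_def] kernel1_deriv_def profile_def b_def by (simp add: field_simps)
qed

lemma kernel1_plus_int:
  shows "kernel1 n (z + of_int k) = kernel1 n z"
    and "kernel1_deriv n (z + of_int k) = kernel1_deriv n z"
proof -
  have "sin (pi * (x + 1)) = - sin (pi * x)" "cos (pi * (x + 1)) = - cos (pi * x)" for x
    by (simp_all add: distrib_left)
  then interpret k: periodic_fun_simple' "kernel1 n" + d: periodic_fun_simple' "kernel1_deriv n"
    by unfold_locales (simp_all add: kernel1_def profile_def kernel1_deriv_def)
  show "kernel1 n (z + of_int k) = kernel1 n z" "kernel1_deriv n (z + of_int k) = kernel1_deriv n z"
    by (rule k.plus_of_int d.plus_of_int)+
qed

lemma kernel1_commute:
  shows "kernel1 n (x - y) = kernel1 n (y - x)"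
    and "kernel1_deriv n (x - y) = - kernel1_deriv n (y - x)"
proof -
  have "pi * (x - y) = - (pi * (y - x))" by (simp add: algebra_simps)
  then show "kernel1 n (x - y) = kernel1 n (y - x)" "kernel1_deriv n (x - y) = - kernel1_deriv n (y - x)"
    unfolding kernel1_def profile_def kernel1_deriv_def by simp_all
qed

lemma integral_kernel1: "(LINT y|circle. kernel1 n (x - y)) = 1"
proof -
  have cont: "continuous_on {0..1} (\<lambda>y. kernel1 n (y - x))" by (intro continuous_intros)
  have "(LINT y|circle. kernel1 n (x - y)) = (LINT y:{0..1}|lborel. kernel1 n (y - x))"
    unfolding kernel1_commute(1)[of n x]
    by (intro integral_lborel_on borel_measurable_continuous_onI continuous_intros) auto
  also have "\<dots> = integral {0..1} (\<lambda>y. kernel1 n (y - x))"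
    by (rule set_borel_integral_eq_integral[OF borel_integrable_atLeastAtMost'[OF cont]])
  also have "\<dots> = integral {-x..-x + 1} (kernel1 n)"
    using integral_shift_Icc_real[of 0 1 "kernel1 n" "- x"] by (simp add: comp_def)
  also have "\<dots> = integral {0..1} (kernel1 n)"
    using kernel1_plus_int(1)[of n _ 1] by (intro integral_periodic_shift continuous_intros) simp
  also have "\<dots> = 1" unfolding kernel1_def[abs_def] by (simp flip: profile_mass_def)
  finally show ?thesis .
qed

lemma bounded_range_periodic:
  fixes f :: "real \<times> real \<Rightarrow> 'a::real_normed_vector"
  assumes "continuous_on UNIV f" "periodic_x f"
  shows "bounded (range f)"
proof -
  have "f x \<in> f ` cell" for x
  proof
    show "(frac (fst x), frac (snd x)) \<in> cell"
      unfolding cell_def by (auto simp: frac_lt_1 less_imp_le)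
    have "f (frac (fst x) + of_int \<lfloor>fst x\<rfloor>, frac (snd x) + of_int \<lfloor>snd x\<rfloor>) = f (frac (fst x), frac (snd x))"
      using assms(2) unfolding periodic_x_def by blast
    then show "f x = f (frac (fst x), frac (snd x))" by (simp add: frac_def)
  qed
  then have "range f \<subseteq> f ` cell" by auto
  moreover have "bounded (f ` cell)"
    by (intro compact_imp_bounded compact_continuous_image compact_cell continuous_on_subset[OF assms(1)]) simp
  ultimately show ?thesis by (rule bounded_subset[rotated])
qed

lemma kernel_nonneg: "0 \<le> kernel n z"
  unfolding kernel_def by (simp add: kernel1_nonneg)

lemma abs_kernel_le: "\<bar>kernel n z\<bar> \<le> kernel_bound n"
proof -
  have "kernel n z \<le> (16 / radius n) * (16 / radius n)"
    unfolding kernel_def by (intro mult_mono kernel1_le kernel1_nonneg) (simp add: less_imp_le)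
  then show ?thesis
    using kernel_nonneg[of n z] by (simp add: kernel_bound_def power2_eq_square)
qed

lemma kernel_bound_pos: "0 < kernel_bound n"
  unfolding kernel_bound_def by simp

lemma kernel_support:
  assumes "kernel n (x - y) \<noteq> 0"
  shows "\<bar>sin (pi * (fst x - fst y))\<bar> \<le> radius n" "\<bar>sin (pi * (snd x - snd y))\<bar> \<le> radius n"
  using assms kernel1_support unfolding kernel_def by auto

lemma kernel_commute:
  shows "kernel n (x - y) = kernel n (y - x)"
    and "kernel_grad n (x - y) = - kernel_grad n (y - x)"
  unfolding kernel_def kernel_grad_def fst_diff snd_diff
  by (simp_all add: kernel1_commute[of n "fst x"] kernel1_commute[of n "snd x"])

lemma continuous_on_kernel [continuous_intros]:
  fixes f :: "'a::t2_space \<Rightarrow> real \<times> real"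
  assumes "continuous_on A f"
  shows "continuous_on A (\<lambda>x. kernel n (f x))" "continuous_on A (\<lambda>x. kernel_grad n (f x))"
  unfolding kernel_def kernel_grad_def by (intro continuous_intros assms)+

lemma borel_measurable_kernel [measurable]:
  "kernel n \<in> borel_measurable borel" "kernel_grad n \<in> borel_measurable borel"
  by (intro borel_measurable_continuous_onI continuous_intros)+

lemma GDERIV_kernel: "GDERIV (kernel n) z :> kernel_grad n z"
  unfolding kernel_def[abs_def] kernel_grad_def by (intro GDERIV_fst_mult_snd DERIV_kernel1)

lemma periodic_x_kernel_shift:
  "periodic_x (\<lambda>y. kernel n (y - x))" "periodic_x (\<lambda>y. kernel_grad n (y - x))"
  unfolding periodic_x_def kernel_def kernel_grad_def
  using kernel1_plus_int[of n "_ - fst x"] kernel1_plus_int[of n "_ - snd x"] by (simp_all add: algebra_simps)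

lemma norm_kernel_grad_le: "norm (kernel_grad n z) \<le> kernel_grad_bound n"
  unfolding kernel_grad_bound_def
proof (rule cSUP_upper)
  have "bounded (range (kernel_grad n))"
    using periodic_x_kernel_shift(2)[of n 0] by (intro bounded_range_periodic continuous_intros) simp
  then obtain C where "\<And>z. norm (kernel_grad n z) \<le> C" unfolding bounded_iff by blast
  then show "bdd_above (range (\<lambda>z. norm (kernel_grad n z)))" by (rule bdd_aboveI2)
qed simp

lemma kernel_grad_bound_nonneg: "0 \<le> kernel_grad_bound n"
  using norm_kernel_grad_le[of n 0] norm_ge_zero order_trans by blast

lemma integral_kernel: "(LINT y|torus. kernel n (x - y)) = 1"
proof -
  have "(LINT y|torus. kernel n (x - y)) = (LINT a|circle. LINT b|circle. kernel n (x - (a, b)))"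
    by (intro integral_torus_rows continuous_intros)
  also have "\<dots> = (LINT a|circle. kernel1 n (fst x - a) * (LINT b|circle. kernel1 n (snd x - b)))"
    unfolding kernel_def by simp
  also have "\<dots> = 1" by (simp add: integral_kernel1)
  finally show ?thesis .
qed

section \<open>Mollification\<close>

definition mollify :: "nat \<Rightarrow> (real \<times> real \<Rightarrow> 'b::{banach, second_countable_topology}) \<Rightarrow> real \<times> real \<Rightarrow> 'b" where
  "mollify n f x = (LINT y|torus. kernel n (x - y) *\<^sub>R f y)"

definition mollify_grad :: "nat \<Rightarrow> (real \<times> real \<Rightarrow> real) \<Rightarrow> real \<times> real \<Rightarrow> real \<times> real" where
  "mollify_grad n f x = (LINT y|torus. f y *\<^sub>R kernel_grad n (x - y))"

definition mollify_div :: "nat \<Rightarrow> (real \<times> real \<Rightarrow> real \<times> real) \<Rightarrow> real \<times> real \<Rightarrow> real" where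
  "mollify_div n q x = (LINT y|torus. q y \<bullet> kernel_grad n (x - y))"

lemma integrable_kernel_scaleR:
  fixes f :: "real \<times> real \<Rightarrow> 'b::{banach, second_countable_topology}"
  assumes "integrable torus f"
  shows "integrable torus (\<lambda>y. kernel n (x - y) *\<^sub>R f y)"
  by (rule integrable_dominated[OF assms, where C = "kernel_bound n"])
    (use assms in \<open>auto intro!: mult_right_mono abs_kernel_le\<close>)

lemma norm_scaleR_kernel_grad_le: "norm (c *\<^sub>R kernel_grad n z) \<le> kernel_grad_bound n * norm c"
  using mult_left_mono[OF norm_kernel_grad_le, of "\<bar>c\<bar>"] by (simp add: mult.commute)

lemma abs_inner_kernel_grad_le: "\<bar>q \<bullet> kernel_grad n z\<bar> \<le> kernel_grad_bound n * norm q"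
  using abs_inner_le[OF norm_kernel_grad_le] by (simp add: inner_commute)

lemma integrable_scaleR_kernel_grad:
  assumes "integrable torus f"
  shows "integrable torus (\<lambda>y. f y *\<^sub>R kernel_grad n (x - y))"
  by (rule integrable_dominated[OF assms _ norm_scaleR_kernel_grad_le]) (use assms in auto)

lemma continuous_on_mollify:
  fixes f :: "real \<times> real \<Rightarrow> 'b::{banach, second_countable_topology}"
  assumes "integrable torus f"
  shows "continuous_on UNIV (mollify n f)"
  unfolding mollify_def[abs_def]
  by (rule continuous_on_parameter_integral[where f = "\<lambda>y. kernel_bound n * norm (f y)"])
    (use assms in \<open>auto intro!: mult_right_mono abs_kernel_le continuous_intros\<close>)

lemma continuous_on_mollify_grad:
  assumes "integrable torus f"
  shows "continuous_on UNIV (mollify_grad n f)"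
  unfolding mollify_grad_def[abs_def]
  by (rule continuous_on_parameter_integral[OF _ _ norm_scaleR_kernel_grad_le])
    (use assms in \<open>auto intro!: continuous_intros\<close>)

lemma continuous_on_mollify_div:
  assumes "integrable torus q"
  shows "continuous_on UNIV (mollify_div n q)"
  unfolding mollify_div_def[abs_def]
  by (rule continuous_on_parameter_integral[where f = "\<lambda>y. kernel_grad_bound n * norm (q y)"])
    (use assms in \<open>auto intro!: abs_inner_kernel_grad_le continuous_intros\<close>)

lemma GDERIV_mollify:
  assumes "integrable torus f"
  shows "GDERIV (mollify n f) x :> mollify_grad n f x"
  unfolding mollify_def[abs_def] mollify_grad_def
proof (rule GDERIV_parameter_integral[where S = UNIV, OF _ _ _ _ norm_scaleR_kernel_grad_le])
  fix x y
  have "GDERIV (\<lambda>x. kernel n (x - y)) x :> kernel_grad n (x - y)"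
    using has_derivative_compose[OF has_derivative_diff[OF has_derivative_ident has_derivative_const]
        GDERIV_kernel[unfolded gderiv_def]] by (simp add: gderiv_def)
  from GDERIV_mult[OF this GDERIV_const]
  show "GDERIV (\<lambda>x. kernel n (x - y) *\<^sub>R f y) x :> f y *\<^sub>R kernel_grad n (x - y)" by simp
qed (use assms integrable_kernel_scaleR[OF assms] in auto)

lemma periodic_x_mollify: "periodic_x (mollify n f)"
  unfolding periodic_x_def mollify_def
  using periodic_x_kernel_shift(1) unfolding periodic_x_def by simp

lemma borel_measurable_mollify [measurable]:
  fixes f :: "real \<times> real \<Rightarrow> 'b::{banach, second_countable_topology}"
  assumes [measurable]: "f \<in> borel_measurable borel"
  shows "mollify n f \<in> borel_measurable borel"
  unfolding mollify_def[abs_def] by measurable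

lemma mollify_add:
  fixes f g :: "real \<times> real \<Rightarrow> 'b::{banach, second_countable_topology}"
  assumes "integrable torus f" "integrable torus g"
  shows "mollify n (\<lambda>x. f x + g x) x = mollify n f x + mollify n g x"
  unfolding mollify_def by (simp add: scaleR_add_right integrable_kernel_scaleR assms)

lemma mollify_diff:
  fixes f g :: "real \<times> real \<Rightarrow> 'b::{banach, second_countable_topology}"
  assumes "integrable torus f" "integrable torus g"
  shows "mollify n (\<lambda>x. f x - g x) x = mollify n f x - mollify n g x"
  unfolding mollify_def by (simp add: scaleR_diff_right integrable_kernel_scaleR assms)

lemma mollify_mult_left:
  fixes f :: "real \<times> real \<Rightarrow> real"
  shows "mollify n (\<lambda>x. c * f x) x = c * mollify n f x"
  unfolding mollify_def by (simp add: mult.left_commute[of _ c])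

lemma mollify_const: "mollify n (\<lambda>_. c) x = c"
proof -
  have "mollify n (\<lambda>_. c) x = (LINT y|torus. kernel n (x - y)) *\<^sub>R c"
    using integrable_kernel_scaleR[of "\<lambda>_. 1::real" n x] unfolding mollify_def
    by (intro integral_scaleR_left) simp
  then show ?thesis by (simp add: integral_kernel)
qed

lemma inner_mollify:
  fixes G :: "real \<times> real \<Rightarrow> 'b::{real_inner, banach, second_countable_topology}"
  assumes "integrable torus G"
  shows "a \<bullet> mollify n G x = mollify n (\<lambda>y. a \<bullet> G y) x"
  unfolding mollify_def using integrable_kernel_scaleR[OF assms]
  by (subst integral_inner_right[symmetric]) (auto simp: inner_scaleR_right)

lemma mollify_mono:
  fixes f g :: "real \<times> real \<Rightarrow> real"
  assumes "integrable torus f" "integrable torus g"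
    and le: "\<And>y. y \<in> cell \<Longrightarrow> kernel n (x - y) \<noteq> 0 \<Longrightarrow> f y \<le> g y"
  shows "mollify n f x \<le> mollify n g x"
  unfolding mollify_def
proof (intro integral_mono_AE integrable_kernel_scaleR assms(1,2))
  show "AE y in torus. kernel n (x - y) *\<^sub>R f y \<le> kernel n (x - y) *\<^sub>R g y"
    using AE_torus_cell
  proof eventually_elim
    case (elim y)
    then show ?case
      using le[of y] kernel_nonneg[of n "x - y"] by (cases "kernel n (x - y) = 0") (auto intro: mult_left_mono)
  qed
qed

lemma norm_mollify_le:
  fixes f :: "real \<times> real \<Rightarrow> 'b::{banach, second_countable_topology}"
  shows "norm (mollify n f x) \<le> mollify n (\<lambda>y. norm (f y)) x"
proof -
  have "norm (mollify n f x) \<le> (LINT y|torus. norm (kernel n (x - y) *\<^sub>R f y))"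
    unfolding mollify_def by (rule integral_norm_bound)
  then show ?thesis unfolding mollify_def by (simp add: kernel_nonneg)
qed

lemma norm_mollify_le_bound:
  fixes f :: "real \<times> real \<Rightarrow> 'b::{banach, second_countable_topology}"
  assumes "integrable torus f"
  shows "norm (mollify n f x) \<le> kernel_bound n * (LINT y|torus. norm (f y))"
proof -
  have "mollify n (\<lambda>y. norm (f y)) x \<le> (LINT y|torus. kernel_bound n * norm (f y))"
    unfolding mollify_def
    by (intro integral_mono integrable_kernel_scaleR integrable_mult_right integrable_norm assms)
      (auto intro!: mult_right_mono order_trans[OF abs_ge_self abs_kernel_le])
  then show ?thesis using norm_mollify_le[of n f x] by simp
qed

lemma norm_mollify_grad_le_bound:
  assumes "integrable torus f"
  shows "norm (mollify_grad n f x) \<le> kernel_grad_bound n * (LINT y|torus. \<bar>f y\<bar>)"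
proof -
  have "norm (mollify_grad n f x) \<le> (LINT y|torus. norm (f y *\<^sub>R kernel_grad n (x - y)))"
    unfolding mollify_grad_def by (rule integral_norm_bound)
  also have "\<dots> \<le> (LINT y|torus. kernel_grad_bound n * norm (f y))"
    by (rule integral_mono'[OF _ norm_scaleR_kernel_grad_le])
      (use assms kernel_grad_bound_nonneg[of n] in auto)
  finally show ?thesis by simp
qed

lemma integral_abs_torus_le:
  fixes f :: "real \<times> real \<Rightarrow> real"
  assumes "f \<in> borel_measurable borel" "integrable torus (\<lambda>x. (f x)\<^sup>2)"
  shows "(LINT x|torus. \<bar>f x\<bar>) \<le> 1 + (LINT x|torus. (f x)\<^sup>2)"
proof -
  have "(LINT x|torus. \<bar>f x\<bar>) \<le> (LINT x|torus. 1 + (f x)\<^sup>2)"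
    using assms by (intro integral_mono' abs_le_one_plus_power2) auto
  then show ?thesis using assms by simp
qed

lemma abs_mollify_div_le:
  assumes "integrable torus q"
  shows "\<bar>mollify_div n q x\<bar> \<le> kernel_grad_bound n * (LINT y|torus. norm (q y))"
proof -
  have "\<bar>mollify_div n q x\<bar> \<le> (LINT y|torus. \<bar>q y \<bullet> kernel_grad n (x - y)\<bar>)"
    unfolding mollify_div_def using integral_norm_bound[of torus "\<lambda>y. q y \<bullet> kernel_grad n (x - y)"] by simp
  also have "\<dots> \<le> (LINT y|torus. kernel_grad_bound n * norm (q y))"
    by (rule integral_mono')
      (use assms abs_inner_kernel_grad_le kernel_grad_bound_nonneg[of n] in auto)
  finally show ?thesis by simp
qed

text \<open>Jensen's inequality, from the tangent of $s \mapsto s^p$ at the mollification of $|f|$.\<close>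

lemma norm_mollify_powr_le:
  fixes f :: "real \<times> real \<Rightarrow> 'b::{banach, second_countable_topology}"
  assumes [measurable]: "f \<in> borel_measurable borel"
    and fp: "integrable torus (\<lambda>x. norm (f x) powr p)" and p: "p \<ge> 1"
  shows "norm (mollify n f x) powr p \<le> mollify n (\<lambda>y. norm (f y) powr p) x"
proof -
  have f: "integrable torus f" by (rule torus.integrable_of_norm_powr[OF _ fp p]) simp
  define a where "a = mollify n (\<lambda>y. norm (f y)) x"
  have "norm (mollify n f x) \<le> a" unfolding a_def by (rule norm_mollify_le)
  then have "0 \<le> a" using norm_ge_zero order_trans by blast
  have "a powr p = p * a powr (p - 1) * a - (p - 1) * a powr p"
    using powr_add[of a "p - 1" 1] \<open>0 \<le> a\<close> by (cases "a = 0") (simp_all add: algebra_simps)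
  also have "\<dots> = mollify n (\<lambda>y. p * a powr (p - 1) * norm (f y) - (p - 1) * a powr p) x"
    using f unfolding a_def by (simp add: mollify_diff mollify_const mollify_mult_left)
  also have "\<dots> \<le> mollify n (\<lambda>y. norm (f y) powr p) x"
    by (rule mollify_mono) (use f fp powr_ge_tangent[OF p \<open>0 \<le> a\<close>] in auto)
  finally have "a powr p \<le> mollify n (\<lambda>y. norm (f y) powr p) x" .
  moreover have "norm (mollify n f x) powr p \<le> a powr p"
    using \<open>norm (mollify n f x) \<le> a\<close> p by (intro powr_mono2) auto
  ultimately show ?thesis by linarith
qed

lemma norm_mollify_power2_le:
  fixes f :: "real \<times> real \<Rightarrow> 'b::{banach, second_countable_topology}"
  assumes "f \<in> borel_measurable borel" "integrable torus (\<lambda>x. (norm (f x))\<^sup>2)"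
  shows "(norm (mollify n f x))\<^sup>2 \<le> mollify n (\<lambda>y. (norm (f y))\<^sup>2) x"
  using norm_mollify_powr_le[of f 2 n x] assms by simp

lemma
  fixes f :: "real \<times> real \<Rightarrow> 'b::{banach, second_countable_topology}"
  assumes f: "integrable torus f"
  shows integrable_mollify: "integrable torus (mollify n f)"
    and integral_mollify: "(LINT x|torus. mollify n f x) = (LINT y|torus. f y)"
proof -
  have [measurable]: "f \<in> borel_measurable borel" using f by auto
  have "integrable (torus \<Otimes>\<^sub>M torus) (\<lambda>z. f (snd z))"
    by (rule torus_torus.Fubini_integrable) (use f in auto)
  then have "integrable (torus \<Otimes>\<^sub>M torus) (\<lambda>z. kernel n (fst z - snd z) *\<^sub>R f (snd z))"
    by (rule integrable_dominated[where C = "kernel_bound n"]) (auto intro!: mult_right_mono abs_kernel_le)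
  then have pair: "integrable (torus \<Otimes>\<^sub>M torus) (\<lambda>(x, y). kernel n (x - y) *\<^sub>R f y)"
    by (simp add: split_beta')
  show "integrable torus (mollify n f)"
    unfolding mollify_def[abs_def] by (rule torus_torus.integrable_fst[OF pair])
  have "(LINT x|torus. mollify n f x) = (LINT y|torus. LINT x|torus. kernel n (x - y) *\<^sub>R f y)"
    unfolding mollify_def by (rule torus_torus.Fubini_integral[OF pair, symmetric])
  also have "\<dots> = (LINT y|torus. mollify n (\<lambda>_. f y) y)"
    unfolding mollify_def by (subst kernel_commute(1)) simp
  finally show "(LINT x|torus. mollify n f x) = (LINT y|torus. f y)" by (simp add: mollify_const)
qed

lemma
  fixes f :: "real \<times> real \<Rightarrow> 'b::{banach, second_countable_topology}"
  assumes meas [measurable]: "f \<in> borel_measurable borel"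
    and fp: "integrable torus (\<lambda>x. norm (f x) powr p)" and p: "p \<ge> 1"
  shows integrable_norm_mollify_powr: "integrable torus (\<lambda>x. norm (mollify n f x) powr p)"
    and integral_norm_mollify_powr_le:
      "(LINT x|torus. norm (mollify n f x) powr p) \<le> (LINT x|torus. norm (f x) powr p)"
proof -
  note pointwise = norm_mollify_powr_le[OF meas fp p]
  show integrable: "integrable torus (\<lambda>x. norm (mollify n f x) powr p)"
    by (rule Bochner_Integration.integrable_bound[OF integrable_mollify[OF fp, of n]])
      (auto intro!: AE_I2 order_trans[OF pointwise])
  show "(LINT x|torus. norm (mollify n f x) powr p) \<le> (LINT x|torus. norm (f x) powr p)"
    using integral_mono[OF integrable integrable_mollify[OF fp] pointwise] integral_mollify[OF fp, of n] by simp
qed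

lemma
  fixes f :: "real \<times> real \<Rightarrow> 'b::{banach, second_countable_topology}"
  assumes "f \<in> borel_measurable borel" "integrable torus (\<lambda>x. (norm (f x))\<^sup>2)"
  shows integrable_norm_mollify_power2: "integrable torus (\<lambda>x. (norm (mollify n f x))\<^sup>2)"
    and integral_norm_mollify_power2_le:
      "(LINT x|torus. (norm (mollify n f x))\<^sup>2) \<le> (LINT x|torus. (norm (f x))\<^sup>2)"
  using integrable_norm_mollify_powr[of f 2 n] integral_norm_mollify_powr_le[of f 2 n] assms by simp_all

section \<open>Convergence of mollifications\<close>

lemma mollify_tendsto_at:
  fixes f :: "real \<times> real \<Rightarrow> 'b::{banach, second_countable_topology}"
  assumes cont: "continuous_on UNIV f" and x: "x \<in> {0<..<1} \<times> {0<..<1}"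
  shows "(\<lambda>n. mollify n f x) \<longlonglongrightarrow> f x"
proof (rule tendstoI)
  fix e :: real assume "e > 0"
  obtain d where d: "d > 0" "\<And>y. dist y x < d \<Longrightarrow> dist (f y) (f x) < e/2"
    using cont[unfolded continuous_on_iff, rule_format, of x "e/2"] \<open>e > 0\<close> by auto
  define \<eta> where "\<eta> = min (min (fst x) (1 - fst x)) (min (snd x) (1 - snd x))"
  have "\<eta> > 0" unfolding \<eta>_def using x by auto
  have f: "integrable torus f" by (rule integrable_torus_continuous[OF cont])
  have "\<forall>\<^sub>F n in sequentially. radius n < min \<eta> (d/2)"
    by (rule order_tendstoD(2)[OF radius_tendsto_0]) (use \<open>\<eta> > 0\<close> d in auto)
  then show "\<forall>\<^sub>F n in sequentially. dist (mollify n f x) (f x) < e"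
  proof eventually_elim
    case (elim n)
    have close: "\<bar>z\<bar> < d/2" if "\<bar>z\<bar> \<le> 1 - \<eta>" "\<bar>sin (pi * z)\<bar> \<le> radius n" for z
      using abs_sin_pi_ge[of z] that elim \<open>\<eta> > 0\<close> by (auto simp: min_def split: if_splits)
    have "norm (f y - f x) \<le> e/2" if y: "y \<in> cell" "kernel n (x - y) \<noteq> 0" for y
    proof -
      have "\<bar>fst x - fst y\<bar> \<le> 1 - \<eta>" "\<bar>snd x - snd y\<bar> \<le> 1 - \<eta>"
        using x y(1) unfolding \<eta>_def cell_def by auto
      then have "\<bar>fst x - fst y\<bar> < d/2" "\<bar>snd x - snd y\<bar> < d/2"
        using close kernel_support[OF y(2)] by auto
      then have "dist y x < d"
        using norm_le_abs_fst_snd[of "x - y"] by (simp add: dist_norm norm_minus_commute)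
      then show ?thesis using d(2) by (auto simp: dist_norm less_imp_le)
    qed
    then have "mollify n (\<lambda>y. norm (f y - f x)) x \<le> mollify n (\<lambda>_. e/2) x"
      using f by (intro mollify_mono) auto
    then have "norm (mollify n (\<lambda>y. f y - f x) x) \<le> e/2"
      using norm_mollify_le[of n "\<lambda>y. f y - f x" x] by (simp add: mollify_const)
    then show ?case using f \<open>e > 0\<close> by (simp add: mollify_diff mollify_const dist_norm)
  qed
qed

lemma mollify_tendsto_L1_continuous:
  fixes f :: "real \<times> real \<Rightarrow> 'b::{banach, second_countable_topology}"
  assumes cont: "continuous_on UNIV f" and bound: "\<And>x. norm (f x) \<le> B"
  shows "(\<lambda>n. LINT x|torus. norm (mollify n f x - f x)) \<longlonglongrightarrow> 0"
proof -
  have [measurable]: "f \<in> borel_measurable borel" using cont by (rule borel_measurable_continuous_onI)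
  have f: "integrable torus f" by (rule integrable_torus_continuous[OF cont])
  have "(\<lambda>n. LINT x|torus. norm (mollify n f x - f x)) \<longlonglongrightarrow> (LINT x|torus. 0)"
  proof (rule integral_dominated_convergence[where w = "\<lambda>_. 2 * B"])
    show "AE x in torus. (\<lambda>n. norm (mollify n f x - f x)) \<longlonglongrightarrow> 0"
      using AE_torus_interior
      by eventually_elim (intro tendsto_norm_zero LIM_zero mollify_tendsto_at[OF cont])
    have "norm (mollify n f x) \<le> B" for n x
    proof -
      have "norm (mollify n f x) \<le> mollify n (\<lambda>y. norm (f y)) x" by (rule norm_mollify_le)
      also have "\<dots> \<le> mollify n (\<lambda>_. B) x" using f bound by (intro mollify_mono) auto
      finally show ?thesis by (simp add: mollify_const)
    qed
    then have "norm (mollify n f x - f x) \<le> 2 * B" for n x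
      using bound[of x] norm_triangle_ineq4[of "mollify n f x" "f x"] by (smt (verit))
    then show "AE x in torus. norm (norm (mollify n f x - f x)) \<le> 2 * B" for n by simp
  qed auto
  then show ?thesis by simp
qed

definition truncate :: "real \<Rightarrow> 'a::real_normed_vector \<Rightarrow> 'a" where
  "truncate r v = (r / max r (norm v)) *\<^sub>R v"

lemma norm_truncate_le: "0 < r \<Longrightarrow> norm (truncate r v) \<le> r"
  unfolding truncate_def by (auto simp: max_def divide_le_eq)

lemma truncate_eq: "0 < r \<Longrightarrow> norm v \<le> r \<Longrightarrow> truncate r v = v"
  unfolding truncate_def by (simp add: max_def)

lemma norm_diff_truncate_le: "0 < r \<Longrightarrow> norm (v - truncate r v) \<le> norm v"
proof -
  assume "0 < r"
  then have "0 \<le> r / max r (norm v)" "r / max r (norm v) \<le> 1" by (auto simp: divide_le_eq)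
  then have "\<bar>1 - r / max r (norm v)\<bar> * norm v \<le> 1 * norm v" by (intro mult_right_mono) auto
  moreover have "v - truncate r v = (1 - r / max r (norm v)) *\<^sub>R v"
    unfolding truncate_def by (simp add: scaleR_diff_left)
  ultimately show ?thesis by simp
qed

lemma continuous_on_truncate [continuous_intros]:
  fixes f :: "'a::topological_space \<Rightarrow> 'b::real_normed_vector"
  assumes "0 < r" "continuous_on A f"
  shows "continuous_on A (\<lambda>x. truncate r (f x))"
  unfolding truncate_def using assms by (intro continuous_intros) auto

lemma borel_measurable_truncate [measurable]:
  fixes f :: "'a \<Rightarrow> 'b::{real_normed_vector, second_countable_topology}"
  assumes "f \<in> borel_measurable M"
  shows "(\<lambda>x. truncate r (f x)) \<in> borel_measurable M"
  unfolding truncate_def using assms by measurable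

lemma truncate_tendsto_Lp:
  fixes f :: "'a \<Rightarrow> 'b::{banach, second_countable_topology}"
  assumes [measurable]: "f \<in> borel_measurable M"
    and fp: "integrable M (\<lambda>x. norm (f x) powr p)" and "p \<ge> 0"
  shows "(\<lambda>k. LINT x|M. norm (f x - truncate (real (Suc k)) (f x)) powr p) \<longlonglongrightarrow> 0"
proof -
  have "(\<lambda>k. LINT x|M. norm (f x - truncate (real (Suc k)) (f x)) powr p) \<longlonglongrightarrow> (LINT x|M. 0)"
  proof (rule integral_dominated_convergence[OF _ _ fp])
    show "AE x in M. (\<lambda>k. norm (f x - truncate (real (Suc k)) (f x)) powr p) \<longlonglongrightarrow> 0"
    proof (rule AE_I2, rule tendsto_eventually)
      fix x
      obtain K :: nat where "norm (f x) \<le> real K" using real_arch_simple by blast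
      then show "\<forall>\<^sub>F k in sequentially. norm (f x - truncate (real (Suc k)) (f x)) powr p = 0"
        by (intro eventually_sequentiallyI[of K]) (simp add: truncate_eq)
    qed
    show "AE x in M. norm (norm (f x - truncate (real (Suc k)) (f x)) powr p) \<le> norm (f x) powr p" for k
      using \<open>p \<ge> 0\<close> by (auto intro!: AE_I2 powr_mono2 norm_diff_truncate_le)
  qed measurable
  then show ?thesis by simp
qed

lemma borel_measurable_AE_limit_of_continuous:
  fixes f :: "'a::euclidean_space \<Rightarrow> 'b::euclidean_space"
  assumes [measurable]: "f \<in> borel_measurable borel"
  obtains g where "\<And>j. continuous_on UNIV (g j)" "AE x in lborel. (\<lambda>j. g j x) \<longlonglongrightarrow> f x"
proof -
  have "f measurable_on UNIV"
    by (rule lebesgue_measurable_imp_measurable_on) (auto intro: measurable_completion)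
  then obtain N g where N: "negligible N" and g: "\<And>j. continuous_on UNIV (g j)"
    and lim: "\<And>x. x \<notin> N \<Longrightarrow> (\<lambda>j. g j x) \<longlonglongrightarrow> f x"
    unfolding measurable_on_def by auto
  have [measurable]: "g j \<in> borel_measurable borel" for j
    using g by (rule borel_measurable_continuous_onI)
  have "AE x in lebesgue. x \<notin> N"
    using N by (simp add: negligible_iff_null_sets AE_not_in)
  then have "AE x in lebesgue. (\<lambda>j. g j x) \<longlonglongrightarrow> f x" by eventually_elim (rule lim)
  then have "AE x in lborel. (\<lambda>j. g j x) \<longlonglongrightarrow> f x"
    by (subst (asm) AE_completion_iff) auto
  with g show thesis by (rule that)
qed

lemma torus_L1_approx_continuous_bounded:
  fixes f :: "real \<times> real \<Rightarrow> 'b::euclidean_space"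
  assumes [measurable]: "f \<in> borel_measurable borel" and r: "0 < r" and e: "0 < e"
  obtains h where "continuous_on UNIV h" "\<And>x. norm (h x) \<le> r"
    "(LINT x|torus. norm (truncate r (f x) - h x)) < e"
proof -
  obtain g where g: "\<And>j. continuous_on UNIV (g j)" and "AE x in lborel. (\<lambda>j. g j x) \<longlonglongrightarrow> f x"
    using borel_measurable_AE_limit_of_continuous[OF assms(1)] by blast
  then have AE_lim: "AE x in torus. (\<lambda>j. g j x) \<longlonglongrightarrow> f x"
    by (simp add: AE_lborel_on eventually_mono)
  have [measurable]: "g j \<in> borel_measurable borel" for j
    using g by (rule borel_measurable_continuous_onI)
  have "(\<lambda>j. LINT x|torus. norm (truncate r (f x) - truncate r (g j x))) \<longlonglongrightarrow> (LINT x|torus. 0)"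
  proof (rule integral_dominated_convergence[where w = "\<lambda>_. 2 * r"])
    show "AE x in torus. (\<lambda>j. norm (truncate r (f x) - truncate r (g j x))) \<longlonglongrightarrow> 0"
      using AE_lim
    proof eventually_elim
      case (elim x)
      have "isCont (truncate r) (f x)"
        using continuous_on_truncate[OF r continuous_on_id, of UNIV]
        unfolding continuous_on_eq_continuous_at[OF open_UNIV] by blast
      then have "(\<lambda>j. truncate r (g j x)) \<longlonglongrightarrow> truncate r (f x)"
        using elim by (rule isCont_tendsto_compose)
      then have "(\<lambda>j. truncate r (f x) - truncate r (g j x)) \<longlonglongrightarrow> truncate r (f x) - truncate r (f x)"
        by (intro tendsto_intros)
      then show ?case using tendsto_norm_zero by simp
    qed
    have "norm (truncate r (f x) - truncate r (g j x)) \<le> r + r" for j x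
      by (rule order_trans[OF norm_triangle_ineq4 add_mono]) (rule norm_truncate_le[OF r])+
    then show "AE x in torus. norm (norm (truncate r (f x) - truncate r (g j x))) \<le> 2 * r" for j by simp
  qed auto
  then have "(\<lambda>j. LINT x|torus. norm (truncate r (f x) - truncate r (g j x))) \<longlonglongrightarrow> 0" by simp
  from order_tendstoD(2)[OF this e] obtain j
    where "(LINT x|torus. norm (truncate r (f x) - truncate r (g j x))) < e"
    using eventually_happens by fastforce
  then show thesis
    using that[of "\<lambda>x. truncate r (g j x)"] continuous_on_truncate[OF r g] norm_truncate_le[OF r] by blast
qed

lemma integrable_norm_diff_powr:
  fixes f g :: "'a \<Rightarrow> 'b::{banach, second_countable_topology}"
  assumes "f \<in> borel_measurable M" "g \<in> borel_measurable M"
    and "integrable M (\<lambda>x. norm (f x) powr p)" "integrable M (\<lambda>x. norm (g x) powr p)" "p \<ge> 0"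
  shows "integrable M (\<lambda>x. norm (f x - g x) powr p)"
proof (rule Bochner_Integration.integrable_bound)
  show "integrable M (\<lambda>x. 2 powr p * (norm (f x) powr p + norm (g x) powr p))" using assms by auto
  show "AE x in M. norm (norm (f x - g x) powr p) \<le> norm (2 powr p * (norm (f x) powr p + norm (g x) powr p))"
    using norm_add_powr_le[OF assms(5), of "f _" "- g _"] by auto
qed (use assms in measurable)

lemma integral_mollify_error_powr_le:
  fixes f h :: "real \<times> real \<Rightarrow> 'b::{banach, second_countable_topology}"
  assumes meas [measurable]: "f \<in> borel_measurable borel" "h \<in> borel_measurable borel"
    and fp: "integrable torus (\<lambda>x. norm (f x) powr p)" and hp: "integrable torus (\<lambda>x. norm (h x) powr p)"
    and p: "p \<ge> 1"
  shows "(LINT x|torus. norm (mollify n f x - f x) powr p) \<le> (2 powr p)\<^sup>2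
    * (2 * (LINT x|torus. norm (f x - h x) powr p) + (LINT x|torus. norm (mollify n h x - h x) powr p))"
proof -
  define C where "C = (2 powr p)\<^sup>2"
  have C: "0 \<le> C" unfolding C_def by simp
  have f: "integrable torus f" and h: "integrable torus h"
    using torus.integrable_of_norm_powr[OF _ fp p] torus.integrable_of_norm_powr[OF _ hp p] by auto
  have fh: "integrable torus (\<lambda>x. norm (f x - h x) powr p)"
    by (rule integrable_norm_diff_powr) (use fp hp p in auto)
  define d where "d x = mollify n (\<lambda>y. f y - h y) x" for x
  have d: "integrable torus (\<lambda>x. norm (d x) powr p)"
      "(LINT x|torus. norm (d x) powr p) \<le> (LINT x|torus. norm (f x - h x) powr p)"
    unfolding d_def[abs_def]
    using integrable_norm_mollify_powr[OF _ fh p] integral_norm_mollify_powr_le[OF _ fh p] by auto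
  have mh: "integrable torus (\<lambda>x. norm (mollify n h x - h x) powr p)"
    by (rule integrable_norm_diff_powr) (use integrable_norm_mollify_powr[OF _ hp p] hp p in auto)
  have pointwise: "norm (mollify n f x - f x) powr p
      \<le> C * (norm (d x) powr p + norm (mollify n h x - h x) powr p + norm (f x - h x) powr p)" for x
  proof -
    have split: "mollify n f x - f x = d x + (mollify n h x - h x) + (h x - f x)"
      using f h unfolding d_def by (simp add: mollify_diff)
    show ?thesis
      using norm_add3_powr_le[of p "d x" "mollify n h x - h x" "h x - f x"] p
      unfolding split C_def by (simp add: norm_minus_commute)
  qed
  have "(LINT x|torus. norm (mollify n f x - f x) powr p)
      \<le> (LINT x|torus. C * (norm (d x) powr p + norm (mollify n h x - h x) powr p + norm (f x - h x) powr p))"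
    using d mh fh pointwise C by (intro integral_mono') auto
  also have "\<dots> = C * ((LINT x|torus. norm (d x) powr p) + (LINT x|torus. norm (mollify n h x - h x) powr p)
      + (LINT x|torus. norm (f x - h x) powr p))"
    using d mh fh by simp
  also have "\<dots> \<le> C * (2 * (LINT x|torus. norm (f x - h x) powr p) + (LINT x|torus. norm (mollify n h x - h x) powr p))"
    using d(2) C by (intro mult_left_mono) auto
  finally show ?thesis unfolding C_def .
qed

lemma mollify_tendsto_L1_bounded:
  fixes f :: "real \<times> real \<Rightarrow> 'b::euclidean_space"
  assumes [measurable]: "f \<in> borel_measurable borel" and bound: "\<And>x. norm (f x) \<le> r" and r: "0 < r"
  shows "(\<lambda>n. LINT x|torus. norm (mollify n f x - f x)) \<longlonglongrightarrow> 0"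
proof (rule tendstoI)
  fix e :: real assume "e > 0"
  obtain h where h: "continuous_on UNIV h" "\<And>x. norm (h x) \<le> r" "(LINT x|torus. norm (f x - h x)) < e/16"
    using torus_L1_approx_continuous_bounded[of f r "e/16"] r bound \<open>e > 0\<close> by (auto simp: truncate_eq)
  have [measurable]: "h \<in> borel_measurable borel" using h(1) by (rule borel_measurable_continuous_onI)
  have integrables: "integrable torus f" "integrable torus h"
    using bound h by (auto intro!: torus.integrable_const_bound[where B = r])
  have "\<forall>\<^sub>F n in sequentially. (LINT x|torus. norm (mollify n h x - h x)) < e/8"
    by (rule order_tendstoD(2)[OF mollify_tendsto_L1_continuous[OF h(1,2)]]) (use \<open>e > 0\<close> in simp)
  then show "\<forall>\<^sub>F n in sequentially. dist (LINT x|torus. norm (mollify n f x - f x)) 0 < e"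
  proof eventually_elim
    case (elim n)
    have "(LINT x|torus. norm (mollify n f x - f x))
        \<le> 4 * (2 * (LINT x|torus. norm (f x - h x)) + (LINT x|torus. norm (mollify n h x - h x)))"
      using integral_mollify_error_powr_le[of f h 1 n] integrables by simp
    then show ?case using h(3) elim by simp
  qed
qed

lemma mollify_tendsto_Lp_bounded:
  fixes f :: "real \<times> real \<Rightarrow> 'b::euclidean_space"
  assumes [measurable]: "f \<in> borel_measurable borel" and bound: "\<And>x. norm (f x) \<le> r"
    and r: "0 < r" and p: "p \<ge> 1"
  shows "(\<lambda>n. LINT x|torus. norm (mollify n f x - f x) powr p) \<longlonglongrightarrow> 0"
proof (rule Lim_null_comparison)
  have f: "integrable torus f" by (rule torus.integrable_const_bound[where B = r]) (use bound in auto)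
  show "(\<lambda>n. (2 * r) powr (p - 1) * (LINT x|torus. norm (mollify n f x - f x))) \<longlonglongrightarrow> 0"
    by (intro tendsto_mult_right_zero mollify_tendsto_L1_bounded[OF _ bound r]) simp
  have "(LINT x|torus. norm (mollify n f x - f x) powr p)
      \<le> (2 * r) powr (p - 1) * (LINT x|torus. norm (mollify n f x - f x))" for n
  proof -
    have "mollify n (\<lambda>y. norm (f y)) x \<le> mollify n (\<lambda>_. r) x" for x
      by (rule mollify_mono) (use f bound in auto)
    then have "norm (mollify n f x) \<le> r" for x
      using norm_mollify_le[of n f x] order_trans unfolding mollify_const by blast
    then have le: "norm (mollify n f x - f x) \<le> 2 * r" for x
      using bound[of x] norm_triangle_ineq4[of "mollify n f x" "f x"] by (smt (verit))
    have "norm (mollify n f x - f x) powr p \<le> (2 * r) powr (p - 1) * norm (mollify n f x - f x)" for x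
    proof (cases "mollify n f x = f x")
      case False
      have "norm (mollify n f x - f x) powr p = norm (mollify n f x - f x) powr (p - 1) * norm (mollify n f x - f x)"
        using False powr_add[of "norm (mollify n f x - f x)" "p - 1" 1] by simp
      also have "\<dots> \<le> (2 * r) powr (p - 1) * norm (mollify n f x - f x)"
        using le p by (intro mult_right_mono powr_mono2) auto
      finally show ?thesis .
    qed simp
    then have "(LINT x|torus. norm (mollify n f x - f x) powr p)
        \<le> (LINT x|torus. (2 * r) powr (p - 1) * norm (mollify n f x - f x))"
      using f integrable_mollify[OF f, of n] by (intro integral_mono') auto
    then show ?thesis by simp
  qed
  then show "\<forall>\<^sub>F n in sequentially. norm (LINT x|torus. norm (mollify n f x - f x) powr p)
      \<le> (2 * r) powr (p - 1) * (LINT x|torus. norm (mollify n f x - f x))" by simp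
qed

lemma mollify_tendsto_Lp:
  fixes f :: "real \<times> real \<Rightarrow> 'b::euclidean_space"
  assumes meas [measurable]: "f \<in> borel_measurable borel"
    and fp: "integrable torus (\<lambda>x. norm (f x) powr p)" and p: "p \<ge> 1"
  shows "(\<lambda>n. LINT x|torus. norm (mollify n f x - f x) powr p) \<longlonglongrightarrow> 0"
proof (rule tendstoI)
  fix e :: real assume "e > 0"
  define d where "d = e / (4 * (2 powr p)\<^sup>2)"
  have "d > 0" unfolding d_def using \<open>e > 0\<close> by simp
  have "\<forall>\<^sub>F k in sequentially. (LINT x|torus. norm (f x - truncate (real (Suc k)) (f x)) powr p) < d"
    by (rule order_tendstoD(2)[OF truncate_tendsto_Lp[OF _ fp]]) (use p \<open>d > 0\<close> in auto)
  then obtain k where k: "(LINT x|torus. norm (f x - truncate (real (Suc k)) (f x)) powr p) < d"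
    using eventually_happens by fastforce
  define h where "h x = truncate (real (Suc k)) (f x)" for x
  have [measurable]: "h \<in> borel_measurable borel" unfolding h_def[abs_def] by measurable
  have h_bound: "norm (h x) \<le> real (Suc k)" for x unfolding h_def by (rule norm_truncate_le) simp
  then have "norm (h x) powr p \<le> real (Suc k) powr p" for x using p by (intro powr_mono2) auto
  then have hp: "integrable torus (\<lambda>x. norm (h x) powr p)"
    by (intro torus.integrable_const_bound[where B = "real (Suc k) powr p"]) auto
  have "\<forall>\<^sub>F n in sequentially. (LINT x|torus. norm (mollify n h x - h x) powr p) < d"
    by (rule order_tendstoD(2)[OF mollify_tendsto_Lp_bounded[OF _ h_bound _ p]]) (use \<open>d > 0\<close> in auto)
  then show "\<forall>\<^sub>F n in sequentially. dist (LINT x|torus. norm (mollify n f x - f x) powr p) 0 < e"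
  proof eventually_elim
    case (elim n)
    have "(LINT x|torus. norm (mollify n f x - f x) powr p) \<le> (2 powr p)\<^sup>2
        * (2 * (LINT x|torus. norm (f x - h x) powr p) + (LINT x|torus. norm (mollify n h x - h x) powr p))"
      by (rule integral_mollify_error_powr_le) (use fp hp p in auto)
    also have "\<dots> < (2 powr p)\<^sup>2 * (4 * d)"
      using k elim \<open>d > 0\<close> unfolding h_def by (intro mult_strict_left_mono) auto
    also have "\<dots> = e" unfolding d_def by simp
    finally show ?case by simp
  qed
qed

lemma mollify_mollify_tendsto_Lp:
  fixes f :: "real \<times> real \<Rightarrow> 'b::euclidean_space"
  assumes meas [measurable]: "f \<in> borel_measurable borel"
    and fp: "integrable torus (\<lambda>x. norm (f x) powr p)" and p: "p \<ge> 1"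
  shows "(\<lambda>n. LINT x|torus. norm (mollify n (mollify n f) x - f x) powr p) \<longlonglongrightarrow> 0"
proof (rule Lim_null_comparison)
  show "(\<lambda>n. 2 powr p * (2 * (LINT x|torus. norm (mollify n f x - f x) powr p))) \<longlonglongrightarrow> 0"
    by (intro tendsto_mult_right_zero mollify_tendsto_Lp fp p) simp
  have "(LINT x|torus. norm (mollify n (mollify n f) x - f x) powr p)
      \<le> 2 powr p * (2 * (LINT x|torus. norm (mollify n f x - f x) powr p))" for n
  proof -
    define d where "d x = mollify n f x - f x" for x
    have [measurable]: "d \<in> borel_measurable borel" unfolding d_def[abs_def] by measurable
    have dp: "integrable torus (\<lambda>x. norm (d x) powr p)"
      unfolding d_def
      by (rule integrable_norm_diff_powr) (use integrable_norm_mollify_powr[OF _ fp p] fp p in auto)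
    have f: "integrable torus f" by (rule torus.integrable_of_norm_powr[OF _ fp p]) simp
    have mdp: "integrable torus (\<lambda>x. norm (mollify n d x) powr p)"
      by (rule integrable_norm_mollify_powr[OF _ dp p]) simp
    have "norm (mollify n (mollify n f) x - f x) powr p \<le> 2 powr p * (norm (mollify n d x) powr p + norm (d x) powr p)" for x
      using norm_add_powr_le[of p "mollify n d x" "d x"] p f integrable_mollify[OF f]
      unfolding d_def by (simp add: mollify_diff)
    then have "(LINT x|torus. norm (mollify n (mollify n f) x - f x) powr p)
        \<le> (LINT x|torus. 2 powr p * (norm (mollify n d x) powr p + norm (d x) powr p))"
      using dp mdp by (intro integral_mono') auto
    also have "\<dots> = 2 powr p * ((LINT x|torus. norm (mollify n d x) powr p) + (LINT x|torus. norm (d x) powr p))"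
      using dp mdp by simp
    also have "\<dots> \<le> 2 powr p * (2 * (LINT x|torus. norm (d x) powr p))"
      using integral_norm_mollify_powr_le[OF _ dp p, of n] by (intro mult_left_mono) auto
    finally show ?thesis unfolding d_def .
  qed
  then show "\<forall>\<^sub>F n in sequentially. norm (LINT x|torus. norm (mollify n (mollify n f) x - f x) powr p)
      \<le> 2 powr p * (2 * (LINT x|torus. norm (mollify n f x - f x) powr p))" by simp
qed

lemma
  fixes q v :: "'a \<Rightarrow> 'b::{euclidean_space}"
  assumes p: "p > 1" "1/p + 1/p' = 1" and "q \<in> borel_measurable M" "v \<in> borel_measurable M"
    and qp: "integrable M (\<lambda>x. norm (q x) powr p')" and vp: "integrable M (\<lambda>x. norm (v x) powr p)" and c: "0 < c"
  shows integrable_inner_of_powr: "integrable M (\<lambda>x. q x \<bullet> v x)"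
    and abs_integral_inner_le_powr: "\<bar>LINT x|M. q x \<bullet> v x\<bar>
      \<le> c powr p' * (LINT x|M. norm (q x) powr p') + c powr (- p) * (LINT x|M. norm (v x) powr p)"
proof -
  let ?b = "\<lambda>x. c powr p' * norm (q x) powr p' + c powr (- p) * norm (v x) powr p"
  have b: "integrable M ?b" using qp vp by auto
  note young = abs_inner_le_powr_add_powr[OF p c]
  show "integrable M (\<lambda>x. q x \<bullet> v x)"
    by (rule Bochner_Integration.integrable_bound[OF b])
      (use assms young in \<open>auto intro!: AE_I2 order_trans[OF _ abs_ge_self]\<close>)
  have "\<bar>LINT x|M. q x \<bullet> v x\<bar> \<le> (LINT x|M. \<bar>q x \<bullet> v x\<bar>)"
    using integral_norm_bound[of M "\<lambda>x. q x \<bullet> v x"] by simp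
  also have "\<dots> \<le> (LINT x|M. ?b x)"
    by (rule integral_mono'[OF b young]) auto
  finally show "\<bar>LINT x|M. q x \<bullet> v x\<bar>
      \<le> c powr p' * (LINT x|M. norm (q x) powr p') + c powr (- p) * (LINT x|M. norm (v x) powr p)"
    using qp vp by simp
qed

lemma integral_inner_tendsto_0:
  fixes q :: "'a \<Rightarrow> 'b::euclidean_space" and v :: "nat \<Rightarrow> 'a \<Rightarrow> 'b"
  assumes p: "p > 1" "1/p + 1/p' = 1" and meas: "q \<in> borel_measurable M" "\<And>n. v n \<in> borel_measurable M"
    and qp: "integrable M (\<lambda>x. norm (q x) powr p')" and vp: "\<And>n. integrable M (\<lambda>x. norm (v n x) powr p)"
    and lim: "(\<lambda>n. LINT x|M. norm (v n x) powr p) \<longlonglongrightarrow> 0"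
  shows "(\<lambda>n. LINT x|M. q x \<bullet> v n x) \<longlonglongrightarrow> 0"
proof (rule tendstoI)
  fix e :: real assume "e > 0"
  define Q where "Q = (LINT x|M. norm (q x) powr p')"
  have "Q \<ge> 0" unfolding Q_def by simp
  define c where "c = (e / (2 * (Q + 1))) powr (1/p')"
  have "p' \<noteq> 0" using p by auto
  then have c: "c > 0" "c powr p' = e / (2 * (Q + 1))"
    unfolding c_def using \<open>e > 0\<close> \<open>Q \<ge> 0\<close> by (auto simp: powr_powr)
  have cQ: "c powr p' * Q < e/2"
    unfolding c(2) using \<open>e > 0\<close> \<open>Q \<ge> 0\<close> by (simp add: field_simps)
  have "(\<lambda>n. c powr (- p) * (LINT x|M. norm (v n x) powr p)) \<longlonglongrightarrow> 0"
    using lim by (rule tendsto_mult_right_zero)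
  then have "\<forall>\<^sub>F n in sequentially. c powr (- p) * (LINT x|M. norm (v n x) powr p) < e/2"
    by (rule order_tendstoD) (use \<open>e > 0\<close> in simp)
  then show "\<forall>\<^sub>F n in sequentially. dist (LINT x|M. q x \<bullet> v n x) 0 < e"
  proof eventually_elim
    case (elim n)
    then show ?case
      using abs_integral_inner_le_powr[OF p meas qp vp c(1), of n] cQ unfolding Q_def by simp
  qed
qed

lemma
  fixes f :: "real \<times> real \<Rightarrow> real"
  assumes meas [measurable]: "f \<in> borel_measurable borel" and f2: "integrable torus (\<lambda>x. (f x)\<^sup>2)"
  shows mollify_tendsto_L2: "(\<lambda>n. LINT x|torus. (mollify n f x - f x)\<^sup>2) \<longlonglongrightarrow> 0"
    and integral_mollify_power2_tendsto: "(\<lambda>n. LINT x|torus. (mollify n f x)\<^sup>2) \<longlonglongrightarrow> (LINT x|torus. (f x)\<^sup>2)"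
proof -
  define d where "d n x = mollify n f x - f x" for n x
  have [measurable]: "d n \<in> borel_measurable borel" for n unfolding d_def[abs_def] by measurable
  have d2: "integrable torus (\<lambda>x. (d n x)\<^sup>2)" for n
    unfolding d_def by (rule integrable_power2_diff) (use f2 integrable_norm_mollify_power2[of f n] in auto)
  show lim: "(\<lambda>n. LINT x|torus. (mollify n f x - f x)\<^sup>2) \<longlonglongrightarrow> 0"
    using mollify_tendsto_Lp[of f 2] f2 by simp
  have "(\<lambda>n. LINT x|torus. f x \<bullet> d n x) \<longlonglongrightarrow> 0"
    by (rule integral_inner_tendsto_0[where p = 2 and p' = 2]) (use f2 d2 lim in \<open>auto simp: d_def\<close>)
  then have "(\<lambda>n. (LINT x|torus. (d n x)\<^sup>2) + 2 * (LINT x|torus. f x * d n x) + (LINT x|torus. (f x)\<^sup>2))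
      \<longlonglongrightarrow> 0 + 2 * 0 + (LINT x|torus. (f x)\<^sup>2)"
    using lim unfolding d_def by (intro tendsto_intros) auto
  moreover have "(LINT x|torus. (mollify n f x)\<^sup>2)
      = (LINT x|torus. (d n x)\<^sup>2) + 2 * (LINT x|torus. f x * d n x) + (LINT x|torus. (f x)\<^sup>2)" for n
  proof -
    have "(LINT x|torus. (mollify n f x)\<^sup>2) = (LINT x|torus. (d n x)\<^sup>2 + 2 * (f x * d n x) + (f x)\<^sup>2)"
      unfolding d_def by (simp add: power2_eq_square algebra_simps)
    then show ?thesis
      using d2[of n] f2 integrable_mult_of_power2[of f torus "d n"] by simp
  qed
  ultimately show "(\<lambda>n. LINT x|torus. (mollify n f x)\<^sup>2) \<longlonglongrightarrow> (LINT x|torus. (f x)\<^sup>2)" by simp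
qed

section \<open>Periodic $C^1$ functions and weak gradients\<close>

definition periodic_C1 :: "(real \<times> real \<Rightarrow> real) \<Rightarrow> (real \<times> real \<Rightarrow> real \<times> real) \<Rightarrow> bool" where
  "periodic_C1 F G \<longleftrightarrow> (\<forall>x. GDERIV F x :> G x) \<and> continuous_on UNIV G \<and> periodic_x F"

lemma periodic_C1_GDERIV: "periodic_C1 F G \<Longrightarrow> GDERIV F x :> G x"
  and periodic_C1_continuous_grad: "periodic_C1 F G \<Longrightarrow> continuous_on UNIV G"
  and periodic_C1_periodic: "periodic_C1 F G \<Longrightarrow> periodic_x F"
  unfolding periodic_C1_def by blast+

lemma periodic_C1_continuous:
  assumes "periodic_C1 F G"
  shows "continuous_on UNIV F"
  using periodic_C1_GDERIV[OF assms] unfolding gderiv_def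
  by (meson continuous_at_imp_continuous_on has_derivative_continuous)

lemma periodic_C1_DERIV_fst:
  assumes "periodic_C1 F G"
  shows "((\<lambda>s. F (s, b)) has_field_derivative fst (G (s, b))) (at s)"
  using GDERIV_imp_DERIV_line[OF periodic_C1_GDERIV[OF assms], of "(0, b)" "(1, 0)" s] by (simp add: inner_prod_def)

lemma periodic_C1_DERIV_snd:
  assumes "periodic_C1 F G"
  shows "((\<lambda>s. F (a, s)) has_field_derivative snd (G (a, s))) (at s)"
  using GDERIV_imp_DERIV_line[OF periodic_C1_GDERIV[OF assms], of "(a, 0)" "(0, 1)" s] by (simp add: inner_prod_def)

lemma periodic_C1_wrap:
  assumes "periodic_C1 F G"
  shows "F (0, b) = F (1, b)" "F (a, 0) = F (a, 1)"
  using periodic_C1_periodic[OF assms, unfolded periodic_x_def, rule_format, of 0 1 b 0]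
    periodic_C1_periodic[OF assms, unfolded periodic_x_def, rule_format, of a 0 0 1] by simp_all

lemma periodic_C1_bounded:
  assumes F: "periodic_C1 F G"
  obtains C where "\<And>x. \<bar>F x\<bar> \<le> C" "\<And>x. norm (G x) \<le> C"
proof -
  have "G (a + of_int k, b + of_int l) = G (a, b)" for a b k l
  proof -
    let ?k = "(of_int k, of_int l)"
    have "(\<lambda>x. F (x + ?k)) = F"
      using periodic_C1_periodic[OF F] unfolding periodic_x_def by (auto simp: fun_eq_iff)
    moreover have "((\<lambda>x. F (x + ?k)) has_derivative (\<lambda>h. h \<bullet> G ((a, b) + ?k))) (at (a, b))"
      by (rule has_derivative_compose[OF _ periodic_C1_GDERIV[OF F, unfolded gderiv_def]])
        (auto intro!: derivative_eq_intros)
    ultimately have "(\<lambda>h. h \<bullet> G ((a, b) + ?k)) = (\<lambda>h. h \<bullet> G (a, b))"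
      using has_derivative_unique[OF _ periodic_C1_GDERIV[OF F, unfolded gderiv_def]] by metis
    then have "\<forall>h. h \<bullet> G ((a, b) + ?k) = h \<bullet> G (a, b)" unfolding fun_eq_iff .
    then have "G ((a, b) + ?k) = G (a, b)" unfolding vector_eq_ldot .
    then show ?thesis by simp
  qed
  then have "periodic_x G" unfolding periodic_x_def by blast
  then obtain C C' where "\<And>x. norm (G x) \<le> C" "\<And>x. \<bar>F x\<bar> \<le> C'"
    using bounded_range_periodic[OF periodic_C1_continuous_grad[OF F]]
      bounded_range_periodic[OF periodic_C1_continuous[OF F] periodic_C1_periodic[OF F]]
    unfolding bounded_iff by auto
  then show thesis using that[of "max C C'"] by (meson max.cobounded1 max.cobounded2 order_trans)
qed

lemma continuous_on_Pair_left: "continuous_on UNIV f \<Longrightarrow> continuous_on UNIV (\<lambda>s. f (s, b))"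
  and continuous_on_Pair_right: "continuous_on UNIV f \<Longrightarrow> continuous_on UNIV (\<lambda>s. f (a, s))"
  by (auto intro!: continuous_on_compose2[of UNIV f] continuous_intros)

lemma periodic_C1_mult:
  assumes "periodic_C1 F G" "periodic_C1 H K"
  shows "periodic_C1 (\<lambda>x. F x * H x) (\<lambda>x. F x *\<^sub>R K x + H x *\<^sub>R G x)"
  using assms periodic_C1_continuous[OF assms(1)] periodic_C1_continuous[OF assms(2)]
  unfolding periodic_C1_def periodic_x_def by (auto intro!: GDERIV_mult continuous_intros)

lemma periodic_C1_const: "periodic_C1 (\<lambda>_. c) (\<lambda>_. 0)"
  unfolding periodic_C1_def periodic_x_def by (simp add: GDERIV_const)

lemma periodic_C1_mollify:
  assumes "integrable torus f"
  shows "periodic_C1 (mollify n f) (mollify_grad n f)"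
  unfolding periodic_C1_def
  using GDERIV_mollify[OF assms] continuous_on_mollify_grad[OF assms] periodic_x_mollify by blast

lemma periodic_C1_kernel: "periodic_C1 (\<lambda>y. kernel n (y - x)) (\<lambda>y. kernel_grad n (y - x))"
proof -
  have "GDERIV (\<lambda>y. kernel n (y - x)) y :> kernel_grad n (y - x)" for y
    using has_derivative_compose[OF has_derivative_diff[OF has_derivative_ident has_derivative_const]
        GDERIV_kernel[unfolded gderiv_def]] by (simp add: gderiv_def)
  then show ?thesis
    unfolding periodic_C1_def using periodic_x_kernel_shift(1) by (auto intro!: continuous_intros)
qed

lemma integral_periodic_C1_grad:
  assumes F: "periodic_C1 F G"
  shows "(LINT x|torus. G x) = 0"
proof -
  note G = periodic_C1_continuous_grad[OF F]
  have cont: "continuous_on UNIV (\<lambda>x. fst (G x))" "continuous_on UNIV (\<lambda>x. snd (G x))"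
    using G by (auto intro: continuous_intros)
  have "(LINT s|circle. fst (G (s, b))) = 0" for b
    using integral_time_deriv[OF periodic_C1_DERIV_fst[OF F] continuous_on_Pair_left[OF cont(1)], of 0 1]
      periodic_C1_wrap[OF F] by simp
  then have "(LINT x|torus. fst (G x)) = 0" using integral_torus_columns[OF cont(1)] by simp
  moreover have "(LINT s|circle. snd (G (a, s))) = 0" for a
    using integral_time_deriv[OF periodic_C1_DERIV_snd[OF F] continuous_on_Pair_right[OF cont(2)], of 0 1]
      periodic_C1_wrap[OF F] by simp
  then have "(LINT x|torus. snd (G x)) = 0" using integral_torus_rows[OF cont(2)] by simp
  ultimately show ?thesis
    using integral_bounded_linear[OF bounded_linear_fst integrable_torus_continuous[OF G]]
      integral_bounded_linear[OF bounded_linear_snd integrable_torus_continuous[OF G]]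
    by (simp add: prod_eq_iff)
qed

lemma integral_by_parts_torus:
  assumes F: "periodic_C1 F G" and H: "periodic_C1 H K"
  shows "(LINT x|torus. F x *\<^sub>R K x) = - (LINT x|torus. H x *\<^sub>R G x)"
proof -
  note [continuous_intros] = periodic_C1_continuous[OF F] periodic_C1_continuous_grad[OF F]
    periodic_C1_continuous[OF H] periodic_C1_continuous_grad[OF H]
  have "integrable torus (\<lambda>x. F x *\<^sub>R K x)" "integrable torus (\<lambda>x. H x *\<^sub>R G x)"
    by (intro integrable_torus_continuous continuous_intros)+
  then show ?thesis
    using integral_periodic_C1_grad[OF periodic_C1_mult[OF F H]] by (simp add: eq_neg_iff_add_eq_0)
qed

lemma mollify_grad_periodic_C1:
  assumes "periodic_C1 F G"
  shows "mollify_grad n F x = mollify n G x"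
proof -
  have "mollify_grad n F x = - (LINT y|torus. F y *\<^sub>R kernel_grad n (y - x))"
    unfolding mollify_grad_def kernel_commute(2)[of n x] by simp
  also have "\<dots> = (LINT y|torus. kernel n (y - x) *\<^sub>R G y)"
    using integral_by_parts_torus[OF assms periodic_C1_kernel] by simp
  finally show ?thesis unfolding mollify_def kernel_commute(1)[of n x] .
qed

lemma integral_mult_mollify_div:
  assumes F: "periodic_C1 F G" and q: "integrable torus q"
  shows "(LINT x|torus. F x * mollify_div n q x) = - (LINT x|torus. q x \<bullet> mollify n G x)"
proof -
  note cont = periodic_C1_continuous[OF F]
  have [measurable]: "F \<in> borel_measurable borel" "q \<in> borel_measurable borel"
    using cont q by (auto intro: borel_measurable_continuous_onI)
  obtain B where B: "\<bar>F x\<bar> \<le> B" for x using periodic_C1_bounded[OF F] by metis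
  have "0 \<le> B" using order_trans[OF abs_ge_zero B] by simp
  have "integrable (torus \<Otimes>\<^sub>M torus) (\<lambda>z. q (snd z))"
    by (rule torus_torus.Fubini_integrable) (use q in auto)
  then have "integrable (torus \<Otimes>\<^sub>M torus) (\<lambda>z. F (fst z) * (q (snd z) \<bullet> kernel_grad n (fst z - snd z)))"
  proof (rule integrable_dominated[where C = "B * kernel_grad_bound n"])
    fix z
    have "\<bar>F (fst z)\<bar> * \<bar>q (snd z) \<bullet> kernel_grad n (fst z - snd z)\<bar> \<le> B * (kernel_grad_bound n * norm (q (snd z)))"
      using \<open>0 \<le> B\<close> by (intro mult_mono B abs_inner_kernel_grad_le) auto
    then show "norm (F (fst z) * (q (snd z) \<bullet> kernel_grad n (fst z - snd z))) \<le> B * kernel_grad_bound n * norm (q (snd z))"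
      by (simp add: abs_mult mult.assoc)
  qed measurable
  then have pair: "integrable (torus \<Otimes>\<^sub>M torus) (\<lambda>(x, y). F x * (q y \<bullet> kernel_grad n (x - y)))"
    by (simp add: split_beta')
  have "(LINT x|torus. F x * mollify_div n q x) = (LINT y|torus. LINT x|torus. F x * (q y \<bullet> kernel_grad n (x - y)))"
    unfolding mollify_div_def using torus_torus.Fubini_integral[OF pair] by simp
  also have "\<dots> = (LINT y|torus. - (q y \<bullet> mollify n G y))"
  proof (intro Bochner_Integration.integral_cong refl)
    fix y
    have "(LINT x|torus. F x * (q y \<bullet> kernel_grad n (x - y))) = - (LINT x|torus. q y \<bullet> (F x *\<^sub>R kernel_grad n (y - x)))"
      by (subst kernel_commute(2)) (simp add: inner_scaleR_right)
    also have "\<dots> = - (q y \<bullet> mollify_grad n F y)"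
      unfolding mollify_grad_def
      using integral_inner_right[OF integrable_scaleR_kernel_grad[OF integrable_torus_continuous[OF cont], of n y], of "q y"]
      by (simp only:)
    finally show "(LINT x|torus. F x * (q y \<bullet> kernel_grad n (x - y))) = - (q y \<bullet> mollify n G y)"
      unfolding mollify_grad_periodic_C1[OF F] .
  qed
  finally show ?thesis by simp
qed

lemma periodic_C1_power2_diff_le:
  assumes F: "periodic_C1 F G" and "x \<in> cell" "y \<in> cell" and near: "kernel r (x - y) \<noteq> 0"
  shows "(F x - F y)\<^sup>2 \<le> 2 * radius r
    * ((LINT w|circle. (fst (G (w, snd x)))\<^sup>2) + (LINT w|circle. (snd (G (fst y, w)))\<^sup>2))"
proof -
  obtain a b a' b' where xy: "x = (a, b)" "y = (a', b')" by (cases x, cases y)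
  have cont: "continuous_on UNIV (\<lambda>x. fst (G x))" "continuous_on UNIV (\<lambda>x. snd (G x))"
    using periodic_C1_continuous_grad[OF F] by (auto intro: continuous_intros)
  have "(F (a, b) - F (a', b))\<^sup>2 \<le> radius r * (LINT w|circle. (fst (G (w, b)))\<^sup>2)"
    by (rule periodic_power2_diff_le[OF periodic_C1_DERIV_fst[OF F] continuous_on_Pair_left[OF cont(1)]])
      (use assms periodic_C1_wrap[OF F] kernel_support(1)[OF near] in \<open>auto simp: xy cell_def\<close>)
  moreover have "(F (a', b) - F (a', b'))\<^sup>2 \<le> radius r * (LINT w|circle. (snd (G (a', w)))\<^sup>2)"
    by (rule periodic_power2_diff_le[OF periodic_C1_DERIV_snd[OF F] continuous_on_Pair_right[OF cont(2)]])
      (use assms periodic_C1_wrap[OF F] kernel_support(2)[OF near] in \<open>auto simp: xy cell_def\<close>)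
  ultimately show ?thesis
    using power2_add_le[of "F (a, b) - F (a', b)" "F (a', b) - F (a', b')"]
    unfolding xy by (simp add: distrib_left)
qed

lemma periodic_C1_mollify_error_power2_le:
  assumes F: "periodic_C1 F G" and x: "x \<in> cell"
  shows "(F x - mollify r F x)\<^sup>2 \<le> 2 * radius r
    * ((LINT w|circle. (fst (G (w, snd x)))\<^sup>2) + mollify r (\<lambda>y. LINT w|circle. (snd (G (fst y, w)))\<^sup>2) x)"
proof -
  define row where "row = (LINT w|circle. (fst (G (w, snd x)))\<^sup>2)"
  define column where "column y = (LINT w|circle. (snd (G (fst y, w)))\<^sup>2)" for y :: "real \<times> real"
  have [continuous_intros]: "continuous_on UNIV F" "continuous_on UNIV G"
    using periodic_C1_continuous[OF F] periodic_C1_continuous_grad[OF F] .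
  have [measurable]: "F \<in> borel_measurable borel" by (intro borel_measurable_continuous_onI continuous_intros)
  have F_int: "integrable torus F" by (intro integrable_torus_continuous continuous_intros)
  have column: "integrable torus column"
    unfolding column_def[abs_def]
    by (rule integrable_torus_row_integral[of "\<lambda>x. (snd (G x))\<^sup>2"], intro continuous_intros)
  have square: "integrable torus (\<lambda>y. (norm (F x - F y))\<^sup>2)"
    by (intro integrable_torus_continuous continuous_intros)
  have "F x - mollify r F x = mollify r (\<lambda>y. F x - F y) x"
    using F_int by (simp add: mollify_diff mollify_const)
  then have "(F x - mollify r F x)\<^sup>2 \<le> mollify r (\<lambda>y. (norm (F x - F y))\<^sup>2) x"
    using norm_mollify_power2_le[OF _ square, of r x] by simp
  also have "\<dots> \<le> mollify r (\<lambda>y. 2 * radius r * (row + column y)) x"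
  proof (rule mollify_mono[OF square])
    show "(norm (F x - F y))\<^sup>2 \<le> 2 * radius r * (row + column y)" if "y \<in> cell" "kernel r (x - y) \<noteq> 0" for y
      using periodic_C1_power2_diff_le[OF F x that] unfolding row_def column_def by simp
  qed (use column in auto)
  also have "\<dots> = 2 * radius r * (row + mollify r column x)"
    using column by (simp add: mollify_mult_left mollify_add mollify_const)
  finally show ?thesis unfolding row_def column_def[abs_def] .
qed

lemma periodic_C1_smoothing:
  assumes F: "periodic_C1 F G"
  shows "(LINT x|torus. (F x - mollify r F x)\<^sup>2) \<le> 2 * radius r * (LINT x|torus. (norm (G x))\<^sup>2)"
proof -
  define row where "row b = (LINT w|circle. (fst (G (w, b)))\<^sup>2)" for b
  define column where "column a = (LINT w|circle. (snd (G (a, w)))\<^sup>2)" for a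
  have [continuous_intros]: "continuous_on UNIV F" "continuous_on UNIV G"
    using periodic_C1_continuous[OF F] periodic_C1_continuous_grad[OF F] .
  have F_int: "integrable torus F" by (intro integrable_torus_continuous continuous_intros)
  have row: "integrable torus (\<lambda>x. row (snd x))" "(LINT x|torus. row (snd x)) = (LINT x|torus. (fst (G x))\<^sup>2)"
    unfolding row_def
    by (rule integrable_torus_column_integral[of "\<lambda>x. (fst (G x))\<^sup>2"]
        integral_torus_column_integral[of "\<lambda>x. (fst (G x))\<^sup>2"], intro continuous_intros)+
  have column: "integrable torus (\<lambda>x. column (fst x))" "(LINT x|torus. column (fst x)) = (LINT x|torus. (snd (G x))\<^sup>2)"
    unfolding column_def
    by (rule integrable_torus_row_integral[of "\<lambda>x. (snd (G x))\<^sup>2"]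
        integral_torus_row_integral[of "\<lambda>x. (snd (G x))\<^sup>2"], intro continuous_intros)+
  define u where "u x = 2 * radius r * (row (snd x) + mollify r (\<lambda>y. column (fst y)) x)" for x

  have "(LINT x|torus. (F x - mollify r F x)\<^sup>2) \<le> (LINT x|torus. u x)"
  proof (rule integral_mono_AE)
    show "integrable torus (\<lambda>x. (F x - mollify r F x)\<^sup>2)"
      by (intro integrable_torus_continuous continuous_intros continuous_on_mollify F_int)
    show "integrable torus u" unfolding u_def using row(1) integrable_mollify[OF column(1)] by auto
    show "AE x in torus. (F x - mollify r F x)\<^sup>2 \<le> u x"
      unfolding u_def row_def column_def
      using AE_torus_cell by eventually_elim (rule periodic_C1_mollify_error_power2_le[OF F])
  qed
  also have "\<dots> = 2 * radius r * ((LINT x|torus. (fst (G x))\<^sup>2) + (LINT x|torus. (snd (G x))\<^sup>2))"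
    unfolding u_def using row column integrable_mollify[OF column(1)] integral_mollify[OF column(1)] by simp
  also have "(LINT x|torus. (fst (G x))\<^sup>2) + (LINT x|torus. (snd (G x))\<^sup>2) = (LINT x|torus. (norm (G x))\<^sup>2)"
    unfolding norm_prod_power2
    by (intro Bochner_Integration.integral_add[symmetric] integrable_torus_continuous continuous_intros)
  finally show ?thesis .
qed

text \<open>The weak gradient is tested against the mollification kernels only, which is all that is needed
  and holds for almost every time slice of a weak solution.\<close>

definition weak_gradient :: "(real \<times> real \<Rightarrow> real) \<Rightarrow> (real \<times> real \<Rightarrow> real \<times> real) \<Rightarrow> bool" where
  "weak_gradient f G \<longleftrightarrow> f \<in> borel_measurable borel \<and> G \<in> borel_measurable borel \<and>
     integrable torus (\<lambda>x. (f x)\<^sup>2) \<and> integrable torus (\<lambda>x. (norm (G x))\<^sup>2) \<and>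
     (\<forall>n. mollify_grad n f = mollify n G)"

lemma weak_gradient_D:
  assumes "weak_gradient f G"
  shows weak_gradient_borel: "f \<in> borel_measurable borel" "G \<in> borel_measurable borel"
    and weak_gradient_power2: "integrable torus (\<lambda>x. (f x)\<^sup>2)" "integrable torus (\<lambda>x. (norm (G x))\<^sup>2)"
    and weak_gradient_integrable: "integrable torus f" "integrable torus G"
    and weak_gradient_mollify: "mollify_grad n f = mollify n G"
  using assms unfolding weak_gradient_def
  by (auto intro: torus.integrable_of_norm_power2)

lemma periodic_C1_mollify_weak:
  assumes "weak_gradient f G"
  shows "periodic_C1 (mollify n f) (mollify n G)"
  using periodic_C1_mollify[OF weak_gradient_integrable(1)[OF assms], of n]
  unfolding weak_gradient_mollify[OF assms] .

lemma integral_mollify_error_power2_le: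
  fixes f F :: "real \<times> real \<Rightarrow> real"
  assumes [measurable]: "f \<in> borel_measurable borel" "F \<in> borel_measurable borel"
    and f2: "integrable torus (\<lambda>x. (f x)\<^sup>2)" and F2: "integrable torus (\<lambda>x. (F x)\<^sup>2)"
  shows "(LINT x|torus. (f x - mollify r f x)\<^sup>2)
    \<le> 2 * (LINT x|torus. (F x - mollify r F x)\<^sup>2) + 8 * (LINT x|torus. (F x - f x)\<^sup>2)"
proof -
  define d where "d x = F x - f x" for x
  have [measurable]: "d \<in> borel_measurable borel" unfolding d_def[abs_def] by measurable
  have d2: "integrable torus (\<lambda>x. (d x)\<^sup>2)" unfolding d_def by (intro integrable_power2_diff F2 f2) auto
  have mollify_d: "integrable torus (\<lambda>x. (mollify r d x)\<^sup>2)" "(LINT x|torus. (mollify r d x)\<^sup>2) \<le> (LINT x|torus. (d x)\<^sup>2)"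
    using integrable_norm_mollify_power2[of d r] integral_norm_mollify_power2_le[of d r] d2 by auto
  have "integrable torus (\<lambda>x. (mollify r F x)\<^sup>2)"
    using integrable_norm_mollify_power2[of F r] F2 by simp
  then have error: "integrable torus (\<lambda>x. (F x - mollify r F x)\<^sup>2)"
    by (intro integrable_power2_diff F2) auto
  have integrable: "integrable torus F" "integrable torus f"
    using torus.integrable_of_norm_power2[of F] torus.integrable_of_norm_power2[of f] f2 F2 by simp_all
  have "(f x - mollify r f x)\<^sup>2 \<le> 2 * (F x - mollify r F x)\<^sup>2 + 4 * (d x)\<^sup>2 + 4 * (mollify r d x)\<^sup>2" for x
  proof -
    have "f x - mollify r f x = (F x - mollify r F x) + - d x + mollify r d x"
      unfolding d_def by (simp add: mollify_diff integrable)
    then show ?thesis using power2_add3_le[of "F x - mollify r F x" "- d x" "mollify r d x"] by simp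
  qed
  then have "(LINT x|torus. (f x - mollify r f x)\<^sup>2)
      \<le> (LINT x|torus. 2 * (F x - mollify r F x)\<^sup>2 + 4 * (d x)\<^sup>2 + 4 * (mollify r d x)\<^sup>2)"
    using error d2 mollify_d by (intro integral_mono') auto
  also have "\<dots> = 2 * (LINT x|torus. (F x - mollify r F x)\<^sup>2) + 4 * (LINT x|torus. (d x)\<^sup>2)
      + 4 * (LINT x|torus. (mollify r d x)\<^sup>2)"
    using error d2 mollify_d by simp
  finally show ?thesis using mollify_d(2) unfolding d_def by linarith
qed

lemma weak_gradient_smoothing:
  assumes w: "weak_gradient f G"
  shows "(LINT x|torus. (f x - mollify r f x)\<^sup>2) \<le> 4 * radius r * (LINT x|torus. (norm (G x))\<^sup>2)"
proof -
  note [measurable] = weak_gradient_borel[OF w]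
  note f2 = weak_gradient_power2(1)[OF w] and G2 = weak_gradient_power2(2)[OF w]
  let ?I = "LINT x|torus. (norm (G x))\<^sup>2"
  have approx: "(LINT x|torus. (f x - mollify r f x)\<^sup>2) \<le> 4 * radius r * ?I + 8 * (LINT x|torus. (mollify n f x - f x)\<^sup>2)" for n
  proof -
    have "integrable torus (\<lambda>x. (mollify n f x)\<^sup>2)"
      using integrable_norm_mollify_power2[of f n] f2 by simp
    then have "(LINT x|torus. (f x - mollify r f x)\<^sup>2) \<le> 2 * (LINT x|torus. (mollify n f x - mollify r (mollify n f) x)\<^sup>2)
        + 8 * (LINT x|torus. (mollify n f x - f x)\<^sup>2)"
      by (intro integral_mollify_error_power2_le f2) measurable
    also have "(LINT x|torus. (mollify n f x - mollify r (mollify n f) x)\<^sup>2)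
        \<le> 2 * radius r * (LINT x|torus. (norm (mollify n G x))\<^sup>2)"
      by (rule periodic_C1_smoothing[OF periodic_C1_mollify_weak[OF w]])
    also have "\<dots> \<le> 2 * radius r * ?I"
      using integral_norm_mollify_power2_le[OF _ G2, of n] by (intro mult_left_mono) (auto simp: less_imp_le)
    finally show ?thesis by simp
  qed
  have "(\<lambda>n. 4 * radius r * ?I + 8 * (LINT x|torus. (mollify n f x - f x)\<^sup>2)) \<longlonglongrightarrow> 4 * radius r * ?I + 8 * 0"
    by (intro tendsto_intros mollify_tendsto_L2 f2) simp
  from LIMSEQ_le_const[OF this] approx show ?thesis by auto
qed

lemma weak_gradient_row_bound:
  assumes w: "weak_gradient f G" and [measurable]: "\<beta> \<in> borel_measurable borel"
    and \<beta>: "\<And>s. s \<in> {0..1} \<Longrightarrow> \<beta> s \<in> {0..1} \<and> \<bar>s - \<beta> s\<bar> \<le> h"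
  shows "(LINT x|torus. (mollify n f x - mollify n f (fst x, \<beta> (snd x)))\<^sup>2) \<le> h * (LINT x|torus. (norm (G x))\<^sup>2)"
proof -
  note [measurable] = weak_gradient_borel[OF w]
  note G2 = weak_gradient_power2(2)[OF w] and F = periodic_C1_mollify_weak[OF w, of n]
  define K where "K x = snd (mollify n G x)" for x
  have K: "continuous_on UNIV K"
    unfolding K_def using periodic_C1_continuous_grad[OF F] by (auto intro: continuous_intros)
  then have K2: "continuous_on UNIV (\<lambda>x. (K x)\<^sup>2)" by (intro continuous_intros)
  define energy where "energy a = (LINT w|circle. (K (a, w))\<^sup>2)" for a
  have "0 \<le> h" using \<beta>[of 0] by (auto intro: order_trans[OF abs_ge_zero])
  have "(LINT x|torus. (mollify n f x - mollify n f (fst x, \<beta> (snd x)))\<^sup>2) \<le> (LINT x|torus. h * energy (fst x))"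
  proof (rule integral_mono_AE')
    show "integrable torus (\<lambda>x. h * energy (fst x))"
      unfolding energy_def using integrable_torus_row_integral[OF K2] by simp
    show "AE x in torus. 0 \<le> h * energy (fst x)" using \<open>0 \<le> h\<close> by (simp add: energy_def)
    show "AE x in torus. (mollify n f x - mollify n f (fst x, \<beta> (snd x)))\<^sup>2 \<le> h * energy (fst x)"
      using AE_torus_cell
    proof eventually_elim
      case (elim x)
      obtain s t where x: "x = (s, t)" by (cases x)
      then have t: "t \<in> {0..1}" using elim by (simp add: cell_def)
      have "(mollify n f (s, t) - mollify n f (s, \<beta> t))\<^sup>2 \<le> \<bar>t - \<beta> t\<bar> * energy s"
        using power2_diff_le_integral_deriv[OF periodic_C1_DERIV_snd[OF F] continuous_on_Pair_right[OF K[unfolded K_def]] t]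
          \<beta>[OF t] unfolding energy_def K_def by blast
      also have "\<dots> \<le> h * energy s" using \<beta>[OF t] by (intro mult_right_mono) (auto simp: energy_def)
      finally show ?case unfolding x by simp
    qed
  qed
  also have "\<dots> = h * (LINT x|torus. (K x)\<^sup>2)"
    unfolding energy_def using integral_torus_row_integral[OF K2] by simp
  also have "(LINT x|torus. (K x)\<^sup>2) \<le> (LINT x|torus. (norm (mollify n G x))\<^sup>2)"
    by (rule integral_mono[OF integrable_torus_continuous[OF K2] integrable_norm_mollify_power2[OF _ G2]])
      (auto simp: K_def norm_prod_power2)
  also have "\<dots> \<le> (LINT x|torus. (norm (G x))\<^sup>2)" by (rule integral_norm_mollify_power2_le[OF _ G2]) simp
  finally show ?thesis using \<open>0 \<le> h\<close> by (simp add: mult_left_mono)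
qed

section \<open>Primitives in time\<close>

lemma integral_time_restrict:
  fixes f :: "real \<Rightarrow> 'b::{banach, second_countable_topology}"
  assumes [measurable]: "f \<in> borel_measurable borel" and "t \<le> T"
  shows "(LINT s|time T. (if s \<le> t then f s else 0)) = (LINT s|time t. f s)"
    and "(LINT s|time T. (if s < t then f s else 0)) = (LINT s|time t. f s)"
proof -
  have "(LINT s|time T. (if s \<le> t then f s else 0)) = (LINT s:{0..T}|lborel. (if s \<le> t then f s else 0))"
    by (rule integral_lborel_on) simp_all
  also have "\<dots> = (LINT s:{0..t}|lborel. f s)"
    unfolding set_lebesgue_integral_def
    by (intro Bochner_Integration.integral_cong) (use assms(2) in \<open>auto simp: indicator_def\<close>)
  also have "\<dots> = (LINT s|time t. f s)" by (rule integral_lborel_on[symmetric]) simp_all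
  finally show closed: "(LINT s|time T. (if s \<le> t then f s else 0)) = (LINT s|time t. f s)" .
  have "AE s in time T. s \<noteq> t"
    unfolding AE_lborel_on[OF atLeastAtMost_borel] using AE_lborel_singleton[of t] by eventually_elim simp
  then have "AE s in time T. (if s < t then f s else 0) = (if s \<le> t then f s else 0)"
    by eventually_elim (simp add: indicator_def)
  then have "(LINT s|time T. (if s < t then f s else 0)) = (LINT s|time T. (if s \<le> t then f s else 0))"
    by (intro integral_cong_AE) auto
  with closed show "(LINT s|time T. (if s < t then f s else 0)) = (LINT s|time t. f s)" by simp
qed

lemma borel_measurable_primitive:
  fixes f :: "real \<Rightarrow> 'b::{banach, second_countable_topology}"
  assumes [measurable]: "f \<in> borel_measurable borel"
  shows "(\<lambda>t. LINT s|time t. f s) \<in> borel_measurable borel"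
proof -
  have "(LINT s|time t. f s) = (LINT s|lborel. (if 0 \<le> s \<and> s \<le> t then f s else 0))" for t
    using integral_lborel_on[OF assms, of "{0..t}"]
    by (simp add: set_lebesgue_integral_def indicator_scaleR_eq_if)
  then show ?thesis by simp
qed

lemma set_integral_time_atMost:
  fixes f :: "real \<Rightarrow> 'b::{banach, second_countable_topology}"
  assumes [measurable]: "f \<in> borel_measurable borel"
  shows "set_lebesgue_integral (time T) {..t} f = (LINT s|time (min t T). f s)"
proof -
  have "set_lebesgue_integral (time T) {..t} f = (LINT s|time T. (if s \<le> min t T then f s else 0))"
    unfolding set_lebesgue_integral_def
    by (rule integral_cong_AE) (auto intro!: eventually_mono[OF AE_time[of T]] simp: indicator_def)
  then show ?thesis using integral_time_restrict(1)[of f "min t T" T] by simp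
qed

lemma AE_zero_of_primitive_zero:
  fixes f :: "real \<Rightarrow> 'b::{banach, second_countable_topology}"
  assumes f: "integrable (time T) f" and zero: "\<And>t. 0 \<le> t \<Longrightarrow> t \<le> T \<Longrightarrow> (LINT s|time t. f s) = 0"
  shows "AE s in time T. f s = 0"
proof (rule time.density_zero[OF f])
  fix A assume "A \<in> sets (time T)"
  have [measurable]: "f \<in> borel_measurable borel" using f by auto
  have primitive_zero: "(LINT s|time t. f s) = 0" if "t \<le> T" for t
    using zero[OF _ that] integral_lborel_on[of f "{0..t}"]
    by (cases "0 \<le> t") (simp_all add: set_lebesgue_integral_def)
  have set_int: "set_integrable (time T) B f" if "B \<in> sets borel" for B
    unfolding set_integrable_def by (rule integrable_mult_indicator[OF _ f]) (use that in simp)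
  have generated: "sigma_sets UNIV (range (\<lambda>t::real. {..t})) = sets borel" by (simp add: borel_eq_atMost)
  have "Int_stable (range (\<lambda>t::real. {..t}))" by (auto simp: Int_stable_def Int_atMost)
  moreover have "range (\<lambda>t::real. {..t}) \<subseteq> Pow UNIV" by simp
  moreover have "A \<in> sigma_sets UNIV (range (\<lambda>t. {..t}))"
    using \<open>A \<in> sets (time T)\<close> generated by simp
  ultimately show "set_lebesgue_integral (time T) A f = 0"
  proof (induction rule: sigma_sets_induct_disjoint)
    case (basic B)
    then show ?case using primitive_zero by (auto simp: set_integral_time_atMost)
  next
    case empty
    then show ?case by (simp add: set_lebesgue_integral_def)
  next
    case (compl B)
    then have B: "B \<in> sets borel" unfolding generated by simp
    have "set_lebesgue_integral (time T) (B \<union> (UNIV - B)) f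
        = set_lebesgue_integral (time T) B f + set_lebesgue_integral (time T) (UNIV - B) f"
      by (rule set_integral_Un) (use B set_int in auto)
    then show ?case using compl primitive_zero[of T] by (simp add: set_lebesgue_integral_def)
  next
    case (union B)
    then have B: "B i \<in> sets borel" for i unfolding generated by auto
    have "set_lebesgue_integral (time T) (\<Union>i. B i) f = (\<Sum>i. set_lebesgue_integral (time T) (B i) f)"
      by (rule lebesgue_integral_countable_add)
        (use union(1) B set_int in \<open>auto simp: disjoint_family_on_def\<close>)
    then show ?case using union by simp
  qed
qed

text \<open>Both halves $\{a \le b\}$ and $\{b < a\}$ of the square contribute the same iterated integral.\<close>

lemma integral_time_power2:
  fixes F :: "real \<Rightarrow> real"
  assumes F: "integrable (time T) F"
  shows "(LINT s|time T. F s)\<^sup>2 = 2 * (LINT b|time T. F b * (LINT a|time b. F a))"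
proof -
  have [measurable]: "F \<in> borel_measurable borel" using F by auto
  note [measurable] = borel_measurable_primitive[of F]
  have "integrable (time T \<Otimes>\<^sub>M time T) (\<lambda>z. F (fst z) * F (snd z))"
    by (rule time_time.Fubini_integrable) (use F in \<open>auto simp: abs_mult\<close>)
  then have square: "integrable (time T \<Otimes>\<^sub>M time T) (\<lambda>(a, b). F a * F b)" by (simp add: split_beta')
  have lower: "integrable (time T \<Otimes>\<^sub>M time T) (\<lambda>(a, b). F b * (if a \<le> b then F a else 0))"
    by (rule Bochner_Integration.integrable_bound[OF square])
      (auto intro!: AE_I2 simp: abs_mult mult.commute)
  have upper: "integrable (time T \<Otimes>\<^sub>M time T) (\<lambda>(a, b). F a * (if b < a then F b else 0))"
    by (rule Bochner_Integration.integrable_bound[OF square])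
      (auto intro!: AE_I2 simp: abs_mult mult.commute)
  have "(LINT s|time T. F s)\<^sup>2 = (LINT a|time T. LINT b|time T. F a * F b)"
    unfolding power2_eq_square by simp
  also have "\<dots> = (LINT (a, b)|(time T \<Otimes>\<^sub>M time T). F a * F b)" by (rule time_time.integral_fst[OF square])
  also have "\<dots> = (LINT z|(time T \<Otimes>\<^sub>M time T). (case z of (a, b) \<Rightarrow> F b * (if a \<le> b then F a else 0))
      + (case z of (a, b) \<Rightarrow> F a * (if b < a then F b else 0)))"
    by (intro Bochner_Integration.integral_cong) (auto simp: indicator_def)
  also have "\<dots> = (LINT (a, b)|(time T \<Otimes>\<^sub>M time T). F b * (if a \<le> b then F a else 0))
      + (LINT (a, b)|(time T \<Otimes>\<^sub>M time T). F a * (if b < a then F b else 0))"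
    by (rule Bochner_Integration.integral_add[OF lower upper])
  also have "\<dots> = (LINT b|time T. F b * (LINT a|time T. (if a \<le> b then F a else 0)))
      + (LINT a|time T. F a * (LINT b|time T. (if b < a then F b else 0)))"
    using time_time.integral_snd[OF lower] time_time.integral_fst[OF upper] by simp
  also have "(LINT b|time T. F b * (LINT a|time T. (if a \<le> b then F a else 0)))
      = (LINT b|time T. F b * (LINT a|time b. F a))"
    by (intro integral_cong_AE) (auto intro!: eventually_mono[OF AE_time] simp: integral_time_restrict)
  also have "(LINT a|time T. F a * (LINT b|time T. (if b < a then F b else 0)))
      = (LINT b|time T. F b * (LINT a|time b. F a))"
    by (intro integral_cong_AE) (auto intro!: eventually_mono[OF AE_time] simp: integral_time_restrict)
  finally show ?thesis by simp
qed

lemma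
  fixes F D :: "real \<Rightarrow> real"
  assumes F: "integrable (time T) F"
    and D: "\<And>t. 0 \<le> t \<Longrightarrow> t \<le> T \<Longrightarrow> D t = d + (LINT s|time t. F s)"
    and [measurable]: "D \<in> borel_measurable borel" and "0 \<le> T"
  shows integrable_mult_primitive: "integrable (time T) (\<lambda>s. D s * F s)"
    and primitive_power2: "(D T)\<^sup>2 = d\<^sup>2 + 2 * (LINT s|time T. D s * F s)"
proof -
  have [measurable]: "F \<in> borel_measurable borel" using F by auto
  note [measurable] = borel_measurable_primitive[of F]
  have bound: "\<bar>D t\<bar> \<le> \<bar>d\<bar> + (LINT s|time T. \<bar>F s\<bar>)" if t: "0 \<le> t" "t \<le> T" for t
  proof -
    have "\<bar>LINT s|time t. F s\<bar> \<le> (LINT s|time t. \<bar>F s\<bar>)" using integral_norm_bound[of "time t" F] by simp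
    also have "\<dots> \<le> (LINT s|time T. \<bar>F s\<bar>)"
      using t F by (intro integral_lborel_on_mono_set) auto
    finally show ?thesis unfolding D[OF t] by linarith
  qed
  show DF: "integrable (time T) (\<lambda>s. D s * F s)"
  proof (rule Bochner_Integration.integrable_bound)
    show "integrable (time T) (\<lambda>s. (\<bar>d\<bar> + (LINT s|time T. \<bar>F s\<bar>)) * \<bar>F s\<bar>)" using F by simp
    show "AE s in time T. norm (D s * F s) \<le> norm ((\<bar>d\<bar> + (LINT s|time T. \<bar>F s\<bar>)) * \<bar>F s\<bar>)"
      using AE_time by eventually_elim (auto simp: abs_mult intro!: mult_right_mono order_trans[OF bound])
  qed simp
  have "(LINT b|time T. F b * (LINT a|time b. F a)) = (LINT s|time T. D s * F s - d * F s)"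
    by (intro integral_cong_AE)
      (auto intro!: eventually_mono[OF AE_time] simp: D algebra_simps)
  also have "\<dots> = (LINT s|time T. D s * F s) - d * (LINT s|time T. F s)" using F DF by simp
  finally have "(LINT s|time T. F s)\<^sup>2 = 2 * (LINT s|time T. D s * F s) - 2 * d * (LINT s|time T. F s)"
    using integral_time_power2[OF F] by simp
  then show "(D T)\<^sup>2 = d\<^sup>2 + 2 * (LINT s|time T. D s * F s)"
    using D[of T] \<open>0 \<le> T\<close> by (simp add: power2_sum algebra_simps)
qed

section \<open>Transport by a divergence-free flow\<close>

text \<open>The Lipschitz condition measures distances on the torus by $|\sin(\pi\,\cdot)|$,
  in which the mollification kernels have small support.\<close>

locale divergence_free_flow =
  fixes v Dv1 Dv2 :: "real \<times> real \<Rightarrow> real \<times> real" and L :: real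
  assumes fst_velocity_C1: "periodic_C1 (\<lambda>x. fst (v x)) Dv1"
    and snd_velocity_C1: "periodic_C1 (\<lambda>x. snd (v x)) Dv2"
    and divergence_zero: "fst (Dv1 x) + snd (Dv2 x) = 0"
    and velocity_Lipschitz: "\<bar>sin (pi * (fst x - fst y))\<bar> \<le> \<delta> \<Longrightarrow> \<bar>sin (pi * (snd x - snd y))\<bar> \<le> \<delta>
      \<Longrightarrow> norm (v x - v y) \<le> L * \<delta>"
begin

definition commutator :: "nat \<Rightarrow> (real \<times> real \<Rightarrow> real \<times> real) \<Rightarrow> real \<times> real \<Rightarrow> real" where
  "commutator n G x = mollify n (\<lambda>y. v y \<bullet> G y) x - v x \<bullet> mollify n G x"

lemma continuous_velocity: "continuous_on UNIV v"
  using continuous_on_Pair[OF periodic_C1_continuous[OF fst_velocity_C1] periodic_C1_continuous[OF snd_velocity_C1]]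
  by simp

lemma borel_measurable_velocity [measurable]: "v \<in> borel_measurable borel"
  using continuous_velocity by (rule borel_measurable_continuous_onI)

lemma velocity_bounded:
  obtains V where "0 \<le> V" "\<And>x. norm (v x) \<le> V"
proof -
  have "periodic_x v"
    using periodic_C1_periodic[OF fst_velocity_C1] periodic_C1_periodic[OF snd_velocity_C1]
    unfolding periodic_x_def by (simp add: prod_eq_iff)
  then obtain V where V: "\<And>x. norm (v x) \<le> V"
    using bounded_range_periodic[OF continuous_velocity] unfolding bounded_iff by blast
  then show thesis using that norm_ge_zero order_trans by blast
qed

lemma integrable_velocity_inner:
  fixes G :: "'a \<Rightarrow> real \<times> real"
  assumes "integrable M G" "a \<in> borel_measurable M"
  shows "integrable M (\<lambda>x. v (a x) \<bullet> G x)"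
proof -
  obtain V where V: "\<And>x. norm (v x) \<le> V" using velocity_bounded by blast
  show ?thesis
    by (rule integrable_dominated[OF assms(1), where C = V]) (use assms in \<open>auto intro: abs_inner_le[OF V]\<close>)
qed

lemma integral_velocity_inner_grad:
  assumes "periodic_C1 H K"
  shows "(LINT x|torus. v x \<bullet> K x) = 0"
proof -
  note [continuous_intros] = continuous_velocity periodic_C1_continuous[OF assms] periodic_C1_continuous_grad[OF assms]
    periodic_C1_continuous_grad[OF fst_velocity_C1] periodic_C1_continuous_grad[OF snd_velocity_C1]
  have integrable: "integrable torus (\<lambda>x. fst (v x) *\<^sub>R K x)" "integrable torus (\<lambda>x. H x *\<^sub>R Dv1 x)"
    "integrable torus (\<lambda>x. snd (v x) *\<^sub>R K x)" "integrable torus (\<lambda>x. H x *\<^sub>R Dv2 x)"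
    by (intro integrable_torus_continuous continuous_intros)+
  note fst_integral = integral_bounded_linear[OF bounded_linear_fst]
    and snd_integral = integral_bounded_linear[OF bounded_linear_snd]
  have "(LINT x|torus. fst (v x) * fst (K x)) = - (LINT x|torus. H x * fst (Dv1 x))"
    using fst_integral[OF integrable(1)] fst_integral[OF integrable(2)]
      integral_by_parts_torus[OF fst_velocity_C1 assms] by simp
  moreover have "(LINT x|torus. snd (v x) * snd (K x)) = - (LINT x|torus. H x * snd (Dv2 x))"
    using snd_integral[OF integrable(3)] snd_integral[OF integrable(4)]
      integral_by_parts_torus[OF snd_velocity_C1 assms] by simp
  moreover have "snd (Dv2 x) = - fst (Dv1 x)" for x using divergence_zero[of x] by simp
  moreover have "integrable torus (\<lambda>x. fst (v x) * fst (K x))" "integrable torus (\<lambda>x. snd (v x) * snd (K x))"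
    by (intro integrable_torus_continuous continuous_intros)+
  ultimately show ?thesis by (simp add: inner_prod_def)
qed

lemma integral_transport_zero:
  assumes F: "periodic_C1 F G"
  shows "(LINT x|torus. F x * (v x \<bullet> G x)) = 0"
proof -
  have "2 * (LINT x|torus. F x * (v x \<bullet> G x)) = (LINT x|torus. v x \<bullet> (F x *\<^sub>R G x + F x *\<^sub>R G x))"
    by (simp add: inner_add_right flip: integral_mult_right_zero)
  also have "\<dots> = 0" by (rule integral_velocity_inner_grad[OF periodic_C1_mult[OF F F]])
  finally show ?thesis by simp
qed

lemma abs_commutator_le:
  assumes "integrable torus G"
  shows "\<bar>commutator n G x\<bar> \<le> L * radius n * mollify n (\<lambda>y. norm (G y)) x"
proof -
  have difference: "integrable torus (\<lambda>y. (v y - v x) \<bullet> G y)"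
    using integrable_velocity_inner[OF assms, of "\<lambda>y. y"] assms by (simp add: inner_diff_left)
  have "commutator n G x = mollify n (\<lambda>y. (v y - v x) \<bullet> G y) x"
    unfolding commutator_def inner_mollify[OF assms] inner_diff_left
    using integrable_velocity_inner[OF assms, of "\<lambda>y. y"] assms by (simp add: mollify_diff)
  then have "\<bar>commutator n G x\<bar> \<le> mollify n (\<lambda>y. \<bar>(v y - v x) \<bullet> G y\<bar>) x"
    using norm_mollify_le[of n "\<lambda>y. (v y - v x) \<bullet> G y" x] by simp
  also have "\<dots> \<le> mollify n (\<lambda>y. L * radius n * norm (G y)) x"
  proof (rule mollify_mono)
    fix y assume "kernel n (x - y) \<noteq> 0"
    then have "norm (v y - v x) \<le> L * radius n"
      using velocity_Lipschitz[OF kernel_support] by (simp add: norm_minus_commute)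
    then show "\<bar>(v y - v x) \<bullet> G y\<bar> \<le> L * radius n * norm (G y)" by (rule abs_inner_le)
  qed (use difference assms in auto)
  finally show ?thesis by (simp add: mollify_mult_left)
qed

lemma commutator_power2_le:
  assumes [measurable]: "G \<in> borel_measurable borel" and G2: "integrable torus (\<lambda>x. (norm (G x))\<^sup>2)"
  shows "(commutator n G x)\<^sup>2 \<le> (L * radius n)\<^sup>2 * mollify n (\<lambda>y. (norm (G y))\<^sup>2) x"
proof -
  have G: "integrable torus G" by (rule torus.integrable_of_norm_power2[OF _ G2]) simp
  have "\<bar>commutator n G x\<bar>\<^sup>2 \<le> (L * radius n * mollify n (\<lambda>y. norm (G y)) x)\<^sup>2"
    by (intro power_mono abs_commutator_le[OF G]) simp
  also have "\<dots> \<le> (L * radius n)\<^sup>2 * mollify n (\<lambda>y. (norm (G y))\<^sup>2) x"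
    using norm_mollify_power2_le[of "\<lambda>y. norm (G y)" n x] G2
    by (simp add: power_mult_distrib mult_left_mono)
  finally show ?thesis by simp
qed

lemma continuous_on_commutator:
  assumes "integrable torus G"
  shows "continuous_on UNIV (commutator n G)"
proof -
  have "integrable torus (\<lambda>y. v y \<bullet> G y)"
    using integrable_velocity_inner[OF assms, of "\<lambda>y. y"] by simp
  then show ?thesis
    unfolding commutator_def[abs_def]
    by (intro continuous_on_diff continuous_on_inner continuous_on_mollify continuous_velocity assms)
qed

lemma
  assumes [measurable]: "G \<in> borel_measurable borel" and G2: "integrable torus (\<lambda>x. (norm (G x))\<^sup>2)"
  shows integrable_commutator_power2: "integrable torus (\<lambda>x. (commutator n G x)\<^sup>2)"
    and integral_commutator_power2_le:
      "(LINT x|torus. (commutator n G x)\<^sup>2) \<le> (L * radius n)\<^sup>2 * (LINT x|torus. (norm (G x))\<^sup>2)"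
proof -
  have G: "integrable torus G" by (rule torus.integrable_of_norm_power2[OF _ G2]) simp
  show integrable: "integrable torus (\<lambda>x. (commutator n G x)\<^sup>2)"
    by (intro integrable_torus_continuous continuous_intros continuous_on_commutator G)
  have "(LINT x|torus. (commutator n G x)\<^sup>2) \<le> (LINT x|torus. (L * radius n)\<^sup>2 * mollify n (\<lambda>y. (norm (G y))\<^sup>2) x)"
    using integrable_mollify[OF G2] commutator_power2_le[OF _ G2] by (intro integral_mono integrable) auto
  then show "(LINT x|torus. (commutator n G x)\<^sup>2) \<le> (L * radius n)\<^sup>2 * (LINT x|torus. (norm (G x))\<^sup>2)"
    by (simp add: integral_mollify[OF G2])
qed

end

section \<open>Weak solutions of the advective $p$-Laplacian equation\<close>

lemma test_functionI:
  assumes "periodic_C1 F G"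
  shows "test_function (\<lambda>x t. F x) (\<lambda>z. (G (fst z), 0))"
  unfolding test_function_def
proof (intro conjI allI)
  fix z :: "(real \<times> real) \<times> real"
  have "((\<lambda>w. F (fst w)) has_derivative (\<lambda>h. fst h \<bullet> G (fst z))) (at z)"
    by (rule has_derivative_compose[OF has_derivative_fst[OF has_derivative_ident]
          periodic_C1_GDERIV[OF assms, unfolded gderiv_def]])
  then show "((\<lambda>w. F (fst w)) has_derivative (\<bullet>) (G (fst z), 0)) (at z)"
    by (rule has_derivative_eq_rhs) (simp add: fun_eq_iff inner_prod_def inner_commute)
  show "continuous_on UNIV (\<lambda>z::(real \<times> real) \<times> real. (G (fst z), 0::real))"
    by (intro continuous_intros continuous_on_compose2[OF periodic_C1_continuous_grad[OF assms]]) auto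
qed (rule periodic_C1_periodic[OF assms])

locale p_laplacian_solution = divergence_free_flow +
  fixes p \<nu> :: real and \<theta>0 :: "real \<times> real \<Rightarrow> real" and \<theta> :: "real \<times> real \<Rightarrow> real \<Rightarrow> real"
    and g :: "real \<times> real \<Rightarrow> real \<Rightarrow> real \<times> real"
  assumes p: "p > 2" and nu: "\<nu> > 0"
    and theta0_borel [measurable]: "\<theta>0 \<in> borel_measurable borel"
    and theta0_power2: "integrable torus (\<lambda>x. (\<theta>0 x)\<^sup>2)"
    and theta_borel [measurable]: "(\<lambda>z. \<theta> (fst z) (snd z)) \<in> borel_measurable borel"
    and theta_power2: "\<And>t. 0 \<le> t \<Longrightarrow> integrable torus (\<lambda>x. (\<theta> x t)\<^sup>2)"
    and theta_continuous: "\<And>t. 0 \<le> t \<Longrightarrow> ((\<lambda>s. LINT x|torus. (\<theta> x s - \<theta> x t)\<^sup>2) \<longlongrightarrow> 0) (at t within {0..})"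
    and grad_borel [measurable]: "(\<lambda>z. g (fst z) (snd z)) \<in> borel_measurable borel"
    and grad_powr: "\<And>T. 0 \<le> T \<Longrightarrow> integrable (spacetime T) (\<lambda>z. norm (g (fst z) (snd z)) powr p)"
    and gradient_equation: "\<And>\<psi> D T. test_function \<psi> D \<Longrightarrow> 0 \<le> T \<Longrightarrow>
        (LINT z|spacetime T. \<theta> (fst z) (snd z) *\<^sub>R fst (D z))
        = - (LINT z|spacetime T. \<psi> (fst z) (snd z) *\<^sub>R g (fst z) (snd z))"
    and evolution_equation: "\<And>\<psi> D t. test_function \<psi> D \<Longrightarrow> 0 \<le> t \<Longrightarrow>
        (LINT x|torus. \<theta> x t * \<psi> x t) - (LINT x|torus. \<theta>0 x * \<psi> x 0)
        = (LINT z|spacetime t.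
             \<theta> (fst z) (snd z) * snd (D z)
             - inner (v (fst z)) (g (fst z) (snd z)) * \<psi> (fst z) (snd z)
             - \<nu> * norm (g (fst z) (snd z)) powr (p - 2) * inner (g (fst z) (snd z)) (fst (D z)))"
begin

abbreviation theta_at :: "real \<Rightarrow> real \<times> real \<Rightarrow> real" where
  "theta_at t \<equiv> (\<lambda>x. \<theta> x t)"

abbreviation grad_at :: "real \<Rightarrow> real \<times> real \<Rightarrow> real \<times> real" where
  "grad_at t \<equiv> (\<lambda>x. g x t)"

definition flux_at :: "real \<Rightarrow> real \<times> real \<Rightarrow> real \<times> real" where
  "flux_at t x = norm (g x t) powr (p - 2) *\<^sub>R g x t"

definition dissipation :: "real \<Rightarrow> real" where
  "dissipation t = (LINT x|torus. norm (g x t) powr p)"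

definition energy :: "real \<Rightarrow> real" where
  "energy t = (LINT x|torus. (\<theta> x t)\<^sup>2)"

definition regular :: "real \<Rightarrow> bool" where
  "regular t \<longleftrightarrow> 0 \<le> t \<and> weak_gradient (theta_at t) (grad_at t) \<and> integrable torus (\<lambda>x. norm (g x t) powr p)"

lemma borel_measurable_theta [measurable]:
  assumes "a \<in> borel_measurable M" "b \<in> borel_measurable M"
  shows "(\<lambda>w. \<theta> (a w) (b w)) \<in> borel_measurable M"
  using measurable_compose[OF borel_measurable_Pair[OF assms] theta_borel] by simp

lemma borel_measurable_grad [measurable]:
  assumes "a \<in> borel_measurable M" "b \<in> borel_measurable M"
  shows "(\<lambda>w. g (a w) (b w)) \<in> borel_measurable M"
  using measurable_compose[OF borel_measurable_Pair[OF assms] grad_borel] by simp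

lemma borel_measurable_flux [measurable]:
  assumes [measurable]: "a \<in> borel_measurable M" "b \<in> borel_measurable M"
  shows "(\<lambda>w. flux_at (b w) (a w)) \<in> borel_measurable M"
  unfolding flux_at_def by measurable

lemma borel_measurable_dissipation [measurable]: "dissipation \<in> borel_measurable borel"
  unfolding dissipation_def[abs_def] by measurable

lemma borel_measurable_energy [measurable]: "energy \<in> borel_measurable borel"
  unfolding energy_def[abs_def] by measurable

lemma borel_measurable_mollify_theta [measurable]:
  assumes [measurable]: "a \<in> borel_measurable M" "b \<in> borel_measurable M"
  shows "(\<lambda>w. mollify n (theta_at (b w)) (a w)) \<in> borel_measurable M"
  unfolding mollify_def by measurable

lemma dissipation_nonneg: "0 \<le> dissipation t"
  and energy_nonneg: "0 \<le> energy t"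
  unfolding dissipation_def energy_def by simp_all

lemma theta_integrable: "0 \<le> t \<Longrightarrow> integrable torus (theta_at t)"
  by (rule torus.square_integrable_imp_integrable[OF _ theta_power2]) measurable

lemma theta0_integrable: "integrable torus \<theta>0"
  by (rule torus.square_integrable_imp_integrable[OF _ theta0_power2]) measurable

lemma norm_flux: "norm (flux_at t x) = norm (g x t) powr (p - 1)"
  using powr_add[of "norm (g x t)" "p - 2" 1] p by (cases "g x t = 0") (auto simp: flux_at_def)

lemma norm_flux_powr: "norm (flux_at t x) powr (p / (p - 1)) = norm (g x t) powr p"
  unfolding norm_flux powr_powr using p by simp

lemma inner_flux_grad: "flux_at t x \<bullet> g x t = norm (g x t) powr p"
  using powr_add[of "norm (g x t)" "p - 2" 2] p
  by (cases "g x t = 0") (auto simp: flux_at_def power2_norm_eq_inner)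

lemma norm_flux_le: "norm (flux_at t x) \<le> 1 + norm (g x t) powr p"
  unfolding norm_flux using p by (intro powr_le_one_plus_powr) auto

lemma norm_grad_le: "norm (g x t) \<le> 1 + norm (g x t) powr p"
  using powr_le_one_plus_powr[of "norm (g x t)" 1 p] p by simp

lemma norm_grad_power2_le: "(norm (g x t))\<^sup>2 \<le> 1 + norm (g x t) powr p"
  using powr_le_one_plus_powr[of "norm (g x t)" 2 p] p by simp

lemma
  assumes "0 \<le> T"
  shows integrable_spacetime_grad: "integrable (spacetime T) (\<lambda>z. g (fst z) (snd z))"
    and integrable_spacetime_flux: "integrable (spacetime T) (\<lambda>z. flux_at (snd z) (fst z))"
proof -
  have dominating: "integrable (spacetime T) (\<lambda>z. 1 + norm (g (fst z) (snd z)) powr p)"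
    using grad_powr[OF assms] by auto
  show "integrable (spacetime T) (\<lambda>z. g (fst z) (snd z))"
    by (rule Bochner_Integration.integrable_bound[OF dominating]) (auto intro!: AE_I2 order_trans[OF norm_grad_le])
  show "integrable (spacetime T) (\<lambda>z. flux_at (snd z) (fst z))"
    by (rule Bochner_Integration.integrable_bound[OF dominating]) (auto intro!: AE_I2 order_trans[OF norm_flux_le])
qed

lemma
  assumes "0 \<le> T"
  shows dissipation_integrable: "integrable (time T) dissipation"
    and AE_grad_powr: "AE t in time T. integrable torus (\<lambda>x. norm (g x t) powr p)"
proof -
  have pair: "integrable (spacetime T) (\<lambda>(x, t). norm (g x t) powr p)"
    using grad_powr[OF assms] by (simp add: split_beta')
  show "integrable (time T) dissipation"
    unfolding dissipation_def[abs_def] by (rule spacetime.integrable_snd[OF pair])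
  show "AE t in time T. integrable torus (\<lambda>x. norm (g x t) powr p)"
    by (rule spacetime.AE_integrable_snd[OF pair])
qed

lemma energy_continuous: "continuous_on {0..} energy"
  unfolding continuous_on_def
proof
  fix t :: real assume "t \<in> {0..}"
  then have t: "0 \<le> t" by simp
  define X where "X s = (LINT x|torus. (\<theta> x s - \<theta> x t)\<^sup>2)" for s
  have difference: "\<bar>energy s - energy t\<bar> \<le> X s + 2 * (sqrt (energy t) * sqrt (X s))" if s: "0 \<le> s" for s
  proof -
    have X: "integrable torus (\<lambda>x. (\<theta> x s - \<theta> x t)\<^sup>2)"
      by (intro integrable_power2_diff theta_power2 s t) auto
    have product: "integrable torus (\<lambda>x. \<theta> x t * (\<theta> x s - \<theta> x t))"
      by (intro integrable_mult_of_power2 theta_power2 t X) auto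
    have "energy s = (LINT x|torus. (\<theta> x s - \<theta> x t)\<^sup>2 + 2 * (\<theta> x t * (\<theta> x s - \<theta> x t)) + (\<theta> x t)\<^sup>2)"
      unfolding energy_def by (simp add: power2_eq_square algebra_simps)
    also have "\<dots> = X s + 2 * (LINT x|torus. \<theta> x t * (\<theta> x s - \<theta> x t)) + energy t"
      using X product theta_power2[OF t] unfolding energy_def X_def by simp
    finally have "energy s = X s + 2 * (LINT x|torus. \<theta> x t * (\<theta> x s - \<theta> x t)) + energy t" .
    moreover have "0 \<le> X s" unfolding X_def by simp
    ultimately have "\<bar>energy s - energy t\<bar> \<le> X s + 2 * \<bar>LINT x|torus. \<theta> x t * (\<theta> x s - \<theta> x t)\<bar>"
      by linarith
    moreover have "(LINT x|torus. \<theta> x t * (\<theta> x s - \<theta> x t))\<^sup>2 \<le> energy t * X s"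
      unfolding energy_def X_def by (intro integral_mult_Cauchy_Schwarz theta_power2 t X) auto
    then have "sqrt ((LINT x|torus. \<theta> x t * (\<theta> x s - \<theta> x t))\<^sup>2) \<le> sqrt (energy t * X s)"
      by (rule real_sqrt_le_mono)
    then have "\<bar>LINT x|torus. \<theta> x t * (\<theta> x s - \<theta> x t)\<bar> \<le> sqrt (energy t) * sqrt (X s)"
      by (simp add: real_sqrt_mult)
    ultimately show ?thesis by linarith
  qed
  show "(energy \<longlongrightarrow> energy t) (at t within {0..})"
  proof (rule LIM_zero_cancel, rule Lim_null_comparison)
    show "\<forall>\<^sub>F s in at t within {0..}. norm (energy s - energy t) \<le> X s + 2 * (sqrt (energy t) * sqrt (X s))"
      using difference by (simp add: eventually_at_filter)
    have "((\<lambda>s. X s + 2 * (sqrt (energy t) * sqrt (X s))) \<longlongrightarrow> 0 + 2 * (sqrt (energy t) * sqrt 0)) (at t within {0..})"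
      using theta_continuous[OF t, folded X_def] by (intro tendsto_intros)
    then show "((\<lambda>s. X s + 2 * (sqrt (energy t) * sqrt (X s))) \<longlongrightarrow> 0) (at t within {0..})" by simp
  qed
qed

lemma energy_bounded:
  obtains B where "0 \<le> B" "\<And>t. 0 \<le> t \<Longrightarrow> t \<le> T \<Longrightarrow> energy t \<le> B"
proof -
  have "bounded (energy ` {0..T})"
    by (intro compact_imp_bounded compact_continuous_image continuous_on_subset[OF energy_continuous]) auto
  then obtain B where B: "\<And>t. t \<in> {0..T} \<Longrightarrow> \<bar>energy t\<bar> \<le> B" unfolding bounded_iff by force
  show thesis
    by (rule that[of "max 0 B"]) (use B in \<open>auto intro: order_trans[OF abs_ge_self] simp: le_max_iff_disj\<close>)
qed

lemma integrable_spacetime_theta: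
  assumes "0 \<le> T"
  shows "integrable (spacetime T) (\<lambda>z. \<theta> (fst z) (snd z))"
proof -
  obtain B where B: "0 \<le> B" "\<And>t. 0 \<le> t \<Longrightarrow> t \<le> T \<Longrightarrow> energy t \<le> B" using energy_bounded[of T] by blast
  have "integrable (spacetime T) (\<lambda>(x, t). (\<theta> x t)\<^sup>2)"
  proof (rule integrable_spacetimeI)
    show "AE t in time T. integrable torus (\<lambda>x. (\<theta> x t)\<^sup>2)"
      using AE_time by eventually_elim (simp add: theta_power2)
    have "AE t in time T. norm (energy t) \<le> B"
      using AE_time by eventually_elim (simp add: B energy_nonneg)
    then have "integrable (time T) energy" by (intro time.integrable_const_bound[where B = B]) auto
    then show "integrable (time T) (\<lambda>t. LINT x|torus. norm ((\<theta> x t)\<^sup>2))"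
      unfolding energy_def[abs_def] by simp
  qed measurable
  then have "integrable (spacetime T) (\<lambda>z. (\<theta> (fst z) (snd z))\<^sup>2)" by (simp add: split_beta')
  then show ?thesis by (rule spacetime.square_integrable_imp_integrable[rotated]) measurable
qed

lemma AE_mollify_grad_theta_at:
  assumes T: "0 \<le> T"
  shows "AE t in time T. mollify_grad n (theta_at t) x = mollify n (grad_at t) x"
proof -
  define a where "a t = mollify_grad n (theta_at t) x - mollify n (grad_at t) x" for t
  have theta: "integrable (spacetime t) (\<lambda>(y, s). \<theta> y s *\<^sub>R kernel_grad n (x - y))"
    and grad: "integrable (spacetime t) (\<lambda>(y, s). kernel n (x - y) *\<^sub>R g y s)" if "0 \<le> t" for t
  proof -
    have "integrable (spacetime t) (\<lambda>z. \<theta> (fst z) (snd z) *\<^sub>R kernel_grad n (x - fst z))"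
      by (rule integrable_dominated[OF integrable_spacetime_theta[OF that] _ norm_scaleR_kernel_grad_le]) measurable
    then show "integrable (spacetime t) (\<lambda>(y, s). \<theta> y s *\<^sub>R kernel_grad n (x - y))" by (simp add: split_beta')
    have "integrable (spacetime t) (\<lambda>z. kernel n (x - fst z) *\<^sub>R g (fst z) (snd z))"
      by (rule integrable_dominated[OF integrable_spacetime_grad[OF that], where C = "kernel_bound n"])
        (auto intro!: mult_right_mono abs_kernel_le)
    then show "integrable (spacetime t) (\<lambda>(y, s). kernel n (x - y) *\<^sub>R g y s)" by (simp add: split_beta')
  qed
  note slices = spacetime.integrable_snd[OF theta] spacetime.integrable_snd[OF grad]
  have a_int: "integrable (time t) a" if "0 \<le> t" for t
    unfolding a_def[abs_def] mollify_grad_def mollify_def using slices[OF that] by auto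
  have "(LINT s|time t. a s) = 0" if t: "0 \<le> t" for t
  proof -
    have test: "test_function (\<lambda>y t. kernel n (x - y)) (\<lambda>z. (- kernel_grad n (x - fst z), 0))"
      using test_functionI[OF periodic_C1_kernel[of n x]]
      unfolding kernel_commute(1)[of n x] kernel_commute(2)[of n x] by simp
    have "(LINT s|time t. a s) = (LINT s|time t. mollify_grad n (theta_at s) x) - (LINT s|time t. mollify n (grad_at s) x)"
      unfolding a_def mollify_grad_def mollify_def using slices[OF t] by simp
    also have "(LINT s|time t. mollify_grad n (theta_at s) x) = (LINT (y, s)|spacetime t. \<theta> y s *\<^sub>R kernel_grad n (x - y))"
      unfolding mollify_grad_def by (rule spacetime.integral_snd[OF theta[OF t]])
    also have "(LINT s|time t. mollify n (grad_at s) x) = (LINT (y, s)|spacetime t. kernel n (x - y) *\<^sub>R g y s)"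
      unfolding mollify_def by (rule spacetime.integral_snd[OF grad[OF t]])
    finally show ?thesis
      using gradient_equation[OF test t] by (simp add: split_beta')
  qed
  then have "AE t in time T. a t = 0" by (rule AE_zero_of_primitive_zero[OF a_int[OF T]])
  then show ?thesis unfolding a_def by eventually_elim simp
qed

lemma AE_regular:
  assumes T: "0 \<le> T"
  shows "AE t in time T. regular t \<and> t \<le> T"
proof -
  define Q where "Q = (\<rat> \<times> \<rat> :: (real \<times> real) set)"
  have countable: "countable Q" unfolding Q_def by (simp add: countable_rat)
  have dense: "closure Q = UNIV" unfolding Q_def closure_Times Rats_closure_real by simp
  have "AE t in time T. \<forall>n. \<forall>x\<in>Q. mollify_grad n (theta_at t) x = mollify n (grad_at t) x"
    unfolding AE_all_countable AE_ball_countable[OF countable] using AE_mollify_grad_theta_at[OF T] by blast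
  then show ?thesis
    using AE_time AE_grad_powr[OF T]
  proof eventually_elim
    case (elim t)
    have grad2: "integrable torus (\<lambda>x. (norm (g x t))\<^sup>2)"
      using torus.integrable_norm_powr_le[of "grad_at t" p 2] elim p by simp
    have grad: "integrable torus (grad_at t)" by (rule torus.integrable_of_norm_power2[OF _ grad2]) measurable
    have "mollify_grad n (theta_at t) x = mollify n (grad_at t) x" for n x
    proof -
      have "continuous_on (closure Q) (\<lambda>x. mollify_grad n (theta_at t) x - mollify n (grad_at t) x)"
        unfolding dense
        using elim grad by (intro continuous_intros continuous_on_mollify_grad continuous_on_mollify theta_integrable) auto
      then have "mollify_grad n (theta_at t) x - mollify n (grad_at t) x = 0"
        by (rule continuous_constant_on_closure) (use elim dense in auto)
      then show ?thesis by simp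
    qed
    then show ?case unfolding regular_def weak_gradient_def using elim grad2 theta_power2 by auto
  qed
qed

end

section \<open>The energy identity\<close>

context divergence_free_flow
begin

lemma Lipschitz_constant_nonneg: "0 \<le> L"
  using velocity_Lipschitz[of "(0, 0)" "(0, 0)" 1] by simp

end

context p_laplacian_solution
begin

definition rate :: "nat \<Rightarrow> real \<times> real \<Rightarrow> real \<Rightarrow> real" where
  "rate n x t = \<nu> * mollify_div n (flux_at t) x - mollify n (\<lambda>y. v y \<bullet> g y t) x"

lemma borel_measurable_rate [measurable]:
  assumes [measurable]: "a \<in> borel_measurable M" "b \<in> borel_measurable M"
  shows "(\<lambda>w. rate n (a w) (b w)) \<in> borel_measurable M"
  unfolding rate_def mollify_def mollify_div_def by measurable

lemma
  assumes "0 \<le> T"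
  shows integrable_spacetime_transport: "integrable (spacetime T) (\<lambda>(y, s). kernel n (x - y) * (v y \<bullet> g y s))"
    and integrable_spacetime_flux_kernel: "integrable (spacetime T) (\<lambda>(y, s). flux_at s y \<bullet> kernel_grad n (x - y))"
proof -
  have "integrable (spacetime T) (\<lambda>z. v (fst z) \<bullet> g (fst z) (snd z))"
    by (rule integrable_velocity_inner[OF integrable_spacetime_grad[OF assms]]) simp
  then have "integrable (spacetime T) (\<lambda>z. kernel n (x - fst z) * (v (fst z) \<bullet> g (fst z) (snd z)))"
    by (rule integrable_dominated[where C = "kernel_bound n"])
      (auto simp: abs_mult intro!: mult_right_mono abs_kernel_le)
  then show "integrable (spacetime T) (\<lambda>(y, s). kernel n (x - y) * (v y \<bullet> g y s))" by (simp add: split_beta')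
  have "integrable (spacetime T) (\<lambda>z. flux_at (snd z) (fst z) \<bullet> kernel_grad n (x - fst z))"
    by (rule integrable_dominated[OF integrable_spacetime_flux[OF assms], where C = "kernel_grad_bound n"])
      (auto intro!: abs_inner_kernel_grad_le)
  then show "integrable (spacetime T) (\<lambda>(y, s). flux_at s y \<bullet> kernel_grad n (x - y))" by (simp add: split_beta')
qed

lemma rate_integrable:
  assumes "0 \<le> T"
  shows "integrable (time T) (rate n x)"
  unfolding rate_def[abs_def] mollify_def mollify_div_def real_scaleR_def
  by (intro Bochner_Integration.integrable_diff integrable_mult_right spacetime.integrable_snd
      integrable_spacetime_transport integrable_spacetime_flux_kernel assms)

lemma mollified_evolution:
  assumes t: "0 \<le> t"
  shows "mollify n (theta_at t) x = mollify n \<theta>0 x + (LINT s|time t. rate n x s)"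
proof -
  note transport = integrable_spacetime_transport[OF t, of n x]
    and flux = integrable_spacetime_flux_kernel[OF t, of n x]
  have test: "test_function (\<lambda>y t. kernel n (x - y)) (\<lambda>z. (- kernel_grad n (x - fst z), 0))"
    using test_functionI[OF periodic_C1_kernel[of n x]]
    unfolding kernel_commute(1)[of n x] kernel_commute(2)[of n x] by simp
  have "mollify n (theta_at t) x - mollify n \<theta>0 x
      = (LINT z|spacetime t. \<nu> * (case z of (y, s) \<Rightarrow> flux_at s y \<bullet> kernel_grad n (x - y))
          - (case z of (y, s) \<Rightarrow> kernel n (x - y) * (v y \<bullet> g y s)))"
    using evolution_equation[OF test t] unfolding mollify_def flux_at_def by (simp add: split_beta' mult_ac)
  also have "\<dots> = \<nu> * (LINT (y, s)|spacetime t. flux_at s y \<bullet> kernel_grad n (x - y))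
      - (LINT (y, s)|spacetime t. kernel n (x - y) * (v y \<bullet> g y s))"
    using transport flux by simp
  also have "\<dots> = \<nu> * (LINT s|time t. mollify_div n (flux_at s) x)
      - (LINT s|time t. mollify n (\<lambda>y. v y \<bullet> g y s) x)"
    unfolding mollify_def mollify_div_def real_scaleR_def
    using spacetime.integral_snd[OF transport] spacetime.integral_snd[OF flux] by simp
  also have "\<dots> = (LINT s|time t. rate n x s)"
    unfolding rate_def mollify_def mollify_div_def real_scaleR_def
    using spacetime.integrable_snd[OF transport] spacetime.integrable_snd[OF flux] by simp
  finally show ?thesis by simp
qed

lemma regular_D:
  assumes "regular t"
  shows regular_nonneg: "0 \<le> t"
    and regular_weak_gradient: "weak_gradient (theta_at t) (grad_at t)"
    and regular_grad_powr: "integrable torus (\<lambda>x. norm (g x t) powr p)"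
  using assms unfolding regular_def by auto

lemmas regular_grad_integrable = weak_gradient_integrable(2)[OF regular_weak_gradient]
  and regular_grad_power2 = weak_gradient_power2(2)[OF regular_weak_gradient]
  and regular_theta_integrable = weak_gradient_integrable(1)[OF regular_weak_gradient]

lemma regular_flux_integrable:
  assumes "regular t"
  shows "integrable torus (flux_at t)"
proof (rule Bochner_Integration.integrable_bound)
  show "integrable torus (\<lambda>x. 1 + norm (g x t) powr p)" using regular_grad_powr[OF assms] by auto
  show "AE x in torus. norm (flux_at t x) \<le> norm (1 + norm (g x t) powr p)"
    by (auto intro!: AE_I2 order_trans[OF norm_flux_le])
qed measurable

lemma integral_le_one_plus_dissipation:
  assumes "regular t" "\<And>x. f x \<le> 1 + norm (g x t) powr p"
  shows "(LINT x|torus. f x) \<le> 1 + dissipation t"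
proof -
  have "(LINT x|torus. f x) \<le> (LINT x|torus. 1 + norm (g x t) powr p)"
    using regular_grad_powr[OF assms(1)] assms(2) by (intro integral_mono') auto
  then show ?thesis unfolding dissipation_def using regular_grad_powr[OF assms(1)] by simp
qed

lemma rate_eq_commutator:
  "rate n x t = \<nu> * mollify_div n (flux_at t) x - v x \<bullet> mollify n (grad_at t) x - commutator n (grad_at t) x"
  unfolding rate_def commutator_def by simp

lemma abs_mollify_div_flux_le:
  assumes "regular t"
  shows "\<bar>mollify_div n (flux_at t) x\<bar> \<le> kernel_grad_bound n * (1 + dissipation t)"
proof -
  have "\<bar>mollify_div n (flux_at t) x\<bar> \<le> kernel_grad_bound n * (LINT y|torus. norm (flux_at t y))"
    by (rule abs_mollify_div_le[OF regular_flux_integrable[OF assms]])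
  also have "\<dots> \<le> kernel_grad_bound n * (1 + dissipation t)"
    by (intro mult_left_mono integral_le_one_plus_dissipation assms norm_flux_le kernel_grad_bound_nonneg)
  finally show ?thesis .
qed

lemma rate_bounded:
  obtains C where "0 \<le> C" "\<And>t x. regular t \<Longrightarrow> \<bar>rate n x t\<bar> \<le> C * (1 + dissipation t)"
proof -
  obtain V where V: "0 \<le> V" "\<And>x. norm (v x) \<le> V" using velocity_bounded by blast
  let ?C = "\<nu> * kernel_grad_bound n + kernel_bound n * V"
  have "\<bar>rate n x t\<bar> \<le> ?C * (1 + dissipation t)" if t: "regular t" for t x
  proof -
    have "integrable torus (\<lambda>y. v y \<bullet> g y t)"
      using integrable_velocity_inner[OF regular_grad_integrable[OF t], of "\<lambda>y. y"] by simp
    then have "\<bar>mollify n (\<lambda>y. v y \<bullet> g y t) x\<bar> \<le> kernel_bound n * (LINT y|torus. \<bar>v y \<bullet> g y t\<bar>)"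
      using norm_mollify_le_bound[of "\<lambda>y. v y \<bullet> g y t" n x] by simp
    also have "\<dots> \<le> kernel_bound n * (LINT y|torus. V * norm (g y t))"
      using regular_grad_integrable[OF t] V kernel_bound_pos[of n] abs_inner_le[OF V(2)]
      by (intro mult_left_mono integral_mono') auto
    also have "\<dots> \<le> kernel_bound n * (V * (1 + dissipation t))"
      using integral_le_one_plus_dissipation[OF t norm_grad_le] V kernel_bound_pos[of n]
      by (simp add: mult_left_mono)
    finally have transport: "\<bar>mollify n (\<lambda>y. v y \<bullet> g y t) x\<bar> \<le> kernel_bound n * (V * (1 + dissipation t))" .
    have "\<bar>rate n x t\<bar> \<le> \<nu> * \<bar>mollify_div n (flux_at t) x\<bar> + \<bar>mollify n (\<lambda>y. v y \<bullet> g y t) x\<bar>"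
      unfolding rate_def using nu abs_triangle_ineq4[of "\<nu> * mollify_div n (flux_at t) x"] by (simp add: abs_mult)
    also have "\<dots> \<le> \<nu> * (kernel_grad_bound n * (1 + dissipation t)) + kernel_bound n * (V * (1 + dissipation t))"
      using nu by (intro add_mono mult_left_mono abs_mollify_div_flux_le t transport) auto
    finally show ?thesis by (simp add: algebra_simps)
  qed
  moreover have "0 \<le> ?C"
    using nu V kernel_grad_bound_nonneg[of n] kernel_bound_pos[of n] by (simp add: less_imp_le)
  ultimately show thesis using that by blast
qed

lemma abs_mollify_theta_le:
  assumes "0 \<le> t"
  shows "\<bar>mollify n (theta_at t) x\<bar> \<le> kernel_bound n * (1 + energy t)"
proof -
  have "\<bar>mollify n (theta_at t) x\<bar> \<le> kernel_bound n * (LINT y|torus. \<bar>\<theta> y t\<bar>)"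
    using norm_mollify_le_bound[OF theta_integrable[OF assms], of n x] by simp
  also have "\<dots> \<le> kernel_bound n * (1 + energy t)"
    unfolding energy_def using kernel_bound_pos[of n]
    by (intro mult_left_mono integral_abs_torus_le theta_power2 assms) auto
  finally show ?thesis .
qed

lemma
  assumes t: "regular t"
  shows integrable_mollify_rate: "integrable torus (\<lambda>x. mollify n (theta_at t) x * rate n x t)"
    and integral_mollify_rate: "(LINT x|torus. mollify n (theta_at t) x * rate n x t)
      = - \<nu> * (LINT x|torus. flux_at t x \<bullet> mollify n (mollify n (grad_at t)) x)
        - (LINT x|torus. mollify n (theta_at t) x * commutator n (grad_at t) x)"
proof -
  define F where "F = mollify n (theta_at t)"
  define G where "G = mollify n (grad_at t)"
  define Q where "Q = mollify_div n (flux_at t)"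
  define K where "K = commutator n (grad_at t)"
  have F: "periodic_C1 F G"
    unfolding F_def G_def by (rule periodic_C1_mollify_weak[OF regular_weak_gradient[OF t]])
  have [continuous_intros]: "continuous_on UNIV F" "continuous_on UNIV G" "continuous_on UNIV Q" "continuous_on UNIV K"
    unfolding Q_def K_def
    by (rule periodic_C1_continuous[OF F] periodic_C1_continuous_grad[OF F]
        continuous_on_mollify_div[OF regular_flux_integrable[OF t]]
        continuous_on_commutator[OF regular_grad_integrable[OF t]])+
  have integrables: "integrable torus (\<lambda>x. F x * Q x)" "integrable torus (\<lambda>x. F x * (v x \<bullet> G x))"
    "integrable torus (\<lambda>x. F x * K x)"
    by (intro integrable_torus_continuous continuous_intros continuous_velocity)+
  have rate: "F x * rate n x t = \<nu> * (F x * Q x) - F x * (v x \<bullet> G x) - F x * K x" for x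
    unfolding rate_eq_commutator G_def Q_def K_def by (simp add: algebra_simps)
  show "integrable torus (\<lambda>x. mollify n (theta_at t) x * rate n x t)"
    unfolding F_def[symmetric] rate using integrables by auto
  have "(LINT x|torus. F x * rate n x t)
      = \<nu> * (LINT x|torus. F x * Q x) - (LINT x|torus. F x * (v x \<bullet> G x)) - (LINT x|torus. F x * K x)"
    unfolding rate using integrables by simp
  also have "(LINT x|torus. F x * Q x) = - (LINT x|torus. flux_at t x \<bullet> mollify n G x)"
    unfolding Q_def by (rule integral_mult_mollify_div[OF F regular_flux_integrable[OF t]])
  finally show "(LINT x|torus. mollify n (theta_at t) x * rate n x t)
      = - \<nu> * (LINT x|torus. flux_at t x \<bullet> mollify n (mollify n (grad_at t)) x)
        - (LINT x|torus. mollify n (theta_at t) x * commutator n (grad_at t) x)"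
    unfolding F_def[symmetric] G_def[symmetric] K_def[symmetric] by (simp add: integral_transport_zero[OF F])
qed

lemma abs_integral_mollify_commutator_le:
  assumes t: "regular t"
  shows "\<bar>LINT x|torus. mollify n (theta_at t) x * commutator n (grad_at t) x\<bar>
    \<le> L * radius n * (energy t + (1 + dissipation t))"
proof -
  note grad2 = regular_grad_power2[OF t] and theta2 = theta_power2[OF regular_nonneg[OF t]]
  have "continuous_on UNIV (commutator n (grad_at t))"
    by (rule continuous_on_commutator[OF regular_grad_integrable[OF t]])
  then have [measurable]: "commutator n (grad_at t) \<in> borel_measurable borel"
    by (rule borel_measurable_continuous_onI)
  have "(LINT x|torus. mollify n (theta_at t) x * commutator n (grad_at t) x)\<^sup>2
      \<le> (LINT x|torus. (mollify n (theta_at t) x)\<^sup>2) * (LINT x|torus. (commutator n (grad_at t) x)\<^sup>2)"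
    using integrable_norm_mollify_power2[of "theta_at t" n] theta2 grad2
    by (intro integral_mult_Cauchy_Schwarz integrable_commutator_power2) auto
  also have "\<dots> \<le> energy t * ((L * radius n)\<^sup>2 * (1 + dissipation t))"
  proof (rule mult_mono)
    show "(LINT x|torus. (mollify n (theta_at t) x)\<^sup>2) \<le> energy t"
      unfolding energy_def using integral_norm_mollify_power2_le[of "theta_at t" n] theta2 by simp
    have "(LINT x|torus. (commutator n (grad_at t) x)\<^sup>2) \<le> (L * radius n)\<^sup>2 * (LINT x|torus. (norm (g x t))\<^sup>2)"
      by (rule integral_commutator_power2_le[OF _ grad2]) measurable
    also have "\<dots> \<le> (L * radius n)\<^sup>2 * (1 + dissipation t)"
      by (intro mult_left_mono integral_le_one_plus_dissipation t norm_grad_power2_le) simp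
    finally show "(LINT x|torus. (commutator n (grad_at t) x)\<^sup>2) \<le> (L * radius n)\<^sup>2 * (1 + dissipation t)" .
  qed (use energy_nonneg in auto)
  also have "\<dots> \<le> (L * radius n)\<^sup>2 * (energy t + (1 + dissipation t))\<^sup>2"
  proof -
    have "energy t * (1 + dissipation t) \<le> (energy t + (1 + dissipation t))\<^sup>2"
      using energy_nonneg[of t] dissipation_nonneg[of t] by (auto simp: power2_eq_square intro!: mult_mono)
    from mult_left_mono[OF this, of "(L * radius n)\<^sup>2"] show ?thesis by (simp add: mult_ac)
  qed
  finally have "(LINT x|torus. mollify n (theta_at t) x * commutator n (grad_at t) x)\<^sup>2
      \<le> (L * radius n * (energy t + (1 + dissipation t)))\<^sup>2" by (simp add: power_mult_distrib)
  moreover have "0 \<le> L * radius n * (energy t + (1 + dissipation t))"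
    using Lipschitz_constant_nonneg energy_nonneg[of t] dissipation_nonneg[of t] by (simp add: less_imp_le)
  ultimately show ?thesis by (simp only: power2_le_iff_abs_le)
qed

lemma
  assumes t: "regular t"
  shows integrable_mollify_mollify_grad_powr: "integrable torus (\<lambda>x. norm (mollify n (mollify n (grad_at t)) x) powr p)"
    and integral_mollify_mollify_grad_powr_le:
      "(LINT x|torus. norm (mollify n (mollify n (grad_at t)) x) powr p) \<le> dissipation t"
proof -
  note gp = regular_grad_powr[OF t]
  have once: "integrable torus (\<lambda>x. norm (mollify n (grad_at t) x) powr p)"
    "(LINT x|torus. norm (mollify n (grad_at t) x) powr p) \<le> dissipation t"
    using integrable_norm_mollify_powr[OF _ gp, of n] integral_norm_mollify_powr_le[OF _ gp, of n] p
    unfolding dissipation_def by auto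
  show "integrable torus (\<lambda>x. norm (mollify n (mollify n (grad_at t)) x) powr p)"
    "(LINT x|torus. norm (mollify n (mollify n (grad_at t)) x) powr p) \<le> dissipation t"
    using integrable_norm_mollify_powr[OF _ once(1), of n] integral_norm_mollify_powr_le[OF _ once(1), of n] once(2) p
    by auto
qed

lemma
  assumes t: "regular t"
  shows integral_flux_mollify_tendsto:
      "(\<lambda>n. LINT x|torus. flux_at t x \<bullet> mollify n (mollify n (grad_at t)) x) \<longlonglongrightarrow> dissipation t"
    and abs_integral_flux_mollify_le:
      "\<bar>LINT x|torus. flux_at t x \<bullet> mollify n (mollify n (grad_at t)) x\<bar> \<le> 2 * dissipation t"
proof -
  define p' where "p' = p / (p - 1)"
  have conjugate: "p > 1" "1/p + 1/p' = 1" unfolding p'_def using p by (auto simp: field_simps)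
  note gp = regular_grad_powr[OF t]
  have flux: "integrable torus (\<lambda>x. norm (flux_at t x) powr p')"
    "(LINT x|torus. norm (flux_at t x) powr p') = dissipation t"
    unfolding p'_def norm_flux_powr dissipation_def using gp by auto
  define M where "M n = mollify n (mollify n (grad_at t))" for n
  have [measurable]: "M n \<in> borel_measurable borel" for n unfolding M_def by measurable
  note M = integrable_mollify_mollify_grad_powr[OF t, folded M_def] integral_mollify_mollify_grad_powr_le[OF t, folded M_def]
  have "\<bar>LINT x|torus. flux_at t x \<bullet> M n x\<bar>
      \<le> (LINT x|torus. norm (flux_at t x) powr p') + (LINT x|torus. norm (M n x) powr p)"
    using abs_integral_inner_le_powr[OF conjugate _ _ flux(1) M(1), where c = 1] by simp
  then show "\<bar>LINT x|torus. flux_at t x \<bullet> mollify n (mollify n (grad_at t)) x\<bar> \<le> 2 * dissipation t"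
    using flux(2) M(2)[of n] unfolding M_def by simp
  have Mg: "integrable torus (\<lambda>x. norm (M n x - g x t) powr p)" for n
    by (rule integrable_norm_diff_powr) (use M gp p in auto)
  have "(\<lambda>n. LINT x|torus. norm (M n x - g x t) powr p) \<longlonglongrightarrow> 0"
    unfolding M_def by (rule mollify_mollify_tendsto_Lp) (use gp p in auto)
  then have "(\<lambda>n. LINT x|torus. flux_at t x \<bullet> (M n x - g x t)) \<longlonglongrightarrow> 0"
    by (intro integral_inner_tendsto_0[OF conjugate _ _ flux(1) Mg]) auto
  moreover have "(LINT x|torus. flux_at t x \<bullet> (M n x - g x t)) = (LINT x|torus. flux_at t x \<bullet> M n x) - dissipation t" for n
  proof -
    have "integrable torus (\<lambda>x. flux_at t x \<bullet> M n x)"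
      by (rule integrable_inner_of_powr[OF conjugate _ _ flux(1) M(1), where c = 1]) auto
    then show ?thesis unfolding dissipation_def using gp by (simp add: inner_diff_right inner_flux_grad)
  qed
  ultimately have "(\<lambda>n. (LINT x|torus. flux_at t x \<bullet> M n x) - dissipation t) \<longlonglongrightarrow> 0" by simp
  then show "(\<lambda>n. LINT x|torus. flux_at t x \<bullet> mollify n (mollify n (grad_at t)) x) \<longlonglongrightarrow> dissipation t"
    unfolding M_def by (rule LIM_zero_cancel)
qed

lemma
  assumes t: "regular t"
  shows integral_mollify_rate_error_le: "\<bar>(LINT x|torus. mollify n (theta_at t) x * rate n x t)
      + \<nu> * (LINT x|torus. flux_at t x \<bullet> mollify n (mollify n (grad_at t)) x)\<bar>
      \<le> radius n * (L * (energy t + (1 + dissipation t)))"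
    and abs_integral_mollify_rate_le: "\<bar>LINT x|torus. mollify n (theta_at t) x * rate n x t\<bar>
      \<le> L * (energy t + (1 + dissipation t)) + 2 * \<nu> * dissipation t"
proof -
  show error: "\<bar>(LINT x|torus. mollify n (theta_at t) x * rate n x t)
      + \<nu> * (LINT x|torus. flux_at t x \<bullet> mollify n (mollify n (grad_at t)) x)\<bar>
      \<le> radius n * (L * (energy t + (1 + dissipation t)))"
    unfolding integral_mollify_rate[OF t]
    using abs_integral_mollify_commutator_le[OF t, of n] by (simp add: mult_ac)
  have "radius n * (L * (energy t + (1 + dissipation t))) \<le> 1 * (L * (energy t + (1 + dissipation t)))"
    using Lipschitz_constant_nonneg energy_nonneg[of t] dissipation_nonneg[of t] by (intro mult_right_mono radius_le_1) auto
  moreover have "\<bar>\<nu> * (LINT x|torus. flux_at t x \<bullet> mollify n (mollify n (grad_at t)) x)\<bar> \<le> \<nu> * (2 * dissipation t)"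
    unfolding abs_mult using nu abs_integral_flux_mollify_le[OF t, of n] by (intro mult_mono) auto
  ultimately show "\<bar>LINT x|torus. mollify n (theta_at t) x * rate n x t\<bar>
      \<le> L * (energy t + (1 + dissipation t)) + 2 * \<nu> * dissipation t"
    using error by linarith
qed

lemma integrable_spacetime_mollify_rate:
  assumes t: "0 \<le> t"
  shows "integrable (spacetime t) (\<lambda>(x, s). mollify n (theta_at s) x * rate n x s)"
proof (rule integrable_spacetimeI)
  obtain B where B: "0 \<le> B" "\<And>s. 0 \<le> s \<Longrightarrow> s \<le> t \<Longrightarrow> energy s \<le> B" using energy_bounded[of t] by blast
  obtain C where C: "0 \<le> C" "\<And>s x. regular s \<Longrightarrow> \<bar>rate n x s\<bar> \<le> C * (1 + dissipation s)"
    using rate_bounded[of n] by blast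
  define K where "K = kernel_bound n * (1 + B) * C"
  have bound: "\<bar>mollify n (theta_at s) x * rate n x s\<bar> \<le> K * (1 + dissipation s)" if s: "regular s" "s \<le> t" for s x
  proof -
    have "\<bar>mollify n (theta_at s) x\<bar> \<le> kernel_bound n * (1 + energy s)"
      by (rule abs_mollify_theta_le[OF regular_nonneg[OF s(1)]])
    also have "\<dots> \<le> kernel_bound n * (1 + B)"
      using B(2)[OF regular_nonneg[OF s(1)] s(2)] kernel_bound_pos[of n] by (intro mult_left_mono) auto
    finally have "\<bar>mollify n (theta_at s) x\<bar> * \<bar>rate n x s\<bar> \<le> (kernel_bound n * (1 + B)) * (C * (1 + dissipation s))"
      by (intro mult_mono C s) (use B kernel_bound_pos[of n] in auto)
    then show ?thesis unfolding K_def by (simp add: abs_mult mult.assoc)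
  qed
  show "AE s in time t. integrable torus (\<lambda>x. mollify n (theta_at s) x * rate n x s)"
    using AE_regular[OF t] by eventually_elim (auto intro: integrable_mollify_rate)
  show "integrable (time t) (\<lambda>s. LINT x|torus. norm (mollify n (theta_at s) x * rate n x s))"
  proof (rule Bochner_Integration.integrable_bound)
    show "integrable (time t) (\<lambda>s. K * (1 + dissipation s))" using dissipation_integrable[OF t] by auto
    show "AE s in time t. norm (LINT x|torus. norm (mollify n (theta_at s) x * rate n x s)) \<le> norm (K * (1 + dissipation s))"
      using AE_regular[OF t]
    proof eventually_elim
      case (elim s)
      have "(LINT x|torus. norm (mollify n (theta_at s) x * rate n x s)) \<le> (LINT x|torus. K * (1 + dissipation s))"
        using elim bound order_trans[OF abs_ge_zero bound] by (intro integral_mono') auto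
      then show ?case by simp
    qed
  qed measurable
qed measurable

lemma mollified_energy_identity:
  assumes t: "0 \<le> t"
  shows "(LINT x|torus. (mollify n (theta_at t) x)\<^sup>2) - (LINT x|torus. (mollify n \<theta>0 x)\<^sup>2)
    = 2 * (LINT s|time t. LINT x|torus. mollify n (theta_at s) x * rate n x s)"
proof -
  note pair = integrable_spacetime_mollify_rate[OF t, of n]
  have square: "(mollify n (theta_at t) x)\<^sup>2 = (mollify n \<theta>0 x)\<^sup>2 + 2 * (LINT s|time t. mollify n (theta_at s) x * rate n x s)" for x
    by (rule primitive_power2[OF rate_integrable[OF t] mollified_evolution]) (use t in auto)
  have "integrable torus (\<lambda>x. (mollify n \<theta>0 x)\<^sup>2)"
    using integrable_norm_mollify_power2[of \<theta>0 n] theta0_power2 by simp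
  then have "(LINT x|torus. (mollify n (theta_at t) x)\<^sup>2)
      = (LINT x|torus. (mollify n \<theta>0 x)\<^sup>2) + 2 * (LINT x|torus. LINT s|time t. mollify n (theta_at s) x * rate n x s)"
    unfolding square using spacetime.integrable_fst[OF pair] by simp
  then show ?thesis using spacetime.Fubini_integral[OF pair] by simp
qed

lemma integral_mollify_rate_tendsto:
  assumes t: "0 \<le> t"
  shows "(\<lambda>n. LINT s|time t. LINT x|torus. mollify n (theta_at s) x * rate n x s)
    \<longlonglongrightarrow> (LINT s|time t. - \<nu> * dissipation s)"
proof -
  obtain B where B: "0 \<le> B" "\<And>s. 0 \<le> s \<Longrightarrow> s \<le> t \<Longrightarrow> energy s \<le> B" using energy_bounded[of t] by blast
  show ?thesis
  proof (rule integral_dominated_convergence[where w = "\<lambda>s. L * (B + (1 + dissipation s)) + 2 * \<nu> * dissipation s"])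
    show "integrable (time t) (\<lambda>s. L * (B + (1 + dissipation s)) + 2 * \<nu> * dissipation s)"
      using dissipation_integrable[OF t] by auto
    show "AE s in time t. (\<lambda>n. LINT x|torus. mollify n (theta_at s) x * rate n x s) \<longlonglongrightarrow> - \<nu> * dissipation s"
      using AE_regular[OF t]
    proof eventually_elim
      case (elim s)
      define X where "X n = (LINT x|torus. mollify n (theta_at s) x * rate n x s)" for n
      define W where "W n = (LINT x|torus. flux_at s x \<bullet> mollify n (mollify n (grad_at s)) x)" for n
      have "(\<lambda>n. X n + \<nu> * W n) \<longlonglongrightarrow> 0"
      proof (rule Lim_null_comparison)
        show "\<forall>\<^sub>F n in sequentially. norm (X n + \<nu> * W n) \<le> radius n * (L * (energy s + (1 + dissipation s)))"
          unfolding X_def W_def real_norm_def using elim by (intro always_eventually allI integral_mollify_rate_error_le) simp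
        show "(\<lambda>n. radius n * (L * (energy s + (1 + dissipation s)))) \<longlonglongrightarrow> 0"
          by (intro tendsto_mult_left_zero radius_tendsto_0)
      qed
      moreover have "(\<lambda>n. \<nu> * W n) \<longlonglongrightarrow> \<nu> * dissipation s"
        unfolding W_def using elim by (intro tendsto_mult_left integral_flux_mollify_tendsto) simp
      ultimately have "(\<lambda>n. (X n + \<nu> * W n) - \<nu> * W n) \<longlonglongrightarrow> 0 - \<nu> * dissipation s" by (rule tendsto_diff)
      then show ?case unfolding X_def by simp
    qed
    show "AE s in time t. norm (LINT x|torus. mollify n (theta_at s) x * rate n x s)
        \<le> L * (B + (1 + dissipation s)) + 2 * \<nu> * dissipation s" for n
      using AE_regular[OF t]
    proof eventually_elim
      case (elim s)
      then have "L * (energy s + (1 + dissipation s)) \<le> L * (B + (1 + dissipation s))"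
        using B(2)[OF regular_nonneg] Lipschitz_constant_nonneg by (intro mult_left_mono) auto
      then show ?case using abs_integral_mollify_rate_le[of s n] elim by simp
    qed
  qed measurable
qed

theorem energy_identity:
  assumes t: "0 \<le> t"
  shows "energy t = (LINT x|torus. (\<theta>0 x)\<^sup>2) - 2 * \<nu> * (LINT s|time t. dissipation s)"
proof -
  have "(\<lambda>n. (LINT x|torus. (mollify n (theta_at t) x)\<^sup>2) - (LINT x|torus. (mollify n \<theta>0 x)\<^sup>2))
      \<longlonglongrightarrow> energy t - (LINT x|torus. (\<theta>0 x)\<^sup>2)"
    unfolding energy_def
    by (intro tendsto_diff integral_mollify_power2_tendsto theta_power2 theta0_power2 t) measurable
  moreover have "(\<lambda>n. (LINT x|torus. (mollify n (theta_at t) x)\<^sup>2) - (LINT x|torus. (mollify n \<theta>0 x)\<^sup>2))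
      \<longlonglongrightarrow> 2 * (LINT s|time t. - \<nu> * dissipation s)"
    unfolding mollified_energy_identity[OF t] by (intro tendsto_mult_left integral_mollify_rate_tendsto t)
  ultimately have "energy t - (LINT x|torus. (\<theta>0 x)\<^sup>2) = 2 * (LINT s|time t. - \<nu> * dissipation s)"
    by (rule LIMSEQ_unique)
  then show ?thesis by simp
qed

lemma energy_antimono:
  assumes "0 \<le> s" "s \<le> t"
  shows "energy t \<le> energy s"
proof -
  have "(LINT r|time s. dissipation r) \<le> (LINT r|time t. dissipation r)"
    using assms dissipation_integrable[of t] dissipation_nonneg by (intro integral_lborel_on_mono_set) auto
  then show ?thesis using energy_identity[of s] energy_identity[of t] assms nu by simp
qed

lemma energy_le_initial:
  assumes "0 \<le> t"
  shows "energy t \<le> (LINT x|torus. (\<theta>0 x)\<^sup>2)"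
proof -
  have "0 \<le> (LINT s|time t. dissipation s)" using dissipation_nonneg by (intro integral_nonneg_AE) auto
  then show ?thesis using energy_identity[OF assms] nu by simp
qed

text \<open>The components of the velocity are admissible test functions in the gradient equation.\<close>

lemma integral_spacetime_velocity_grad:
  assumes t: "0 \<le> t"
  shows "(LINT z|spacetime t. v (fst z) \<bullet> g (fst z) (snd z)) = 0"
proof -
  have component: "(LINT z|spacetime t. \<theta> (fst z) (snd z) *\<^sub>R K (fst z)) = - (LINT z|spacetime t. H (fst z) *\<^sub>R g (fst z) (snd z))"
      "integrable (spacetime t) (\<lambda>z. \<theta> (fst z) (snd z) *\<^sub>R K (fst z))"
      "integrable (spacetime t) (\<lambda>z. H (fst z) *\<^sub>R g (fst z) (snd z))"
    if H: "periodic_C1 H K" for H K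
  proof -
    show "(LINT z|spacetime t. \<theta> (fst z) (snd z) *\<^sub>R K (fst z)) = - (LINT z|spacetime t. H (fst z) *\<^sub>R g (fst z) (snd z))"
      using gradient_equation[OF test_functionI[OF H] t] by simp
    have [measurable]: "H \<in> borel_measurable borel" "K \<in> borel_measurable borel"
      using periodic_C1_continuous[OF H] periodic_C1_continuous_grad[OF H] by (auto intro: borel_measurable_continuous_onI)
    obtain C where C: "\<And>x. \<bar>H x\<bar> \<le> C" "\<And>x. norm (K x) \<le> C" using periodic_C1_bounded[OF H] by blast
    show "integrable (spacetime t) (\<lambda>z. \<theta> (fst z) (snd z) *\<^sub>R K (fst z))"
    proof (rule integrable_dominated[OF integrable_spacetime_theta[OF t], where C = C])
      show "norm (\<theta> (fst z) (snd z) *\<^sub>R K (fst z)) \<le> C * norm (\<theta> (fst z) (snd z))" for z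
        using mult_left_mono[OF C(2), of "\<bar>\<theta> (fst z) (snd z)\<bar>"] by (simp add: mult.commute)
    qed measurable
    show "integrable (spacetime t) (\<lambda>z. H (fst z) *\<^sub>R g (fst z) (snd z))"
      by (rule integrable_dominated[OF integrable_spacetime_grad[OF t], where C = C]) (auto intro: mult_right_mono C(1))
  qed
  note first = component[OF fst_velocity_C1] and second = component[OF snd_velocity_C1]
  note fst_integral = integral_bounded_linear[OF bounded_linear_fst] integrable_bounded_linear[OF bounded_linear_fst]
    and snd_integral = integral_bounded_linear[OF bounded_linear_snd] integrable_bounded_linear[OF bounded_linear_snd]
  have "(LINT z|spacetime t. v (fst z) \<bullet> g (fst z) (snd z))
      = (LINT z|spacetime t. fst (v (fst z)) * fst (g (fst z) (snd z))) + (LINT z|spacetime t. snd (v (fst z)) * snd (g (fst z) (snd z)))"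
    unfolding inner_prod_def inner_real_def
    using fst_integral(2)[OF first(3)] snd_integral(2)[OF second(3)] by simp
  also have "\<dots> = - ((LINT z|spacetime t. \<theta> (fst z) (snd z) * fst (Dv1 (fst z)))
      + (LINT z|spacetime t. \<theta> (fst z) (snd z) * snd (Dv2 (fst z))))"
    using fst_integral(1)[OF first(2)] fst_integral(1)[OF first(3)] first(1)
      snd_integral(1)[OF second(2)] snd_integral(1)[OF second(3)] second(1) by simp
  also have "\<dots> = - (LINT z|spacetime t. \<theta> (fst z) (snd z) * (fst (Dv1 (fst z)) + snd (Dv2 (fst z))))"
    using fst_integral(2)[OF first(2)] snd_integral(2)[OF second(2)] by (simp add: distrib_left)
  finally show ?thesis by (simp add: divergence_zero)
qed

lemma mean_conserved:
  assumes t: "0 \<le> t"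
  shows "(LINT x|torus. \<theta> x t) = (LINT x|torus. \<theta>0 x)"
proof -
  have "test_function (\<lambda>x t. 1) (\<lambda>z. 0)"
    using test_functionI[OF periodic_C1_const[of 1]] by (simp add: zero_prod_def)
  from evolution_equation[OF this t] integral_spacetime_velocity_grad[OF t]
  show ?thesis by simp
qed

end

section \<open>Differences of the mollified solution\<close>

lemma two_abs_mult_le:
  fixes a b s M :: real
  assumes "b\<^sup>2 \<le> s\<^sup>2 * M" "0 \<le> s" "0 \<le> M"
  shows "2 * \<bar>a * b\<bar> \<le> s * (a\<^sup>2 + M)"
proof -
  have "b\<^sup>2 \<le> (s * sqrt M)\<^sup>2" using assms by (simp add: power_mult_distrib)
  then have "\<bar>b\<bar> \<le> s * sqrt M" using assms by (simp add: power2_le_iff_abs_le)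
  then have "2 * \<bar>a * b\<bar> \<le> 2 * (\<bar>a\<bar> * (s * sqrt M))" by (simp add: abs_mult mult_left_mono)
  also have "\<dots> = s * (2 * \<bar>a\<bar> * sqrt M)" by simp
  also have "\<dots> \<le> s * (\<bar>a\<bar>\<^sup>2 + (sqrt M)\<^sup>2)" by (intro mult_left_mono sum_squares_bound assms)
  finally show ?thesis using assms by simp
qed

definition defect :: "real \<Rightarrow> nat \<Rightarrow> real" where
  "defect p n = radius n powr (1 - 2 / p)"

definition residual_bound :: "real \<Rightarrow> real \<Rightarrow> nat \<Rightarrow> real" where
  "residual_bound \<nu> B n = 16 * (kernel_bound n)\<^sup>2 + 16 * kernel_bound n * \<nu> * kernel_grad_bound n * B"

lemma defect_pos: "0 < defect p n"
  unfolding defect_def by simp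

context p_laplacian_solution
begin

lemma defect_power2:
  shows "(radius n)\<^sup>2 * (radius n powr (- 2 / p))\<^sup>2 = (defect p n)\<^sup>2"
    and "(radius n powr (- 2 / p)) powr (2 - p) = (defect p n)\<^sup>2"
proof -
  have "radius n * radius n powr (- 2 / p) = radius n powr 1 * radius n powr (- 2 / p)"
    using radius_pos[of n] by (simp add: less_imp_le)
  also have "\<dots> = defect p n" unfolding defect_def powr_add[symmetric] by simp
  finally show "(radius n)\<^sup>2 * (radius n powr (- 2 / p))\<^sup>2 = (defect p n)\<^sup>2"
    unfolding power_mult_distrib[symmetric] by simp
  have "- 2 / p * (2 - p) = (1 - 2 / p) * 2" using p by (simp add: field_simps)
  then have "(radius n powr (- 2 / p)) powr (2 - p) = defect p n powr 2"
    unfolding defect_def powr_powr by simp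
  then show "(radius n powr (- 2 / p)) powr (2 - p) = (defect p n)\<^sup>2"
    using defect_pos[of p n] by simp
qed

text \<open>Here $p > 2$ enters: the defect $\rho^{1 - 2/p}$ vanishes with the radius $\rho$ of the kernel.\<close>

lemma mollify_grad_power2_le:
  assumes t: "regular t"
  shows "(radius n)\<^sup>2 * mollify n (\<lambda>y. (norm (g y t))\<^sup>2) x \<le> 256 * (defect p n)\<^sup>2 * (1 + dissipation t)"
proof -
  note gp = regular_grad_powr[OF t]
  define c where "c = radius n powr (- 2 / p)"
  have c: "0 < c" "(radius n)\<^sup>2 * c\<^sup>2 = (defect p n)\<^sup>2" "c powr (2 - p) = (defect p n)\<^sup>2"
    unfolding c_def using defect_power2[of n] by simp_all
  have "mollify n (\<lambda>y. (norm (g y t))\<^sup>2) x \<le> mollify n (\<lambda>y. c\<^sup>2 + c powr (2 - p) * norm (g y t) powr p) x"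
  proof (rule mollify_mono)
    show "(norm (g y t))\<^sup>2 \<le> c\<^sup>2 + c powr (2 - p) * norm (g y t) powr p" for y
      using p by (intro power2_le_add_powr c) auto
  qed (use gp regular_grad_power2[OF t] in auto)
  also have "\<dots> = c\<^sup>2 + (defect p n)\<^sup>2 * mollify n (\<lambda>y. norm (g y t) powr p) x"
    using gp by (simp add: mollify_add mollify_mult_left mollify_const c)
  also have "mollify n (\<lambda>y. norm (g y t) powr p) x \<le> kernel_bound n * dissipation t"
    using norm_mollify_le_bound[OF gp, of n x] unfolding dissipation_def by simp
  finally have "mollify n (\<lambda>y. (norm (g y t))\<^sup>2) x \<le> c\<^sup>2 + (defect p n)\<^sup>2 * (kernel_bound n * dissipation t)"
    by (simp add: mult_left_mono)
  then have "(radius n)\<^sup>2 * mollify n (\<lambda>y. (norm (g y t))\<^sup>2) x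
      \<le> (radius n)\<^sup>2 * (c\<^sup>2 + (defect p n)\<^sup>2 * (kernel_bound n * dissipation t))"
    by (rule mult_left_mono) simp
  also have "\<dots> = (defect p n)\<^sup>2 + 256 * (defect p n)\<^sup>2 * dissipation t"
    unfolding distrib_left c by (simp add: kernel_bound_def)
  also have "\<dots> \<le> 256 * (defect p n)\<^sup>2 * (1 + dissipation t)" by (simp add: distrib_left)
  finally show ?thesis .
qed

lemma commutator_grad_power2_le:
  assumes "regular t"
  shows "(commutator n (grad_at t) x)\<^sup>2 \<le> (L * defect p n)\<^sup>2 * (256 * (1 + dissipation t))"
proof -
  have "(commutator n (grad_at t) x)\<^sup>2 \<le> L\<^sup>2 * ((radius n)\<^sup>2 * mollify n (\<lambda>y. (norm (g y t))\<^sup>2) x)"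
    using commutator_power2_le[OF _ regular_grad_power2[OF assms], of n x] by (simp add: power_mult_distrib mult.assoc)
  also have "\<dots> \<le> L\<^sup>2 * (256 * (defect p n)\<^sup>2 * (1 + dissipation t))"
    by (intro mult_left_mono mollify_grad_power2_le assms) simp
  finally show ?thesis by (simp only: power_mult_distrib mult_ac)
qed

lemma radius_norm_mollify_grad_power2_le:
  assumes "regular t"
  shows "(radius n * norm (mollify n (grad_at t) x))\<^sup>2 \<le> 256 * (defect p n)\<^sup>2 * (1 + dissipation t)"
proof -
  have "(norm (mollify n (grad_at t) x))\<^sup>2 \<le> mollify n (\<lambda>y. (norm (g y t))\<^sup>2) x"
    by (rule norm_mollify_power2_le[OF _ regular_grad_power2[OF assms]]) measurable
  then have "(radius n)\<^sup>2 * (norm (mollify n (grad_at t) x))\<^sup>2 \<le> (radius n)\<^sup>2 * mollify n (\<lambda>y. (norm (g y t))\<^sup>2) x"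
    by (rule mult_left_mono) simp
  also have "\<dots> \<le> 256 * (defect p n)\<^sup>2 * (1 + dissipation t)" by (rule mollify_grad_power2_le[OF assms])
  finally show ?thesis by (simp add: power_mult_distrib)
qed

definition increment :: "nat \<Rightarrow> real \<times> real \<Rightarrow> real \<times> real \<Rightarrow> real \<Rightarrow> real" where
  "increment n x y t = mollify n (theta_at t) x - mollify n (theta_at t) y"

definition remainder :: "nat \<Rightarrow> real \<times> real \<Rightarrow> real \<times> real \<Rightarrow> real \<Rightarrow> real" where
  "remainder n x y t = \<nu> * (mollify_div n (flux_at t) x - mollify_div n (flux_at t) y)
     - (commutator n (grad_at t) x - commutator n (grad_at t) y)"

lemma borel_measurable_increment [measurable]:
  assumes [measurable]: "a \<in> borel_measurable M" "b \<in> borel_measurable M" "c \<in> borel_measurable M"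
  shows "(\<lambda>w. increment n (a w) (b w) (c w)) \<in> borel_measurable M"
  unfolding increment_def by measurable

lemma borel_measurable_remainder [measurable]: "remainder n x y \<in> borel_measurable borel"
  unfolding remainder_def[abs_def] commutator_def mollify_def mollify_div_def by measurable

lemma rate_diff_stagnation_point:
  assumes "v y = 0"
  shows "rate n x t - rate n y t = remainder n x y t - v x \<bullet> mollify n (grad_at t) x"
  unfolding rate_eq_commutator remainder_def using assms by (simp add: algebra_simps)

lemma increment_power2_le:
  assumes t: "regular t" and near: "norm (x - y) \<le> radius n"
  shows "(increment n x y t)\<^sup>2 \<le> 256 * (defect p n)\<^sup>2 * (1 + dissipation t)"
proof -
  define D where "D = sqrt (256 * (defect p n)\<^sup>2 * (1 + dissipation t)) / radius n"
  have D: "0 \<le> D" "(radius n * D)\<^sup>2 = 256 * (defect p n)\<^sup>2 * (1 + dissipation t)"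
    unfolding D_def using dissipation_nonneg[of t] by (simp_all add: less_imp_le)
  have F: "periodic_C1 (mollify n (theta_at t)) (mollify n (grad_at t))"
    by (rule periodic_C1_mollify_weak[OF regular_weak_gradient[OF t]])
  have grad: "norm (mollify n (grad_at t) w) \<le> D" for w
  proof -
    have "radius n * norm (mollify n (grad_at t) w) \<le> radius n * D"
      by (rule power2_le_imp_le) (use radius_norm_mollify_grad_power2_le[OF t, of n w] D in \<open>auto simp: less_imp_le\<close>)
    then show ?thesis by simp
  qed
  have "\<bar>increment n x y t\<bar> \<le> D * norm (x - y)"
    unfolding increment_def by (rule GDERIV_imp_Lipschitz[OF periodic_C1_GDERIV[OF F] grad])
  also have "\<dots> \<le> D * radius n" using near D by (intro mult_left_mono) auto
  finally have "\<bar>increment n x y t\<bar>\<^sup>2 \<le> (radius n * D)\<^sup>2" by (intro power_mono) (auto simp: mult.commute)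
  then show ?thesis unfolding D by simp
qed

lemma increment_remainder_le:
  assumes t: "regular t" and increment: "\<bar>increment n x y t\<bar> \<le> K"
  shows "2 * \<bar>increment n x y t * remainder n x y t\<bar>
    \<le> L * defect p n * ((increment n x y t)\<^sup>2 + 1024 * (1 + dissipation t))
      + 4 * K * \<nu> * kernel_grad_bound n * (1 + dissipation t)"
proof -
  define d where "d = increment n x y t"
  define commutators where "commutators = commutator n (grad_at t) x - commutator n (grad_at t) y"
  define fluxes where "fluxes = mollify_div n (flux_at t) x - mollify_div n (flux_at t) y"
  have "commutators\<^sup>2 \<le> 2 * (commutator n (grad_at t) x)\<^sup>2 + 2 * (commutator n (grad_at t) y)\<^sup>2"
    using power2_add_le[of "commutator n (grad_at t) x" "- commutator n (grad_at t) y"] unfolding commutators_def by simp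
  also have "\<dots> \<le> (L * defect p n)\<^sup>2 * (1024 * (1 + dissipation t))"
    using commutator_grad_power2_le[OF t, of n x] commutator_grad_power2_le[OF t, of n y] by (simp add: algebra_simps)
  finally have transport: "2 * \<bar>d * commutators\<bar> \<le> L * defect p n * (d\<^sup>2 + 1024 * (1 + dissipation t))"
    using Lipschitz_constant_nonneg defect_pos[of p n] dissipation_nonneg[of t]
    by (intro two_abs_mult_le) (auto simp: less_imp_le)
  have "\<bar>fluxes\<bar> \<le> 2 * (kernel_grad_bound n * (1 + dissipation t))"
    using abs_mollify_div_flux_le[OF t, of n x] abs_mollify_div_flux_le[OF t, of n y] unfolding fluxes_def by linarith
  then have "\<bar>d\<bar> * (\<nu> * \<bar>fluxes\<bar>) \<le> K * (\<nu> * (2 * (kernel_grad_bound n * (1 + dissipation t))))"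
    using increment nu unfolding d_def by (intro mult_mono mult_left_mono) auto
  moreover have "\<bar>d * remainder n x y t\<bar> \<le> \<bar>d\<bar> * (\<nu> * \<bar>fluxes\<bar>) + \<bar>d * commutators\<bar>"
    using abs_triangle_ineq4[of "d * (\<nu> * fluxes)" "d * commutators"] nu
    unfolding remainder_def fluxes_def[symmetric] commutators_def[symmetric] by (simp add: right_diff_distrib abs_mult)
  ultimately show ?thesis using transport unfolding d_def by (simp add: algebra_simps)
qed

end

locale dissipation_bounded_solution = p_laplacian_solution +
  fixes \<tau> B :: real
  assumes tau: "0 < \<tau>"
    and theta0_energy: "(LINT x|torus. (\<theta>0 x)\<^sup>2) = 1"
    and dissipation_bound: "(LINT t|time \<tau>. 1 + dissipation t) \<le> B"
begin

lemma energy_le_1: "0 \<le> t \<Longrightarrow> energy t \<le> 1"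
  using energy_le_initial theta0_energy by simp

lemma integrable_one_plus_dissipation: "integrable (time \<tau>) (\<lambda>t. 1 + dissipation t)"
  using dissipation_integrable[of \<tau>] tau by auto

lemma B_nonneg: "0 \<le> B"
proof -
  have "0 \<le> (LINT t|time \<tau>. 1 + dissipation t)"
    using dissipation_nonneg by (intro integral_nonneg_AE) (simp add: add_nonneg_nonneg)
  then show ?thesis using dissipation_bound by simp
qed

lemma AE_regular_tau: "AE t in time \<tau>. regular t"
  using AE_regular[of \<tau>] tau by auto

lemma abs_mollify_theta_le_bound:
  assumes "0 \<le> t"
  shows "\<bar>mollify n (theta_at t) x\<bar> \<le> 2 * kernel_bound n"
proof -
  have "kernel_bound n * (1 + energy t) \<le> kernel_bound n * 2"
    using energy_le_1[OF assms] kernel_bound_pos[of n] by (intro mult_left_mono) auto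
  then show ?thesis using abs_mollify_theta_le[OF assms, of n x] by simp
qed

lemma abs_mollify_theta0_le_bound: "\<bar>mollify n \<theta>0 x\<bar> \<le> 2 * kernel_bound n"
proof -
  have "\<bar>mollify n \<theta>0 x\<bar> \<le> kernel_bound n * (LINT y|torus. \<bar>\<theta>0 y\<bar>)"
    using norm_mollify_le_bound[OF theta0_integrable, of n x] by simp
  also have "\<dots> \<le> kernel_bound n * (1 + 1)"
    using integral_abs_torus_le[OF _ theta0_power2] theta0_energy kernel_bound_pos[of n]
    by (intro mult_left_mono) auto
  finally show ?thesis by simp
qed

lemma norm_mollify_grad_theta_le_bound:
  assumes "0 \<le> t"
  shows "norm (mollify_grad n (theta_at t) x) \<le> 2 * kernel_grad_bound n"
proof -
  have "norm (mollify_grad n (theta_at t) x) \<le> kernel_grad_bound n * (LINT y|torus. \<bar>\<theta> y t\<bar>)"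
    by (rule norm_mollify_grad_le_bound[OF theta_integrable[OF assms]])
  also have "\<dots> \<le> kernel_grad_bound n * (1 + energy t)"
    unfolding energy_def by (intro mult_left_mono integral_abs_torus_le theta_power2 assms kernel_grad_bound_nonneg) measurable
  also have "\<dots> \<le> kernel_grad_bound n * 2"
    using energy_le_1[OF assms] by (intro mult_left_mono kernel_grad_bound_nonneg) auto
  finally show ?thesis by simp
qed

lemma abs_increment_le:
  assumes "0 \<le> t"
  shows "\<bar>increment n x y t\<bar> \<le> 4 * kernel_bound n"
  using abs_mollify_theta_le_bound[OF assms, of n x] abs_mollify_theta_le_bound[OF assms, of n y]
  unfolding increment_def by linarith

lemma increment_power2_le_bound:
  assumes "0 \<le> t"
  shows "(increment n x y t)\<^sup>2 \<le> (4 * kernel_bound n)\<^sup>2"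
  using power_mono[OF abs_increment_le[OF assms], of n x y 2] by simp

lemma initial_increment_power2_le_bound: "(mollify n \<theta>0 x - mollify n \<theta>0 y)\<^sup>2 \<le> (4 * kernel_bound n)\<^sup>2"
proof -
  have "\<bar>mollify n \<theta>0 x - mollify n \<theta>0 y\<bar> \<le> 4 * kernel_bound n"
    using abs_mollify_theta0_le_bound[of n x] abs_mollify_theta0_le_bound[of n y] by linarith
  from power_mono[OF this, of 2] show ?thesis by simp
qed

definition gap :: "nat \<Rightarrow> real \<times> real \<Rightarrow> real \<times> real \<Rightarrow> real" where
  "gap n x y = (LINT t|time \<tau>. (increment n x y t)\<^sup>2)"

definition gap_grad :: "nat \<Rightarrow> real \<times> real \<Rightarrow> real \<times> real \<Rightarrow> real \<times> real" where
  "gap_grad n x y = (LINT t|time \<tau>. (2 * increment n x y t) *\<^sub>R mollify_grad n (theta_at t) x)"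

lemma gap_nonneg: "0 \<le> gap n x y"
  and gap_self: "gap n x x = 0"
  unfolding gap_def increment_def by simp_all

lemma integrable_increment_power2: "integrable (time \<tau>) (\<lambda>t. (increment n x y t)\<^sup>2)"
proof (rule time.integrable_const_bound[where B = "(4 * kernel_bound n)\<^sup>2"])
  show "AE t in time \<tau>. norm ((increment n x y t)\<^sup>2) \<le> (4 * kernel_bound n)\<^sup>2"
    using AE_time by eventually_elim (simp only: real_norm_def abs_power2 increment_power2_le_bound)
qed measurable

lemma gap_le_bound: "gap n x y \<le> \<tau> * (4 * kernel_bound n)\<^sup>2"
proof -
  have "gap n x y \<le> (LINT t|time \<tau>. (4 * kernel_bound n)\<^sup>2)"
    unfolding gap_def
  proof (rule integral_mono_AE[OF integrable_increment_power2])
    show "AE t in time \<tau>. (increment n x y t)\<^sup>2 \<le> (4 * kernel_bound n)\<^sup>2"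
      using AE_time by eventually_elim (simp only: increment_power2_le_bound)
  qed simp
  then show ?thesis using tau by simp
qed

lemma gap_triangle: "gap n x z \<le> 2 * gap n x y + 2 * gap n y z"
proof -
  have "gap n x z \<le> (LINT t|time \<tau>. 2 * (increment n x y t)\<^sup>2 + 2 * (increment n y z t)\<^sup>2)"
    unfolding gap_def
  proof (rule integral_mono[OF integrable_increment_power2])
    show "(increment n x z t)\<^sup>2 \<le> 2 * (increment n x y t)\<^sup>2 + 2 * (increment n y z t)\<^sup>2" for t
      using power2_add_le[of "increment n x y t" "increment n y z t"] unfolding increment_def by simp
  qed (use integrable_increment_power2 in auto)
  then show ?thesis unfolding gap_def using integrable_increment_power2 by simp
qed

lemma gap_le_of_near:
  assumes "norm (x - y) \<le> radius n"
  shows "gap n x y \<le> 256 * (defect p n)\<^sup>2 * B"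
proof -
  have "gap n x y \<le> (LINT t|time \<tau>. 256 * (defect p n)\<^sup>2 * (1 + dissipation t))"
    unfolding gap_def
  proof (rule integral_mono_AE[OF integrable_increment_power2])
    show "AE t in time \<tau>. (increment n x y t)\<^sup>2 \<le> 256 * (defect p n)\<^sup>2 * (1 + dissipation t)"
      using AE_regular_tau by eventually_elim (rule increment_power2_le[OF _ assms])
  qed (intro integrable_mult_right integrable_one_plus_dissipation)
  also have "\<dots> = 256 * (defect p n)\<^sup>2 * (LINT t|time \<tau>. 1 + dissipation t)" by simp
  also have "\<dots> \<le> 256 * (defect p n)\<^sup>2 * B" by (intro mult_left_mono dissipation_bound) simp
  finally show ?thesis .
qed

lemma
  shows GDERIV_gap: "GDERIV (\<lambda>x. gap n x y) x :> gap_grad n x y"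
    and integrable_gap_grad: "integrable (time \<tau>) (\<lambda>t. (2 * increment n x y t) *\<^sub>R mollify_grad n (theta_at t) x)"
proof -
  define C where "C = 2 * (4 * kernel_bound n) * (2 * kernel_grad_bound n)"
  have bound: "norm ((2 * increment n x y t) *\<^sub>R mollify_grad n (theta_at t) x) \<le> C" if "0 \<le> t" for x t
    unfolding C_def
    using mult_mono[OF abs_increment_le norm_mollify_grad_theta_le_bound, OF that that] kernel_bound_pos[of n]
    by (simp add: abs_mult)
  have measurable: "(\<lambda>t. (2 * increment n x y t) *\<^sub>R mollify_grad n (theta_at t) x) \<in> borel_measurable (time \<tau>)" for x
    unfolding mollify_grad_def by measurable
  show "integrable (time \<tau>) (\<lambda>t. (2 * increment n x y t) *\<^sub>R mollify_grad n (theta_at t) x)"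
    by (rule time.integrable_const_bound[OF _ measurable, of _ C]) (use AE_time in eventually_elim, simp add: bound del: norm_scaleR)
  show "GDERIV (\<lambda>x. gap n x y) x :> gap_grad n x y"
    unfolding gap_def gap_grad_def
  proof (rule GDERIV_parameter_integral[where S = "{0..}" and f = "\<lambda>_. C", OF _ integrable_increment_power2 measurable])
    show "AE t in time \<tau>. t \<in> {0..}" using AE_time by eventually_elim simp
    show "norm ((2 * increment n x y t) *\<^sub>R mollify_grad n (theta_at t) x) \<le> C" if "t \<in> {0..}" for x t
      using bound that by simp
    show "GDERIV (\<lambda>x. (increment n x y t)\<^sup>2) x :> (2 * increment n x y t) *\<^sub>R mollify_grad n (theta_at t) x"
      if "t \<in> {0..}" for x t
    proof -
      have "GDERIV (\<lambda>x. increment n x y t) x :> mollify_grad n (theta_at t) x - 0"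
        unfolding increment_def using that by (intro GDERIV_diff GDERIV_mollify GDERIV_const theta_integrable) simp
      from GDERIV_mult[OF this this] show ?thesis by (simp add: power2_eq_square scaleR_add_left[symmetric])
    qed
  qed simp
qed

lemma
  shows integrable_increment_rate: "integrable (time \<tau>) (\<lambda>t. increment n x y t * (rate n x t - rate n y t))"
    and increment_power2_eq: "(increment n x y \<tau>)\<^sup>2 = (mollify n \<theta>0 x - mollify n \<theta>0 y)\<^sup>2
      + 2 * (LINT t|time \<tau>. increment n x y t * (rate n x t - rate n y t))"
proof -
  have rate: "integrable (time t) (\<lambda>s. rate n x s - rate n y s)" if "0 \<le> t" for t
    using that by (intro Bochner_Integration.integrable_diff rate_integrable)
  have primitive: "increment n x y t = (mollify n \<theta>0 x - mollify n \<theta>0 y) + (LINT s|time t. rate n x s - rate n y s)"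
    if "0 \<le> t" for t
    unfolding increment_def mollified_evolution[OF that] using rate_integrable[OF that] by simp
  note square = rate[OF less_imp_le[OF tau]] primitive _ less_imp_le[OF tau]
  show "integrable (time \<tau>) (\<lambda>t. increment n x y t * (rate n x t - rate n y t))"
    by (rule integrable_mult_primitive[OF square]) measurable
  show "(increment n x y \<tau>)\<^sup>2 = (mollify n \<theta>0 x - mollify n \<theta>0 y)\<^sup>2
      + 2 * (LINT t|time \<tau>. increment n x y t * (rate n x t - rate n y t))"
    by (rule primitive_power2[OF square]) measurable
qed

text \<open>The transport term turns the time derivative of the squared increment to a stagnation point into
  the derivative of the gap along the flow.\<close>

lemma
  assumes stagnation: "v y = 0"
  shows integrable_increment_remainder: "integrable (time \<tau>) (\<lambda>t. increment n x y t * remainder n x y t)"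
    and velocity_gap_grad_eq: "v x \<bullet> gap_grad n x y
      = (mollify n \<theta>0 x - mollify n \<theta>0 y)\<^sup>2 - (increment n x y \<tau>)\<^sup>2
        + 2 * (LINT t|time \<tau>. increment n x y t * remainder n x y t)"
proof -
  define transport where "transport t = v x \<bullet> ((2 * increment n x y t) *\<^sub>R mollify_grad n (theta_at t) x)" for t
  have transport: "integrable (time \<tau>) transport" "(LINT t|time \<tau>. transport t) = v x \<bullet> gap_grad n x y"
    unfolding transport_def gap_grad_def
    by (intro integrable_inner_right integral_inner_right integrable_gap_grad)+
  have split: "AE t in time \<tau>. increment n x y t * remainder n x y t
      = increment n x y t * (rate n x t - rate n y t) + transport t / 2"
    using AE_regular_tau
  proof eventually_elim
    case (elim t)
    then show ?case
      unfolding rate_diff_stagnation_point[OF stagnation] transport_def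
        weak_gradient_mollify[OF regular_weak_gradient[OF elim]]
      by (simp add: algebra_simps)
  qed
  have sum: "integrable (time \<tau>) (\<lambda>t. increment n x y t * (rate n x t - rate n y t) + transport t / 2)"
    using integrable_increment_rate transport(1) by auto
  show "integrable (time \<tau>) (\<lambda>t. increment n x y t * remainder n x y t)"
    by (rule integrable_cong_AE_imp[OF sum]) (use split in \<open>auto elim: eventually_mono\<close>)
  have "(LINT t|time \<tau>. increment n x y t * remainder n x y t)
      = (LINT t|time \<tau>. increment n x y t * (rate n x t - rate n y t) + transport t / 2)"
    by (rule integral_cong_AE[OF _ _ split]) (use borel_measurable_integrable[OF sum] in auto)
  also have "\<dots> = (LINT t|time \<tau>. increment n x y t * (rate n x t - rate n y t)) + v x \<bullet> gap_grad n x y / 2"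
    using integrable_increment_rate transport by simp
  finally show "v x \<bullet> gap_grad n x y = (mollify n \<theta>0 x - mollify n \<theta>0 y)\<^sup>2 - (increment n x y \<tau>)\<^sup>2
        + 2 * (LINT t|time \<tau>. increment n x y t * remainder n x y t)"
    using increment_power2_eq[of n x y] by simp
qed

lemma abs_velocity_gap_grad_le:
  assumes stagnation: "v y = 0"
  shows "\<bar>v x \<bullet> gap_grad n x y\<bar> \<le> L * defect p n * (gap n x y + 1024 * B) + residual_bound \<nu> B n"
proof -
  define K where "K = 16 * kernel_bound n * \<nu> * kernel_grad_bound n"
  have K: "0 \<le> K" unfolding K_def using nu kernel_bound_pos[of n] kernel_grad_bound_nonneg[of n] by (simp add: less_imp_le)
  have s: "0 \<le> L * defect p n" using Lipschitz_constant_nonneg defect_pos[of p n] by (simp add: less_imp_le)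
  define N where "N t = 1 + dissipation t" for t
  note N = integrable_one_plus_dissipation[folded N_def] dissipation_bound[folded N_def]
  have "2 * \<bar>LINT t|time \<tau>. increment n x y t * remainder n x y t\<bar>
      \<le> (LINT t|time \<tau>. 2 * \<bar>increment n x y t * remainder n x y t\<bar>)"
    using integral_norm_bound[of "time \<tau>" "\<lambda>t. increment n x y t * remainder n x y t"] by simp
  also have "\<dots> \<le> (LINT t|time \<tau>. L * defect p n * ((increment n x y t)\<^sup>2 + 1024 * N t) + K * N t)"
  proof (rule integral_mono_AE)
    show "AE t in time \<tau>. 2 * \<bar>increment n x y t * remainder n x y t\<bar>
        \<le> L * defect p n * ((increment n x y t)\<^sup>2 + 1024 * N t) + K * N t"
      using AE_regular_tau
    proof eventually_elim
      case (elim t)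
      show ?case
        using increment_remainder_le[OF elim abs_increment_le[OF regular_nonneg[OF elim]]]
        unfolding K_def N_def by simp
    qed
    show "integrable (time \<tau>) (\<lambda>t. 2 * \<bar>increment n x y t * remainder n x y t\<bar>)"
      by (intro integrable_mult_right integrable_abs integrable_increment_remainder stagnation)
  qed (intro Bochner_Integration.integrable_add integrable_mult_right integrable_increment_power2 N)
  also have "\<dots> = L * defect p n * (gap n x y + 1024 * (LINT t|time \<tau>. N t)) + K * (LINT t|time \<tau>. N t)"
    unfolding gap_def using integrable_increment_power2 N(1) by simp
  also have "\<dots> \<le> L * defect p n * (gap n x y + 1024 * B) + K * B"
    by (intro add_mono mult_left_mono order_refl N(2) s K) simp
  finally have integral: "2 * \<bar>LINT t|time \<tau>. increment n x y t * remainder n x y t\<bar>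
      \<le> L * defect p n * (gap n x y + 1024 * B) + K * B" .
  have "(mollify n \<theta>0 x - mollify n \<theta>0 y)\<^sup>2 \<le> 16 * (kernel_bound n)\<^sup>2" "(increment n x y \<tau>)\<^sup>2 \<le> 16 * (kernel_bound n)\<^sup>2"
    using initial_increment_power2_le_bound[of n x y] increment_power2_le_bound[of \<tau> n x y] tau
    by (simp_all add: power_mult_distrib)
  moreover have "0 \<le> (mollify n \<theta>0 x - mollify n \<theta>0 y)\<^sup>2" "0 \<le> (increment n x y \<tau>)\<^sup>2" by simp_all
  ultimately show ?thesis
    using integral unfolding velocity_gap_grad_eq[OF stagnation] residual_bound_def K_def by linarith
qed

end

section \<open>The cellular flow and its separatrices\<close>

abbreviation (input) cellular_flow :: "real \<Rightarrow> nat \<Rightarrow> real \<times> real \<Rightarrow> real \<times> real" where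
  "cellular_flow A m \<equiv> (\<lambda>x. A *\<^sub>R cell_flow (real m *\<^sub>R x))"

definition cellular_grad_fst :: "real \<Rightarrow> nat \<Rightarrow> real \<times> real \<Rightarrow> real \<times> real" where
  "cellular_grad_fst A m x = (A * (2 * pi)\<^sup>2 * real m) *\<^sub>R
     (- cos (2 * pi * real m * fst x) * cos (2 * pi * real m * snd x),
      sin (2 * pi * real m * fst x) * sin (2 * pi * real m * snd x))"

definition cellular_grad_snd :: "real \<Rightarrow> nat \<Rightarrow> real \<times> real \<Rightarrow> real \<times> real" where
  "cellular_grad_snd A m x = (A * (2 * pi)\<^sup>2 * real m) *\<^sub>R
     (- sin (2 * pi * real m * fst x) * sin (2 * pi * real m * snd x),
      cos (2 * pi * real m * fst x) * cos (2 * pi * real m * snd x))"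

lemma cell_flow_scaleR: "cell_flow (real m *\<^sub>R x) =
  (- (2 * pi) * (sin (2 * pi * real m * fst x) * cos (2 * pi * real m * snd x)),
     (2 * pi) * (cos (2 * pi * real m * fst x) * sin (2 * pi * real m * snd x)))"
  unfolding cell_flow_def by (simp add: mult_ac)

lemma
  shows abs_sin_diff_le: "\<bar>sin (2 * pi * real m * a) - sin (2 * pi * real m * b)\<bar> \<le> 2 * real m * \<bar>sin (pi * (a - b))\<bar>"
    and abs_cos_diff_le: "\<bar>cos (2 * pi * real m * a) - cos (2 * pi * real m * b)\<bar> \<le> 2 * real m * \<bar>sin (pi * (a - b))\<bar>"
proof -
  define s where "s = \<bar>sin (real m * (pi * (a - b)))\<bar>"
  have s: "0 \<le> s" "s \<le> real m * \<bar>sin (pi * (a - b))\<bar>"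
    unfolding s_def using abs_sin_nat_mult_le by simp_all
  have half: "(2 * pi * real m * a - 2 * pi * real m * b) / 2 = real m * (pi * (a - b))"
    "(2 * pi * real m * b - 2 * pi * real m * a) / 2 = - (real m * (pi * (a - b)))"
    by (simp_all add: field_simps)
  have "\<bar>sin (2 * pi * real m * a) - sin (2 * pi * real m * b)\<bar>
      = 2 * s * \<bar>cos ((2 * pi * real m * a + 2 * pi * real m * b) / 2)\<bar>"
    unfolding sin_diff_sin half s_def by (simp add: abs_mult)
  also have "\<dots> \<le> 2 * s * 1" using s by (intro mult_left_mono) auto
  finally show "\<bar>sin (2 * pi * real m * a) - sin (2 * pi * real m * b)\<bar> \<le> 2 * real m * \<bar>sin (pi * (a - b))\<bar>"
    using s by simp
  have "\<bar>cos (2 * pi * real m * a) - cos (2 * pi * real m * b)\<bar>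
      = 2 * s * \<bar>sin ((2 * pi * real m * a + 2 * pi * real m * b) / 2)\<bar>"
    unfolding cos_diff_cos half s_def by (simp add: abs_mult)
  also have "\<dots> \<le> 2 * s * 1" using s by (intro mult_left_mono) auto
  finally show "\<bar>cos (2 * pi * real m * a) - cos (2 * pi * real m * b)\<bar> \<le> 2 * real m * \<bar>sin (pi * (a - b))\<bar>"
    using s by simp
qed

lemma abs_mult_diff_le:
  fixes a a' b b' d :: real
  assumes "\<bar>a\<bar> \<le> 1" "\<bar>b'\<bar> \<le> 1" "\<bar>a - a'\<bar> \<le> d" "\<bar>b - b'\<bar> \<le> d"
  shows "\<bar>a * b - a' * b'\<bar> \<le> 2 * d"
proof -
  have "\<bar>a * b - a' * b'\<bar> = \<bar>a * (b - b') + (a - a') * b'\<bar>" by (simp add: algebra_simps)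
  also have "\<dots> \<le> \<bar>a\<bar> * \<bar>b - b'\<bar> + \<bar>a - a'\<bar> * \<bar>b'\<bar>" by (metis abs_mult abs_triangle_ineq)
  also have "\<dots> \<le> 1 * d + d * 1" using assms by (intro add_mono mult_mono) auto
  finally show ?thesis by simp
qed

lemma norm_cell_flow_diff_le:
  assumes "\<bar>sin (pi * (fst x - fst y))\<bar> \<le> \<delta>" "\<bar>sin (pi * (snd x - snd y))\<bar> \<le> \<delta>"
  shows "norm (cell_flow (real m *\<^sub>R x) - cell_flow (real m *\<^sub>R y)) \<le> 64 * real m * \<delta>"
proof -
  let ?s = "\<lambda>a. sin (2 * pi * real m * a)" and ?c = "\<lambda>a. cos (2 * pi * real m * a)"
  define d where "d = 2 * real m * \<delta>"
  have diff: "\<bar>?s a - ?s b\<bar> \<le> d" "\<bar>?c a - ?c b\<bar> \<le> d" if "\<bar>sin (pi * (a - b))\<bar> \<le> \<delta>" for a b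
    using abs_sin_diff_le[of m a b] abs_cos_diff_le[of m a b] mult_left_mono[OF that, of "2 * real m"]
    unfolding d_def by simp_all
  define components where "components = \<bar>?s (fst x) * ?c (snd x) - ?s (fst y) * ?c (snd y)\<bar>
    + \<bar>?c (fst x) * ?s (snd x) - ?c (fst y) * ?s (snd y)\<bar>"
  have "components \<le> 2 * d + 2 * d"
    unfolding components_def by (intro add_mono abs_mult_diff_le diff assms) auto
  then have "2 * pi * components \<le> 8 * (2 * d + 2 * d)"
    using pi_less_4 unfolding components_def by (intro mult_mono) auto
  moreover have "norm (cell_flow (real m *\<^sub>R x) - cell_flow (real m *\<^sub>R y)) \<le> 2 * pi * components"
    by (rule order_trans[OF norm_le_abs_fst_snd])
      (simp add: cell_flow_scaleR components_def distrib_left abs_mult flip: right_diff_distrib)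
  moreover have "8 * (2 * d + 2 * d) = 64 * real m * \<delta>" unfolding d_def by simp
  ultimately show ?thesis by linarith
qed

lemma sin_cos_2pi_nat_periodic:
  shows "sin (2 * pi * real m * (a + of_int k)) = sin (2 * pi * real m * a)"
    and "cos (2 * pi * real m * (a + of_int k)) = cos (2 * pi * real m * a)"
proof -
  have shift: "2 * pi * real m * (a + of_int k) = 2 * pi * real m * a + 2 * pi * of_int (int m * k)"
    by (simp add: algebra_simps)
  have period: "sin (2 * pi * of_int j) = 0" "cos (2 * pi * of_int j) = 1" for j
    using sin_int_2pin[of j] cos_int_2pin[of j] by (auto simp: mult_ac)
  show "sin (2 * pi * real m * (a + of_int k)) = sin (2 * pi * real m * a)"
    "cos (2 * pi * real m * (a + of_int k)) = cos (2 * pi * real m * a)"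
    unfolding shift sin_add cos_add period by auto
qed

lemma
  shows periodic_C1_fst_cellular_flow: "periodic_C1 (\<lambda>x. fst (cellular_flow A m x)) (cellular_grad_fst A m)"
    and periodic_C1_snd_cellular_flow: "periodic_C1 (\<lambda>x. snd (cellular_flow A m x)) (cellular_grad_snd A m)"
proof -
  let ?s = "\<lambda>a. sin (2 * pi * real m * a)" and ?c = "\<lambda>a. cos (2 * pi * real m * a)"
  have DERIV: "(?s has_field_derivative 2 * pi * real m * ?c a) (at a)"
    "(?c has_field_derivative - (2 * pi * real m * ?s a)) (at a)" for a
    by (auto intro!: derivative_eq_intros)
  have "GDERIV (\<lambda>x. (- (A * (2 * pi)) * ?s (fst x)) * ?c (snd x)) x :> cellular_grad_fst A m x" for x
    using GDERIV_fst_mult_snd[where x = x, OF DERIV_cmult[OF DERIV(1), where c = "- (A * (2 * pi))"] DERIV(2)]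
    unfolding cellular_grad_fst_def by (simp add: power2_eq_square mult_ac)
  then have "periodic_C1 (\<lambda>x. (- (A * (2 * pi)) * ?s (fst x)) * ?c (snd x)) (cellular_grad_fst A m)"
    unfolding periodic_C1_def periodic_x_def
    by (simp add: sin_cos_2pi_nat_periodic cellular_grad_fst_def[abs_def] continuous_intros)
  then show "periodic_C1 (\<lambda>x. fst (cellular_flow A m x)) (cellular_grad_fst A m)"
    by (simp add: cell_flow_scaleR mult.assoc)
  have "GDERIV (\<lambda>x. (A * (2 * pi) * ?c (fst x)) * ?s (snd x)) x :> cellular_grad_snd A m x" for x
    using GDERIV_fst_mult_snd[where x = x, OF DERIV_cmult[OF DERIV(2), where c = "A * (2 * pi)"] DERIV(1)]
    unfolding cellular_grad_snd_def by (simp add: power2_eq_square mult_ac)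
  then have "periodic_C1 (\<lambda>x. (A * (2 * pi) * ?c (fst x)) * ?s (snd x)) (cellular_grad_snd A m)"
    unfolding periodic_C1_def periodic_x_def
    by (simp add: sin_cos_2pi_nat_periodic cellular_grad_snd_def[abs_def] continuous_intros)
  then show "periodic_C1 (\<lambda>x. snd (cellular_flow A m x)) (cellular_grad_snd A m)"
    by (simp add: cell_flow_scaleR mult.assoc)
qed

lemma divergence_free_flow_cellular:
  assumes "0 \<le> A"
  shows "divergence_free_flow (cellular_flow A m) (cellular_grad_fst A m) (cellular_grad_snd A m) (64 * A * real m)"
proof
  show "fst (cellular_grad_fst A m x) + snd (cellular_grad_snd A m x) = 0" for x
    unfolding cellular_grad_fst_def cellular_grad_snd_def by simp
  show "norm (cellular_flow A m x - cellular_flow A m y) \<le> 64 * A * real m * \<delta>"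
    if "\<bar>sin (pi * (fst x - fst y))\<bar> \<le> \<delta>" "\<bar>sin (pi * (snd x - snd y))\<bar> \<le> \<delta>" for x y \<delta>
    using mult_left_mono[OF norm_cell_flow_diff_le[OF that, of m] assms] assms
    by (simp add: mult_ac flip: scaleR_diff_right)
qed (rule periodic_C1_fst_cellular_flow periodic_C1_snd_cellular_flow)+

definition spacing :: "nat \<Rightarrow> real" where
  "spacing m = 1 / (2 * real m)"

definition grid_point :: "nat \<Rightarrow> nat \<Rightarrow> nat \<Rightarrow> real \<times> real" where
  "grid_point m i j = (real i * spacing m, real j * spacing m)"

definition separatrix :: "nat \<Rightarrow> real \<times> real \<Rightarrow> real \<times> real \<Rightarrow> bool" where
  "separatrix m c e \<longleftrightarrow> norm e = 1 \<and>
     (\<exists>\<sigma>. \<bar>\<sigma>\<bar> = 1 \<and> (\<forall>z. cell_flow (real m *\<^sub>R (c + z *\<^sub>R e)) = (\<sigma> * (2 * pi * sin (pi * (z / spacing m)))) *\<^sub>R e))"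

lemma
  assumes "0 < m"
  shows spacing_pos: "0 < spacing m"
    and spacing_le_1: "spacing m \<le> 1"
  using assms unfolding spacing_def by (auto simp: field_simps)

lemma
  assumes "0 < m"
  shows separatrix_horizontal: "separatrix m (grid_point m i j) (1, 0)"
    and separatrix_vertical: "separatrix m (grid_point m i j) (0, 1)"
proof -
  have angle: "2 * pi * real m * (real k * spacing m + z) = real k * pi + pi * (z / spacing m)"
    "2 * pi * real m * (real k * spacing m) = real k * pi" for k z
    using assms unfolding spacing_def by (auto simp: field_simps)
  have values_at_multiples: "sin (real k * pi + y) = (-1) ^ k * sin y" "cos (real k * pi) = (-1) ^ k" "sin (real k * pi) = 0" for k y
    by (auto simp: sin_add)
  show "separatrix m (grid_point m i j) (1, 0)"
    unfolding separatrix_def grid_point_def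
    by (intro conjI exI[of _ "- ((-1) ^ i * (-1) ^ j)"] allI, unfold cell_flow_scaleR)
      (auto simp: angle values_at_multiples abs_mult power_abs)
  show "separatrix m (grid_point m i j) (0, 1)"
    unfolding separatrix_def grid_point_def
    by (intro conjI exI[of _ "(-1) ^ i * (-1) ^ j"] allI, unfold cell_flow_scaleR)
      (auto simp: angle values_at_multiples abs_mult power_abs)
qed

lemma one_le_abs_sin_mult:
  assumes "0 < z" "z < h" "h \<le> 1"
  shows "1 \<le> \<bar>sin (pi * (z / h))\<bar> * (1 / z + 1 / (h - z))"
proof -
  define d where "d = min z (h - z)"
  have d: "0 < d" unfolding d_def using assms by simp
  have "z \<le> z / h" "h - z \<le> (h - z) / h" using assms by (simp_all add: le_divide_eq mult_left_le)
  moreover have "(h - z) / h = 1 - z / h" "\<bar>z / h\<bar> = z / h" using assms by (simp_all add: diff_divide_distrib)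
  ultimately have "d \<le> min \<bar>z / h\<bar> (1 - \<bar>z / h\<bar>)" unfolding d_def by auto
  also have "\<dots> \<le> 2 * min \<bar>z / h\<bar> (1 - \<bar>z / h\<bar>)" using d calculation by simp
  also have "\<dots> \<le> \<bar>sin (pi * (z / h))\<bar>" using assms by (intro abs_sin_pi_ge) simp
  finally have "d \<le> \<bar>sin (pi * (z / h))\<bar>" .
  moreover have "1 / d \<le> 1 / z + 1 / (h - z)" unfolding d_def using assms by (auto simp: min_def)
  ultimately have "d * (1 / d) \<le> \<bar>sin (pi * (z / h))\<bar> * (1 / z + 1 / (h - z))"
    using d by (intro mult_mono) auto
  then show ?thesis using d by simp
qed

text \<open>The logarithm is the travel time along the separatrix between two points at distance $r$ from
  the stagnation points at its ends.\<close>

lemma travel_time_bound: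
  fixes G G' :: "real \<Rightarrow> real"
  assumes deriv: "\<And>z. (G has_field_derivative G' z) (at z)"
    and transport: "\<And>z. r \<le> z \<Longrightarrow> z \<le> h - r \<Longrightarrow> \<bar>sin (pi * (z / h))\<bar> * \<bar>G' z\<bar> \<le> \<kappa>"
    and r: "0 < r" and h: "h \<le> 1" and z: "r \<le> z" "z \<le> h - r"
  shows "G z \<le> G r + 2 * \<kappa> * ln (1 / r)"
proof -
  have \<kappa>: "0 \<le> \<kappa>" using transport[OF z] by (rule order_trans[rotated]) simp
  have abs_G': "\<bar>G' x\<bar> \<le> \<kappa> * (1 / x + 1 / (h - x))" if x: "r \<le> x" "x \<le> h - r" for x
  proof -
    have "0 < x" "x < h" using x r by auto
    then have "\<bar>G' x\<bar> * 1 \<le> \<bar>G' x\<bar> * (\<bar>sin (pi * (x / h))\<bar> * (1 / x + 1 / (h - x)))"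
      using h by (intro mult_left_mono one_le_abs_sin_mult) auto
    also have "\<dots> = \<bar>sin (pi * (x / h))\<bar> * \<bar>G' x\<bar> * (1 / x + 1 / (h - x))" by simp
    also have "\<dots> \<le> \<kappa> * (1 / x + 1 / (h - x))"
      using \<open>0 < x\<close> \<open>x < h\<close> by (intro mult_right_mono transport x) auto
    finally show ?thesis by simp
  qed
  define \<Psi> where "\<Psi> x = \<kappa> * (ln x - ln (h - x)) - G x" for x
  have "\<Psi> r \<le> \<Psi> z"
  proof (rule DERIV_nonneg_imp_nondecreasing[OF z(1)])
    fix x assume "r \<le> x" "x \<le> z"
    then have x: "r \<le> x" "x \<le> h - r" "0 < x" "0 < h - x" using z r by auto
    have "(\<Psi> has_field_derivative (\<kappa> * (1 / x - (1 / (h - x)) * (0 - 1)) - G' x)) (at x)"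
      unfolding \<Psi>_def[abs_def] using x
      by (intro DERIV_diff DERIV_cmult deriv DERIV_ln_divide DERIV_chain2[OF DERIV_ln_divide] derivative_intros) auto
    moreover have "0 \<le> \<kappa> * (1 / x - (1 / (h - x)) * (0 - 1)) - G' x" using abs_G'[OF x(1,2)] by simp
    ultimately show "\<exists>y. (\<Psi> has_real_derivative y) (at x) \<and> 0 \<le> y" by blast
  qed
  then have "G z \<le> G r + \<kappa> * ((ln z - ln (h - z)) - (ln r - ln (h - r)))"
    unfolding \<Psi>_def by (simp add: algebra_simps)
  moreover have "ln z \<le> 0" "ln (h - r) \<le> 0" "ln r \<le> ln (h - z)" "ln (1 / r) = - ln r"
    using z h r by (auto simp: ln_div)
  then have "\<kappa> * ((ln z - ln (h - z)) - (ln r - ln (h - r))) \<le> \<kappa> * (2 * ln (1 / r))"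
    by (intro mult_left_mono \<kappa>) linarith
  ultimately show ?thesis by (simp add: mult_ac)
qed

definition grid_floor :: "nat \<Rightarrow> real \<Rightarrow> real" where
  "grid_floor m s = real_of_int \<lfloor>2 * real m * s\<rfloor> / (2 * real m)"

lemma borel_measurable_grid_floor [measurable]: "grid_floor m \<in> borel_measurable borel"
  unfolding grid_floor_def[abs_def] by measurable

lemma grid_floor:
  assumes "0 < m" "s \<in> {0..1}"
  obtains i where "grid_floor m s = real i * spacing m" "i \<le> 2 * m"
    "0 \<le> s - grid_floor m s" "s - grid_floor m s \<le> spacing m"
proof -
  define i where "i = nat \<lfloor>2 * real m * s\<rfloor>"
  have real_i: "real i = real_of_int \<lfloor>2 * real m * s\<rfloor>" unfolding i_def using assms by simp
  have scale: "0 < 2 * real m" using assms by simp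
  have floor: "real i \<le> 2 * real m * s" "2 * real m * s \<le> real i + 1" unfolding real_i by linarith+
  have i: "grid_floor m s = real i / (2 * real m)" unfolding grid_floor_def real_i ..
  show thesis
  proof (rule that[of i])
    show "grid_floor m s = real i * spacing m" unfolding i spacing_def by simp
    have "2 * real m * s \<le> 2 * real m * 1" using assms by (intro mult_left_mono) auto
    then have "real i \<le> real (2 * m)" using floor by simp
    then show "i \<le> 2 * m" by (simp only: of_nat_le_iff)
    show "0 \<le> s - grid_floor m s" unfolding i using floor(1) scale by (simp add: divide_le_eq mult.commute)
    have "s \<le> (real i + 1) / (2 * real m)" using floor(2) scale by (simp add: le_divide_eq mult.commute)
    then show "s - grid_floor m s \<le> spacing m" unfolding i spacing_def by (simp add: add_divide_distrib)
  qed
qed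

lemma grid_floor_bounds:
  assumes "0 < m" "s \<in> {0..1}"
  shows "grid_floor m s \<in> {0..1} \<and> \<bar>s - grid_floor m s\<bar> \<le> spacing m"
proof -
  obtain i where i: "grid_floor m s = real i * spacing m" "0 \<le> s - grid_floor m s" "s - grid_floor m s \<le> spacing m"
    using grid_floor[OF assms] by blast
  moreover have "0 \<le> real i * spacing m" using spacing_pos[OF assms(1)] by simp
  ultimately show ?thesis using assms(2) by auto
qed

section \<open>Decay in a cellular flow\<close>

definition edge_error :: "real \<Rightarrow> real \<Rightarrow> real \<Rightarrow> nat \<Rightarrow> real \<Rightarrow> nat \<Rightarrow> real" where
  "edge_error p \<nu> B m A n = 2048 * (defect p n)\<^sup>2 * B
     + 8 * ln (1 / radius n) * (64 * real m * defect p n * (1024 * B) + residual_bound \<nu> B n / A)"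

lemma ln_inverse_radius_nonneg: "0 \<le> ln (1 / radius n)"
  using radius_pos[of n] radius_le_1[of n] by simp

lemma residual_bound_nonneg:
  assumes "0 \<le> \<nu>" "0 \<le> B"
  shows "0 \<le> residual_bound \<nu> B n"
  unfolding residual_bound_def using assms kernel_bound_pos[of n] kernel_grad_bound_nonneg[of n] by (simp add: less_imp_le)

locale cellular_solution =
  dissipation_bounded_solution "cellular_flow A m" "cellular_grad_fst A m" "cellular_grad_snd A m" "64 * A * real m"
    p \<nu> \<theta>0 \<theta> g \<tau> B
  for A m p \<nu> \<theta>0 \<theta> g \<tau> B +
  fixes n :: nat
  assumes A: "0 < A" and m: "0 < m"
    and mean_zero: "(LINT x|torus. \<theta>0 x) = 0"
    and fine_mollification: "2 * radius n < spacing m"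
    and small_defect: "4 * ln (1 / radius n) * (64 * real m * defect p n) \<le> 1 / 2"
begin

lemma edge_error_nonneg: "0 \<le> edge_error p \<nu> B m A n"
  unfolding edge_error_def
  using A B_nonneg nu defect_pos[of p n] ln_inverse_radius_nonneg[of n] residual_bound_nonneg[of \<nu> B n]
  by (intro add_nonneg_nonneg mult_nonneg_nonneg) (auto simp: less_imp_le)

lemma separatrix_stagnation_point:
  assumes "separatrix m c e"
  shows "cellular_flow A m c = 0"
proof -
  obtain \<sigma> where "\<forall>z. cell_flow (real m *\<^sub>R (c + z *\<^sub>R e)) = (\<sigma> * (2 * pi * sin (pi * (z / spacing m)))) *\<^sub>R e"
    using assms unfolding separatrix_def by blast
  from this[rule_format, of 0] show ?thesis by simp
qed

lemma separatrix_gap_grad_le: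
  assumes "separatrix m c e"
  shows "\<bar>sin (pi * (z / spacing m))\<bar> * \<bar>e \<bullet> gap_grad n (c + z *\<^sub>R e) c\<bar>
    \<le> 64 * real m * defect p n * (gap n (c + z *\<^sub>R e) c + 1024 * B) + residual_bound \<nu> B n / A"
proof -
  define x where "x = c + z *\<^sub>R e"
  define s where "s = \<bar>sin (pi * (z / spacing m))\<bar> * \<bar>e \<bullet> gap_grad n x c\<bar>"
  obtain \<sigma> where \<sigma>: "\<bar>\<sigma>\<bar> = 1" and flow: "cell_flow (real m *\<^sub>R x) = (\<sigma> * (2 * pi * sin (pi * (z / spacing m)))) *\<^sub>R e"
    using assms unfolding separatrix_def x_def by blast
  have "1 * s \<le> 2 * pi * s" unfolding s_def using pi_gt3 by (intro mult_right_mono) auto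
  then have "A * s \<le> A * (2 * pi * s)" using A by simp
  also have "\<dots> = \<bar>cellular_flow A m x \<bullet> gap_grad n x c\<bar>"
    unfolding flow s_def using A \<sigma> by (simp add: abs_mult)
  also have "\<dots> \<le> 64 * A * real m * defect p n * (gap n x c + 1024 * B) + residual_bound \<nu> B n"
    by (rule abs_velocity_gap_grad_le[OF separatrix_stagnation_point[OF assms]])
  also have "\<dots> = A * (64 * real m * defect p n * (gap n x c + 1024 * B) + residual_bound \<nu> B n / A)"
    using A by (simp add: distrib_left)
  finally show ?thesis using A unfolding s_def x_def by simp
qed

lemma gap_near_on_separatrix:
  assumes "separatrix m c e" "\<bar>z - z'\<bar> \<le> radius n"
  shows "gap n (c + z *\<^sub>R e) (c + z' *\<^sub>R e) \<le> 256 * (defect p n)\<^sup>2 * B"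
proof (rule gap_le_of_near)
  show "norm ((c + z *\<^sub>R e) - (c + z' *\<^sub>R e)) \<le> radius n"
    using assms unfolding separatrix_def by (simp flip: scaleR_diff_left)
qed

lemma gap_inside_separatrix:
  assumes sep: "separatrix m c e"
    and bound: "\<And>z. z \<in> {0..spacing m} \<Longrightarrow> gap n (c + z *\<^sub>R e) c \<le> M"
    and z: "radius n \<le> z" "z \<le> spacing m - radius n"
  shows "gap n (c + z *\<^sub>R e) c \<le> 256 * (defect p n)\<^sup>2 * B
    + 2 * (64 * real m * defect p n * (M + 1024 * B) + residual_bound \<nu> B n / A) * ln (1 / radius n)"
proof -
  have "gap n (c + z *\<^sub>R e) c \<le> gap n (c + radius n *\<^sub>R e) c
      + 2 * (64 * real m * defect p n * (M + 1024 * B) + residual_bound \<nu> B n / A) * ln (1 / radius n)"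
  proof (rule travel_time_bound[OF _ _ radius_pos spacing_le_1[OF m] z])
    show "((\<lambda>z. gap n (c + z *\<^sub>R e) c) has_field_derivative e \<bullet> gap_grad n (c + z *\<^sub>R e) c) (at z)" for z
      by (rule GDERIV_imp_DERIV_line[OF GDERIV_gap])
    fix z assume "radius n \<le> z" "z \<le> spacing m - radius n"
    then have "z \<in> {0..spacing m}" using radius_pos[of n] unfolding atLeastAtMost_iff by linarith
    then have "64 * real m * defect p n * (gap n (c + z *\<^sub>R e) c + 1024 * B)
        \<le> 64 * real m * defect p n * (M + 1024 * B)"
      using bound defect_pos[of p n] by (intro mult_left_mono) (auto simp: less_imp_le)
    then show "\<bar>sin (pi * (z / spacing m))\<bar> * \<bar>e \<bullet> gap_grad n (c + z *\<^sub>R e) c\<bar>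
        \<le> 64 * real m * defect p n * (M + 1024 * B) + residual_bound \<nu> B n / A"
      using separatrix_gap_grad_le[OF sep, of z] by linarith
  qed
  then show ?thesis
    using gap_near_on_separatrix[OF sep, of "radius n" 0] radius_pos[of n] by simp
qed

lemma gap_on_separatrix_le_of_bound:
  assumes sep: "separatrix m c e"
    and bound: "\<And>z. z \<in> {0..spacing m} \<Longrightarrow> gap n (c + z *\<^sub>R e) c \<le> M" and z: "z \<in> {0..spacing m}"
  shows "gap n (c + z *\<^sub>R e) c \<le> 1024 * (defect p n)\<^sup>2 * B
    + 4 * ln (1 / radius n) * (64 * real m * defect p n * (M + 1024 * B) + residual_bound \<nu> B n / A)"
    (is "_ \<le> _ + 4 * ?l * ?\<kappa>")
proof -
  define s where "s = 256 * (defect p n)\<^sup>2 * B"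
  have s: "0 \<le> s" unfolding s_def using B_nonneg by simp
  have \<kappa>: "0 \<le> ?\<kappa>"
    using separatrix_gap_grad_le[OF sep, of 0] bound[of 0] spacing_pos[OF m] gap_nonneg[of n c c] B_nonneg A nu
      residual_bound_nonneg[of \<nu> B n] defect_pos[of p n]
    by (intro add_nonneg_nonneg mult_nonneg_nonneg) (auto simp: less_imp_le)
  then have l\<kappa>: "0 \<le> ?l * ?\<kappa>" using ln_inverse_radius_nonneg[of n] by simp
  have interior: "gap n (c + z *\<^sub>R e) c \<le> s + 2 * (?l * ?\<kappa>)"
    if "radius n \<le> z" "z \<le> spacing m - radius n" for z
    using gap_inside_separatrix[OF sep bound that] unfolding s_def by (simp only: mult_ac)
  have near_corner: "gap n (c + z *\<^sub>R e) c \<le> s" if "z \<le> radius n"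
    using gap_near_on_separatrix[OF sep, of z 0] z that unfolding s_def by simp
  consider (start) "z \<le> radius n" | (inside) "radius n \<le> z" "z \<le> spacing m - radius n"
    | (end_point) "spacing m - radius n \<le> z" by linarith
  then have "gap n (c + z *\<^sub>R e) c \<le> 4 * s + 4 * (?l * ?\<kappa>)"
  proof cases
    case start
    then show ?thesis using near_corner s l\<kappa> by linarith
  next
    case inside
    then show ?thesis using interior[of z] s l\<kappa> by linarith
  next
    case end_point
    have "gap n (c + z *\<^sub>R e) (c + (spacing m - radius n) *\<^sub>R e) \<le> s"
      unfolding s_def by (rule gap_near_on_separatrix[OF sep]) (use end_point z in auto)
    moreover have "gap n (c + (spacing m - radius n) *\<^sub>R e) c \<le> s + 2 * (?l * ?\<kappa>)"
      by (rule interior) (use fine_mollification in auto)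
    ultimately show ?thesis
      using gap_triangle[of n "c + z *\<^sub>R e" c "c + (spacing m - radius n) *\<^sub>R e"] by linarith
  qed
  then show ?thesis unfolding s_def by simp
qed

text \<open>The supremum of the gap occurs on both sides of the bound and is absorbed.\<close>

lemma gap_on_separatrix_le:
  assumes sep: "separatrix m c e" and z: "z \<in> {0..spacing m}"
  shows "gap n (c + z *\<^sub>R e) c \<le> edge_error p \<nu> B m A n"
proof -
  define M where "M = (SUP z\<in>{0..spacing m}. gap n (c + z *\<^sub>R e) c)"
  have "bdd_above ((\<lambda>z. gap n (c + z *\<^sub>R e) c) ` {0..spacing m})" by (rule bdd_aboveI2) (rule gap_le_bound)
  then have bound: "gap n (c + z *\<^sub>R e) c \<le> M" if "z \<in> {0..spacing m}" for z
    unfolding M_def using that by (intro cSUP_upper)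
  have "0 \<le> M" using bound[of 0] spacing_pos[OF m] by (simp add: gap_self)
  have "M \<le> 1024 * (defect p n)\<^sup>2 * B
      + 4 * ln (1 / radius n) * (64 * real m * defect p n * (M + 1024 * B) + residual_bound \<nu> B n / A)"
    unfolding M_def
    using gap_on_separatrix_le_of_bound[OF sep bound] spacing_pos[OF m] by (intro cSUP_least) (auto simp: M_def)
  also have "\<dots> = 4 * ln (1 / radius n) * (64 * real m * defect p n) * M + edge_error p \<nu> B m A n / 2"
    unfolding edge_error_def by (simp add: algebra_simps)
  also have "\<dots> \<le> 1 / 2 * M + edge_error p \<nu> B m A n / 2"
    using mult_right_mono[OF small_defect \<open>0 \<le> M\<close>] by simp
  finally show ?thesis using bound[OF z] by simp
qed

lemma gap_step_along_separatrix:
  assumes "separatrix m c e" "gap n c y \<le> 4 ^ k * edge_error p \<nu> B m A n" "z \<in> {0..spacing m}"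
  shows "gap n (c + z *\<^sub>R e) y \<le> 4 ^ Suc k * edge_error p \<nu> B m A n"
proof -
  have "gap n (c + z *\<^sub>R e) y \<le> 2 * edge_error p \<nu> B m A n + 2 * (4 ^ k * edge_error p \<nu> B m A n)"
    using gap_triangle[of n "c + z *\<^sub>R e" y c] gap_on_separatrix_le[OF assms(1,3)] assms(2) by linarith
  also have "\<dots> \<le> 2 * (4 ^ k * edge_error p \<nu> B m A n) + 2 * (4 ^ k * edge_error p \<nu> B m A n)"
    using mult_right_mono[OF one_le_power[of "4::real" k] edge_error_nonneg] by simp
  finally show ?thesis by simp
qed

lemma gap_grid_point_le: "gap n (grid_point m i j) (grid_point m 0 0) \<le> 4 ^ (i + j) * edge_error p \<nu> B m A n"
proof (induction i)
  case 0
  show ?case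
  proof (induction j)
    case 0
    show ?case using edge_error_nonneg by (simp add: gap_self)
  next
    case (Suc j)
    have "grid_point m 0 (Suc j) = grid_point m 0 j + spacing m *\<^sub>R (0, 1)"
      unfolding grid_point_def by (simp add: distrib_right)
    then show ?case using gap_step_along_separatrix[OF separatrix_vertical[OF m] Suc] spacing_pos[OF m] by simp
  qed
next
  case (Suc i)
  have "grid_point m (Suc i) j = grid_point m i j + spacing m *\<^sub>R (1, 0)"
    unfolding grid_point_def by (simp add: distrib_right)
  then show ?case using gap_step_along_separatrix[OF separatrix_horizontal[OF m] Suc] spacing_pos[OF m] by simp
qed

lemma gap_grid_row_le:
  assumes "x \<in> cell"
  shows "gap n (fst x, grid_floor m (snd x)) (grid_point m 0 0) \<le> 4 ^ (4 * m + 1) * edge_error p \<nu> B m A n"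
proof -
  have x: "fst x \<in> {0..1}" "snd x \<in> {0..1}" using assms unfolding cell_def by auto
  obtain i where i: "grid_floor m (fst x) = real i * spacing m" "i \<le> 2 * m"
    "0 \<le> fst x - grid_floor m (fst x)" "fst x - grid_floor m (fst x) \<le> spacing m"
    using grid_floor[OF m x(1)] .
  obtain j where j: "grid_floor m (snd x) = real j * spacing m" "j \<le> 2 * m" using grid_floor[OF m x(2)] .
  have "(fst x, grid_floor m (snd x)) = grid_point m i j + (fst x - grid_floor m (fst x)) *\<^sub>R (1, 0)"
    unfolding grid_point_def i(1) j(1) by simp
  then have "gap n (fst x, grid_floor m (snd x)) (grid_point m 0 0) \<le> 4 ^ Suc (i + j) * edge_error p \<nu> B m A n"
    using gap_step_along_separatrix[OF separatrix_horizontal[OF m] gap_grid_point_le] i(3,4) by simp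
  also have "\<dots> \<le> 4 ^ (4 * m + 1) * edge_error p \<nu> B m A n"
    using i(2) j(2) by (intro mult_right_mono edge_error_nonneg power_increasing) auto
  finally show ?thesis .
qed

definition row_deviation :: "real \<Rightarrow> real" where
  "row_deviation t = (LINT x|torus. (increment n (fst x, grid_floor m (snd x)) (grid_point m 0 0) t)\<^sup>2)"

lemma
  shows row_deviation_integrable: "integrable (time \<tau>) row_deviation"
    and integral_row_deviation_le:
      "(LINT t|time \<tau>. row_deviation t) \<le> 4 ^ (4 * m + 1) * edge_error p \<nu> B m A n"
proof -
  let ?f = "\<lambda>x t. (increment n (fst x, grid_floor m (snd x)) (grid_point m 0 0) t)\<^sup>2"
  have "integrable (spacetime \<tau>) (\<lambda>z. ?f (fst z) (snd z))"
  proof (rule spacetime.integrable_const_bound[where B = "(4 * kernel_bound n)\<^sup>2"])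
    show "AE z in spacetime \<tau>. norm (?f (fst z) (snd z)) \<le> (4 * kernel_bound n)\<^sup>2"
      unfolding spacetime_eq AE_lborel_on[OF cell_Times_sets]
      by (auto simp only: real_norm_def abs_power2 mem_Times_iff atLeastAtMost_iff intro!: AE_I2 increment_power2_le_bound)
  qed measurable
  then have pair: "integrable (spacetime \<tau>) (\<lambda>(x, t). ?f x t)" by (simp add: split_beta')
  show "integrable (time \<tau>) row_deviation"
    unfolding row_deviation_def[abs_def] by (rule spacetime.integrable_snd[OF pair])
  have "(LINT t|time \<tau>. row_deviation t) = (LINT x|torus. gap n (fst x, grid_floor m (snd x)) (grid_point m 0 0))"
    unfolding row_deviation_def gap_def by (rule spacetime.Fubini_integral[OF pair])
  also have "\<dots> \<le> (LINT x|torus. 4 ^ (4 * m + 1) * edge_error p \<nu> B m A n)"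
  proof (rule integral_mono_AE)
    show "integrable torus (\<lambda>x. gap n (fst x, grid_floor m (snd x)) (grid_point m 0 0))"
      unfolding gap_def by (rule spacetime.integrable_fst[OF pair])
    show "AE x in torus. gap n (fst x, grid_floor m (snd x)) (grid_point m 0 0) \<le> 4 ^ (4 * m + 1) * edge_error p \<nu> B m A n"
      using AE_torus_cell by eventually_elim (rule gap_grid_row_le)
  qed simp
  finally show "(LINT t|time \<tau>. row_deviation t) \<le> 4 ^ (4 * m + 1) * edge_error p \<nu> B m A n" by simp
qed

lemma energy_le_power2_deviation:
  assumes t: "0 \<le> t"
  shows "energy t \<le> (LINT x|torus. (\<theta> x t - c)\<^sup>2)"
proof -
  have "(LINT x|torus. (\<theta> x t - c)\<^sup>2) = (LINT x|torus. (\<theta> x t)\<^sup>2 - 2 * c * \<theta> x t + c\<^sup>2)"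
    by (simp add: power2_diff algebra_simps)
  also have "\<dots> = energy t - 2 * c * (LINT x|torus. \<theta> x t) + c\<^sup>2"
    unfolding energy_def using theta_integrable[OF t] theta_power2[OF t] by simp
  finally show ?thesis using mean_conserved[OF t] mean_zero by simp
qed

lemma energy_slice_le:
  assumes t: "regular t"
  shows "energy t \<le> (8 * radius n + 4 * spacing m) * (1 + dissipation t) + 4 * row_deviation t"
proof -
  note weak = regular_weak_gradient[OF t] and t_nonneg = regular_nonneg[OF t]
  define F where "F = mollify n (theta_at t)"
  define row where "row x = (fst x, grid_floor m (snd x))" for x :: "real \<times> real"
  define c where "c = F (grid_point m 0 0)"
  have increment: "F x - F y = increment n x y t" for x y unfolding F_def increment_def ..
  have grad: "(LINT x|torus. (norm (g x t))\<^sup>2) \<le> 1 + dissipation t"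
    by (rule integral_le_one_plus_dissipation[OF t norm_grad_power2_le])
  have "continuous_on UNIV F" unfolding F_def by (rule continuous_on_mollify[OF theta_integrable[OF t_nonneg]])
  then have "integrable torus (\<lambda>x. (F x)\<^sup>2)" by (intro integrable_torus_continuous continuous_intros)
  then have smoothing: "integrable torus (\<lambda>x. (\<theta> x t - F x)\<^sup>2)"
    unfolding F_def using theta_power2[OF t_nonneg] by (intro integrable_power2_diff) auto
  have bounded: "integrable torus (\<lambda>x. (increment n (a x) (b x) t)\<^sup>2)"
    if [measurable]: "a \<in> borel_measurable borel" "b \<in> borel_measurable borel" for a b
    by (rule torus.integrable_const_bound[where B = "(4 * kernel_bound n)\<^sup>2"])
      (auto simp only: real_norm_def abs_power2 intro!: AE_I2 increment_power2_le_bound t_nonneg, measurable)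
  have rows: "integrable torus (\<lambda>x. (F x - F (row x))\<^sup>2)" "integrable torus (\<lambda>x. (F (row x) - c)\<^sup>2)"
    unfolding c_def increment row_def by (rule bounded; measurable)+
  have "energy t \<le> (LINT x|torus. (\<theta> x t - c)\<^sup>2)" by (rule energy_le_power2_deviation[OF t_nonneg])
  also have "\<dots> \<le> (LINT x|torus. 2 * (\<theta> x t - F x)\<^sup>2 + 4 * (F x - F (row x))\<^sup>2 + 4 * (F (row x) - c)\<^sup>2)"
  proof (rule integral_mono')
    show "(\<theta> x t - c)\<^sup>2 \<le> 2 * (\<theta> x t - F x)\<^sup>2 + 4 * (F x - F (row x))\<^sup>2 + 4 * (F (row x) - c)\<^sup>2" for x
      using power2_add3_le[of "\<theta> x t - F x" "F x - F (row x)" "F (row x) - c"] by simp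
  qed (use smoothing rows in auto)
  also have "\<dots> = 2 * (LINT x|torus. (\<theta> x t - F x)\<^sup>2) + 4 * (LINT x|torus. (F x - F (row x))\<^sup>2) + 4 * row_deviation t"
    unfolding row_deviation_def increment[symmetric] row_def[symmetric] c_def[symmetric] using smoothing rows by simp
  also have "(LINT x|torus. (\<theta> x t - F x)\<^sup>2) \<le> 4 * radius n * (1 + dissipation t)"
    unfolding F_def
    by (rule order_trans[OF weak_gradient_smoothing[OF weak]]) (intro mult_left_mono grad, simp add: less_imp_le)
  also have "(LINT x|torus. (F x - F (row x))\<^sup>2) \<le> spacing m * (1 + dissipation t)"
    unfolding F_def row_def
    by (rule order_trans[OF weak_gradient_row_bound[OF weak borel_measurable_grid_floor grid_floor_bounds[OF m]]])
      (use spacing_pos[OF m] in \<open>auto intro!: mult_left_mono grad\<close>)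
  finally show ?thesis by (simp add: algebra_simps)
qed

theorem energy_decay:
  assumes "1 / 4 < energy \<tau>"
  shows "\<tau> / 4 \<le> (8 * radius n + 4 * spacing m) * B + 4 ^ (4 * m + 2) * edge_error p \<nu> B m A n"
proof -
  let ?K = "8 * radius n + 4 * spacing m"
  have "AE t in time \<tau>. 1 / 4 \<le> ?K * (1 + dissipation t) + 4 * row_deviation t"
    using AE_regular_tau AE_time
  proof eventually_elim
    case (elim t)
    then show ?case using energy_slice_le[of t] energy_antimono[of t \<tau>] assms by linarith
  qed
  then have "(LINT t|time \<tau>. 1 / 4) \<le> (LINT t|time \<tau>. ?K * (1 + dissipation t) + 4 * row_deviation t)"
    by (intro integral_mono_AE Bochner_Integration.integrable_add integrable_mult_right
        integrable_one_plus_dissipation row_deviation_integrable) auto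
  also have "\<dots> = ?K * (LINT t|time \<tau>. 1 + dissipation t) + 4 * (LINT t|time \<tau>. row_deviation t)"
    using integrable_one_plus_dissipation row_deviation_integrable
    by (subst Bochner_Integration.integral_add) auto
  also have "\<dots> \<le> ?K * B + 4 * (4 ^ (4 * m + 1) * edge_error p \<nu> B m A n)"
    using spacing_pos[OF m]
    by (intro add_mono mult_left_mono dissipation_bound integral_row_deviation_le) (auto simp: add_nonneg_nonneg less_imp_le)
  finally show ?thesis using tau by simp
qed

end

section \<open>Choice of the parameters\<close>

lemma defect_tendsto_0:
  assumes "2 < p"
  shows "defect p \<longlonglongrightarrow> 0"
proof -
  have "(\<lambda>n. radius n powr (1 - 2 / p)) \<longlonglongrightarrow> 0 powr (1 - 2 / p)"
    by (rule tendsto_powr'[OF radius_tendsto_0 tendsto_const]) (use assms in \<open>auto simp: less_imp_le\<close>)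
  then show ?thesis unfolding defect_def[abs_def] by simp
qed

lemma ln_mult_defect_tendsto_0:
  assumes "2 < p"
  shows "(\<lambda>n. ln (1 / radius n) * defect p n) \<longlonglongrightarrow> 0"
proof -
  have "ln (1 / radius n) * defect p n = ln (real (Suc n)) / real (Suc n) powr (1 - 2 / p)" for n
    unfolding radius_def defect_def by (simp add: inverse_eq_divide powr_divide)
  then show ?thesis using LIMSEQ_Suc[OF lim_ln_over_power[of "1 - 2 / p"]] assms by simp
qed

lemma mollification_scale_exists:
  assumes "2 < p" "0 < m" "0 < \<delta>"
  obtains n where "2 * radius n < spacing m" "4 * ln (1 / radius n) * (64 * real m * defect p n) \<le> 1 / 2"
    "8 * radius n * B < \<delta>"
    "C * (2048 * (defect p n)\<^sup>2 * B + 8 * ln (1 / radius n) * (64 * real m * defect p n * (1024 * B))) < \<delta>"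
proof -
  note log_defect = ln_mult_defect_tendsto_0[OF assms(1)]
  have radii: "(\<lambda>n. 2 * radius n) \<longlonglongrightarrow> 2 * 0" "(\<lambda>n. 8 * radius n * B) \<longlonglongrightarrow> 8 * 0 * B"
    by (intro tendsto_intros radius_tendsto_0)+
  have "(\<lambda>n. 256 * real m * (ln (1 / radius n) * defect p n)) \<longlonglongrightarrow> 256 * real m * 0"
    by (intro tendsto_intros log_defect)
  then have small: "(\<lambda>n. 4 * ln (1 / radius n) * (64 * real m * defect p n)) \<longlonglongrightarrow> 0" by (simp add: mult_ac)
  have "(\<lambda>n. C * (2048 * (defect p n)\<^sup>2 * B + 8 * (64 * real m * (1024 * B)) * (ln (1 / radius n) * defect p n)))
      \<longlonglongrightarrow> C * (2048 * 0\<^sup>2 * B + 8 * (64 * real m * (1024 * B)) * 0)"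
    by (intro tendsto_intros log_defect defect_tendsto_0 assms)
  then have error: "(\<lambda>n. C * (2048 * (defect p n)\<^sup>2 * B + 8 * ln (1 / radius n) * (64 * real m * defect p n * (1024 * B)))) \<longlonglongrightarrow> 0"
    by (simp add: mult_ac)
  have "\<forall>\<^sub>F n in sequentially. 2 * radius n < spacing m \<and> 4 * ln (1 / radius n) * (64 * real m * defect p n) < 1 / 2
      \<and> 8 * radius n * B < \<delta>
      \<and> C * (2048 * (defect p n)\<^sup>2 * B + 8 * ln (1 / radius n) * (64 * real m * defect p n * (1024 * B))) < \<delta>"
    by (intro eventually_conj order_tendstoD(2)[OF radii(1)] order_tendstoD(2)[OF radii(2)]
        order_tendstoD(2)[OF small] order_tendstoD(2)[OF error]) (use spacing_pos assms in auto)
  from eventually_happens'[OF sequentially_bot this] show thesis using that less_imp_le by blast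
qed

text \<open>The cell size is chosen first, then the mollification scale, and the amplitude last: it must
  beat the constants \<open>residual_bound\<close>, which blow up with the scale.\<close>

lemma decay_parameters_exist:
  assumes "2 < p" "0 \<le> \<nu>" "0 < \<tau>" "0 \<le> B"
  obtains m n A where "0 < m" "0 < A" "2 * radius n < spacing m"
    "4 * ln (1 / radius n) * (64 * real m * defect p n) \<le> 1 / 2"
    "(8 * radius n + 4 * spacing m) * B + 4 ^ (4 * m + 2) * edge_error p \<nu> B m A n < \<tau> / 4"
proof -
  obtain m :: nat where large: "32 * B / \<tau> < real m" using reals_Archimedean2 by blast
  moreover have "0 \<le> 32 * B / \<tau>" using assms by simp
  ultimately have "0 < real m" by linarith
  then have m: "0 < m" "32 * B < \<tau> * real m" using large assms by (simp_all add: divide_less_eq mult.commute)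
  then have cells: "4 * spacing m * B < \<tau> / 16" unfolding spacing_def by (simp add: field_simps)
  define C where "C = (4::real) ^ (4 * m + 2)"
  obtain n where n: "2 * radius n < spacing m" "4 * ln (1 / radius n) * (64 * real m * defect p n) \<le> 1 / 2"
    "8 * radius n * B < \<tau> / 16"
    "C * (2048 * (defect p n)\<^sup>2 * B + 8 * ln (1 / radius n) * (64 * real m * defect p n * (1024 * B))) < \<tau> / 16"
    using mollification_scale_exists[of p m "\<tau> / 16" B C] assms m by auto
  define R where "R = C * (8 * ln (1 / radius n) * residual_bound \<nu> B n)"
  define A where "A = 16 * R / \<tau> + 1"
  have "0 \<le> R"
    unfolding R_def C_def using ln_inverse_radius_nonneg[of n] residual_bound_nonneg[of \<nu> B n] assms by simp
  then have A: "0 < A" unfolding A_def using assms by (simp add: add_nonneg_pos)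
  have "16 * R < \<tau> * A" unfolding A_def using assms by (simp add: distrib_left)
  then have amplitude: "R / A < \<tau> / 16" using A by (simp add: field_simps)
  have "(8 * radius n + 4 * spacing m) * B + C * edge_error p \<nu> B m A n
      = 8 * radius n * B + 4 * spacing m * B
        + C * (2048 * (defect p n)\<^sup>2 * B + 8 * ln (1 / radius n) * (64 * real m * defect p n * (1024 * B))) + R / A"
    unfolding edge_error_def R_def by (simp add: algebra_simps)
  then have "(8 * radius n + 4 * spacing m) * B + C * edge_error p \<nu> B m A n < \<tau> / 4"
    using n(3,4) cells amplitude by linarith
  then show thesis using that[OF m(1) A n(1,2)] unfolding C_def by blast
qed

section \<open>Decay of weak solutions\<close>

lemma test_function_measurable:
  assumes "test_function \<psi> D"
  shows "(\<lambda>z. \<psi> (fst z) (snd z)) \<in> borel_measurable borel" "D \<in> borel_measurable borel"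
proof -
  have "isCont (\<lambda>w. \<psi> (fst w) (snd w)) z" for z
    using assms unfolding test_function_def by (meson has_derivative_continuous)
  then show "(\<lambda>z. \<psi> (fst z) (snd z)) \<in> borel_measurable borel"
    by (intro borel_measurable_continuous_onI) (simp add: continuous_at_imp_continuous_on)
  show "D \<in> borel_measurable borel"
    using assms unfolding test_function_def by (intro borel_measurable_continuous_onI) auto
qed

lemma borel_measurable_time_slice:
  fixes f :: "real \<times> real \<Rightarrow> real \<Rightarrow> real"
  assumes "(\<lambda>z. f (fst z) (snd z)) \<in> borel_measurable borel"
  shows "(\<lambda>x. f x t) \<in> borel_measurable borel"
  using measurable_compose[OF borel_measurable_Pair[OF measurable_ident borel_measurable_const] assms, of t] by simp

lemma (in divergence_free_flow) p_laplacian_solution_of_weak_solution: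
  assumes p: "p > 2" and nu: "\<nu> > 0"
    and theta0: "\<theta>0 \<in> borel_measurable lborel" "set_integrable lborel cell (\<lambda>x. (\<theta>0 x)\<^sup>2)"
    and weak: "weak_solution p \<nu> v \<theta>0 \<theta>"
  obtains g where "p_laplacian_solution v Dv1 Dv2 L p \<nu> \<theta>0 \<theta> g"
proof -
  obtain g where theta: "(\<lambda>z. \<theta> (fst z) (snd z)) \<in> borel_measurable borel"
      "\<And>t. 0 \<le> t \<Longrightarrow> set_integrable lborel cell (\<lambda>x. (\<theta> x t)\<^sup>2)"
      "\<And>t. 0 \<le> t \<Longrightarrow> ((\<lambda>s. LINT x:cell|lborel. (\<theta> x s - \<theta> x t)\<^sup>2) \<longlongrightarrow> 0) (at t within {0..})"
    and g: "(\<lambda>z. g (fst z) (snd z)) \<in> borel_measurable borel"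
      "\<And>T. 0 \<le> T \<Longrightarrow> set_integrable lborel (cell \<times> {0..T}) (\<lambda>z. norm (g (fst z) (snd z)) powr p)"
    and gradient: "\<And>\<psi> D T. test_function \<psi> D \<Longrightarrow> 0 \<le> T \<Longrightarrow>
        (LINT z:(cell \<times> {0..T})|lborel. \<theta> (fst z) (snd z) *\<^sub>R fst (D z))
        = - (LINT z:(cell \<times> {0..T})|lborel. \<psi> (fst z) (snd z) *\<^sub>R g (fst z) (snd z))"
    and evolution: "\<And>\<psi> D t. test_function \<psi> D \<Longrightarrow> 0 \<le> t \<Longrightarrow>
        (LINT x:cell|lborel. \<theta> x t * \<psi> x t) - (LINT x:cell|lborel. \<theta>0 x * \<psi> x 0)
        = (LINT z:(cell \<times> {0..t})|lborel.
             \<theta> (fst z) (snd z) * snd (D z)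
             - inner (v (fst z)) (g (fst z) (snd z)) * \<psi> (fst z) (snd z)
             - \<nu> * norm (g (fst z) (snd z)) powr (p - 2) * inner (g (fst z) (snd z)) (fst (D z)))"
    using weak unfolding weak_solution_def by (elim conjE exE) simp
  note [measurable] = theta(1) g(1) borel_measurable_time_slice[OF theta(1)] theta0(1)[simplified]
  have "p_laplacian_solution v Dv1 Dv2 L p \<nu> \<theta>0 \<theta> g"
  proof (intro p_laplacian_solution.intro p_laplacian_solution_axioms.intro divergence_free_flow_axioms p nu)
    show "integrable torus (\<lambda>x. (\<theta>0 x)\<^sup>2)" "0 \<le> t \<Longrightarrow> integrable torus (\<lambda>x. (\<theta> x t)\<^sup>2)"
      "0 \<le> T \<Longrightarrow> integrable (spacetime T) (\<lambda>z. norm (g (fst z) (snd z)) powr p)" for t T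
      using theta0(2) theta(2) g(2) unfolding spacetime_eq by (simp_all add: integrable_lborel_on)
    show "((\<lambda>s. LINT x|torus. (\<theta> x s - \<theta> x t)\<^sup>2) \<longlongrightarrow> 0) (at t within {0..})" if "0 \<le> t" for t
      using theta(3)[OF that] by (simp add: integral_lborel_on)
    fix \<psi> D and T :: real assume test: "test_function \<psi> D" and T: "0 \<le> T"
    note [measurable] = test_function_measurable[OF test] borel_measurable_time_slice[OF test_function_measurable(1)[OF test]]
    show "(LINT z|spacetime T. \<theta> (fst z) (snd z) *\<^sub>R fst (D z))
        = - (LINT z|spacetime T. \<psi> (fst z) (snd z) *\<^sub>R g (fst z) (snd z))"
      using gradient[OF test T] unfolding spacetime_eq by (simp add: integral_lborel_on)
    show "(LINT x|torus. \<theta> x T * \<psi> x T) - (LINT x|torus. \<theta>0 x * \<psi> x 0)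
        = (LINT z|spacetime T. \<theta> (fst z) (snd z) * snd (D z)
             - inner (v (fst z)) (g (fst z) (snd z)) * \<psi> (fst z) (snd z)
             - \<nu> * norm (g (fst z) (snd z)) powr (p - 2) * inner (g (fst z) (snd z)) (fst (D z)))"
      using evolution[OF test T] unfolding spacetime_eq by (simp add: integral_lborel_on)
  qed measurable
  then show thesis by (rule that)
qed

lemma L2norm_cell_eq:
  assumes [measurable]: "f \<in> borel_measurable borel"
  shows "L2norm_cell f = sqrt (LINT x|torus. (f x)\<^sup>2)"
  unfolding L2norm_cell_def by (simp add: integral_lborel_on)

lemma p_laplacian_energy_decay:
  assumes solution: "p_laplacian_solution (cellular_flow A m) (cellular_grad_fst A m) (cellular_grad_snd A m) (64 * A * real m) p \<nu> \<theta>0 \<theta> g"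
    and initial: "(LINT x|torus. (\<theta>0 x)\<^sup>2) = 1" "(LINT x|torus. \<theta>0 x) = 0"
    and "0 < \<tau>" "0 < m" "0 < A" "2 * radius n < spacing m"
    "4 * ln (1 / radius n) * (64 * real m * defect p n) \<le> 1 / 2"
    and B: "\<tau> + 1 / (2 * \<nu>) \<le> B"
    and small: "(8 * radius n + 4 * spacing m) * B + 4 ^ (4 * m + 2) * edge_error p \<nu> B m A n < \<tau> / 4"
  shows "(LINT x|torus. (\<theta> x \<tau>)\<^sup>2) \<le> 1 / 4"
proof (rule ccontr)
  interpret p_laplacian_solution "cellular_flow A m" "cellular_grad_fst A m" "cellular_grad_snd A m" "64 * A * real m" p \<nu> \<theta>0 \<theta> g
    by (rule solution)
  assume "\<not> (LINT x|torus. (\<theta> x \<tau>)\<^sup>2) \<le> 1 / 4"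
  then have large: "1 / 4 < energy \<tau>" unfolding energy_def by simp
  have "2 * \<nu> * (LINT t|time \<tau>. dissipation t) \<le> 1"
    using energy_identity[of \<tau>] energy_nonneg[of \<tau>] initial(1) \<open>0 < \<tau>\<close> by simp
  then have "(LINT t|time \<tau>. 1 + dissipation t) \<le> \<tau> + 1 / (2 * \<nu>)"
    using nu dissipation_integrable[of \<tau>] \<open>0 < \<tau>\<close> by (simp add: field_simps)
  then interpret cellular_solution A m p \<nu> \<theta>0 \<theta> g \<tau> B n
    by unfold_locales (use assms in auto)
  show False using energy_decay[OF large] small by simp
qed

lemma L2norm_cell_weak_solution_le_half:
  assumes "2 < p" "0 < \<nu>" "0 < \<tau>"
    and theta0: "\<theta>0 \<in> borel_measurable lborel" "set_integrable lborel cell (\<lambda>x. (\<theta>0 x)\<^sup>2)"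
      "(LINT x:cell|lborel. \<theta>0 x) = 0" "L2norm_cell \<theta>0 = 1"
    and weak: "weak_solution p \<nu> (cellular_flow A m) \<theta>0 \<theta>"
    and parameters: "0 < m" "0 < A" "2 * radius n < spacing m"
      "4 * ln (1 / radius n) * (64 * real m * defect p n) \<le> 1 / 2" "\<tau> + 1 / (2 * \<nu>) \<le> B"
      "(8 * radius n + 4 * spacing m) * B + 4 ^ (4 * m + 2) * edge_error p \<nu> B m A n < \<tau> / 4"
  shows "L2norm_cell (\<lambda>x. \<theta> x \<tau>) \<le> 1 / 2"
proof -
  have "divergence_free_flow (cellular_flow A m) (cellular_grad_fst A m) (cellular_grad_snd A m) (64 * A * real m)"
    using parameters(2) by (intro divergence_free_flow_cellular) simp
  then obtain g where solution: "p_laplacian_solution (cellular_flow A m) (cellular_grad_fst A m) (cellular_grad_snd A m)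
      (64 * A * real m) p \<nu> \<theta>0 \<theta> g"
    by (rule divergence_free_flow.p_laplacian_solution_of_weak_solution[OF _ assms(1,2) theta0(1,2) weak])
  have "(LINT x|torus. (\<theta>0 x)\<^sup>2) = 1" "(LINT x|torus. \<theta>0 x) = 0"
    using theta0 by (simp_all add: L2norm_cell_eq integral_lborel_on)
  from p_laplacian_energy_decay[OF solution this assms(3) parameters]
  have "sqrt (LINT x|torus. (\<theta> x \<tau>)\<^sup>2) \<le> sqrt ((1 / 2)\<^sup>2)"
    by (intro real_sqrt_le_mono) (simp add: power2_eq_square)
  moreover have "(\<lambda>x. \<theta> x \<tau>) \<in> borel_measurable borel"
    using weak unfolding weak_solution_def by (intro borel_measurable_time_slice) simp
  ultimately show ?thesis by (simp add: L2norm_cell_eq)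
qed

theorem theorem4p7:
  fixes p \<nu> \<tau> :: real
  assumes "p > 2" and "\<nu> > 0" and "\<tau> > 0"
  shows "\<exists>m::nat. \<exists>A::real. m > 0 \<and>
           (\<forall>\<theta>0 \<theta>.
              \<theta>0 \<in> borel_measurable lborel \<and> periodic_x \<theta>0 \<and>
              set_integrable lborel cell (\<lambda>x. (\<theta>0 x)^2) \<and>
              (LINT x:cell|lborel. \<theta>0 x) = 0 \<and>
              L2norm_cell \<theta>0 = 1 \<and>
              weak_solution p \<nu> (\<lambda>x. A *\<^sub>R cell_flow (real m *\<^sub>R x)) \<theta>0 \<theta>
              \<longrightarrow> L2norm_cell (\<lambda>x. \<theta> x \<tau>) \<le> 1/2)"
proof -
  define B where "B = \<tau> + 1 / (2 * \<nu>)"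
  then have "0 \<le> B" using assms by simp
  then obtain m n A where parameters: "0 < m" "0 < A" "2 * radius n < spacing m"
    "4 * ln (1 / radius n) * (64 * real m * defect p n) \<le> 1 / 2" "\<tau> + 1 / (2 * \<nu>) \<le> B"
    "(8 * radius n + 4 * spacing m) * B + 4 ^ (4 * m + 2) * edge_error p \<nu> B m A n < \<tau> / 4"
    using decay_parameters_exist[of p \<nu> \<tau> B] assms unfolding B_def by (metis order_refl less_imp_le)
  then show ?thesis using L2norm_cell_weak_solution_le_half[OF assms] by blast
qed

end
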